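(* Let $\Sigma$ be a linear compartment model with graph $G$ such that, from every vertex of $G$, at least one leak or input is reachable. Then the field of identifiable functions of $\Sigma$ and the field of IO-identifiable functions of $\Sigma$ coincide.
   Context: **Linear compartment models.** Let $G$ be a simple directed graph with vertex set $V=\{1,\ldots,n\}$ and edge set $E$, and let $\mathrm{In},\mathrm{Out},\mathrm{Leak}\subset V$ with, without loss of generality, $\mathrm{Out}=\{1,\ldots,m\}$, $m\ge1$. The parameters $\bm{\mu}=(\mu_1,\ldots,\mu_\lambda)$ are indeterminates consisting of all $a_{ji}$ for edges $i\to j$ in $E$, all $a_{0i}$ for $i\in\mathrm{Leak}$, and possibly some additional parameters. Let $b_i\in\mathbb{C}(\bm{\mu})\setminus\{0\}$ for $i\in\mathrm{In}$ and $c_i\in\mathbb{C}(\bm{\mu})\setminus\{0\}$ for $i\in\mathrm{Out}$. The matrix $A(G)$ is the $n\times n$ matrix with $A(G)_{ii}=-a_{0i}-\sum_{k:\,i\to k\in E}a_{ki}$ if $i\in\mathrm{Leak}$, $A(G)_{ii}=-\sum_{k:\,i\to k\in E}a_{ki}$ if $i\notin\mathrm{Leak}$, $A(G)_{ij}=a_{ij}$ if $j\to i\in E$, and $A(G)_{ij}=0$ otherwise. The associated *linear compartment model* is the system $\Sigma$: $\mathbf{x}'=A(G)\mathbf{x}+\mathbf{v}$, $y_i=c_i(\bm{\mu})x_i$ for $i\in\mathrm{Out}$, $\mathbf{x}(0)=\mathbf{x}^\ast$, where $\mathbf{v}$ is the column whose $i$-th entry is $b_i(\bm{\mu})u_i$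 if $i\in\mathrm{In}$ and $0$ otherwise. So the states are $\mathbf{x}=(x_1,\ldots,x_n)$, outputs $\mathbf{y}=(y_1,\ldots,y_m)$, inputs $\mathbf{u}=(u_i\mid i\in\mathrm{In})$, $\kappa=|\mathrm{In}|$ ($\mathrm{In}$ may be empty). Write $\Sigma$ as $\mathbf{x}'=\mathbf{f}$, $\mathbf{y}=\mathbf{g}$. Vertex $v$ is *reachable* from vertex $w$ if there is a directed path (possibly of length $0$) from $w$ to $v$; a leak (resp. input) is reachable from $w$ if some $v\in\mathrm{Leak}$ (resp. $v\in\mathrm{In}$) is reachable from $w$. **Identifiability.** $\mathbb{C}^\infty(0)$ is the set of all functions complex analytic in some neighborhood of $t=0$. $\Omega\subset\mathbb{C}^\lambda$ is the complement of the set where at least one of the denominators of the coefficients (in $\mathbb{C}(\bm{\mu})$) of $\Sigma$ vanishes. For $h\in\mathbb{C}(\bm{\mu})$ put $\Omega_h:=\mathbb{C}^n\times\{\hat{\bm{\mu}}\in\Omega\mid h(\hat{\bm{\mu}})\text{ well-defined}\}\times(\mathbb{C}^\infty(0))^\kappa$. For $(\hat{\mathbf{x}}^\ast,\hat{\bm{\mu}},\hat{\mathbf{u}})$ with $\hat{\bm{\mu}}\in\Omega$, $Y(\hat{\mathbf{x}}^\ast,\hat{\bm{\mu}},\hat{\mathbf{u}})$ denotes the $\mathbf{y}$-component of the unique solution over $\mathbb{C}^\infty(0)$ of $\Sigma$ with $\mathbf{x}^\ast=\hat{\mathbf{x}}^\ast$, $\bm{\mu}=\hat{\bm{\mu}}$,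 $\mathbf{u}=\hat{\mathbf{u}}$. A subset of $\mathbb{C}^s$ is Zariski open if it is the complement of the zero set of some polynomial $P$ on $\mathbb{C}^s$; a subset $U\subset(\mathbb{C}^\infty(0))^s$ is Zariski open if there is a polynomial $P$ in $z_1,\ldots,z_s$ and their derivatives with $U=\{\hat{\mathbf z}\in(\mathbb{C}^\infty(0))^s\mid P(\hat{\mathbf z})|_{t=0}\neq0\}$. $\tau(X)$ denotes the set of nonempty Zariski open subsets of $X$. A function $h\in\mathbb{C}(\bm{\mu})$ is *identifiable* if there exist $\Theta\in\tau(\mathbb{C}^n\times\mathbb{C}^\lambda)$ and $U\in\tau((\mathbb{C}^\infty(0))^\kappa)$ such that for all $(\hat{\mathbf{x}}^\ast,\hat{\bm{\mu}},\hat{\mathbf{u}})\in(\Theta\times U)\cap\Omega_h$ one has $|S_h(\hat{\mathbf{x}}^\ast,\hat{\bm{\mu}},\hat{\mathbf{u}})|=1$, where $$S_h(\hat{\mathbf{x}}^\ast,\hat{\bm{\mu}},\hat{\mathbf{u}})=\{h(\tilde{\bm{\mu}})\mid\exists(\tilde{\mathbf{x}}^\ast,\tilde{\bm{\mu}},\hat{\mathbf{u}})\in\Omega_h\text{ with }Y(\hat{\mathbf{x}}^\ast,\hat{\bm{\mu}},\hat{\mathbf{u}})=Y(\tilde{\mathbf{x}}^\ast,\tilde{\bm{\mu}},\hat{\mathbf{u}})\}.$$ The *field of identifiable functions* is $\{h\in\mathbb{C}(\bm{\mu})\mid h\text{ is identifiable}\}$. **IO-identifiability.** For a field $K$, $K\{z_1,\ldots,z_s\}$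 is the differential polynomial ring $K[z_j^{(i)}\mid i\ge0,1\le j\le s]$ with derivation $(z_j^{(i)})'=z_j^{(i+1)}$, zero on $K$; $\operatorname{ord}_{z_j}P$ is the order of the highest derivative of $z_j$ appearing in $P$ ($-\infty$ if none); $[F]$ is the smallest differential ideal containing $F$. Put $I_\Sigma=[\mathbf{x}'-\mathbf{f},\mathbf{y}-\mathbf{g}]\subset\mathbb{C}(\bm{\mu})\{\mathbf{x},\mathbf{y},\mathbf{u}\}$. "Linear" differential polynomial means of total degree at most one. A tuple $(p_1,\ldots,p_m)$ in $\mathbb{C}(\bm{\mu})\{\mathbf{y},\mathbf{u}\}$ is a *full set of input-output equations* if, for some ordering of the outputs, written $y_1<\cdots<y_m$ to simplify notation: (1) $p_1$ is the linear differential polynomial in $y_1$ and $\mathbf{u}$ in $I_\Sigma$ of the smallest possible order in $y_1$ such that the coefficient of the highest derivative of $y_1$ is one; (2) for every $\ell>1$, $p_\ell$ is the linear differential polynomial in $y_1,\ldots,y_\ell$ and $\mathbf{u}$ in $I_\Sigma$ such that $\operatorname{ord}_{y_j}p_\ell<\operatorname{ord}_{y_j}p_j$ for all $1\le j<\ell$, the coefficient of the highest derivative of $y_\ell$ in $p_\ell$ is $1$, and $\operatorname{ord}_{y_\ell}p_\ell$ is the smallest possible. The *field of IO-identifiable functions* is the subfield of $\mathbb{C}(\bm{\mu})$ generated over $\mathbb{C}$ by the coefficients of a full set of input-output equations (it does not depend on the choice of the full set). *)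

theory Defs
  imports
    "HOL-Complex_Analysis.Complex_Analysis"
    "HOL-Library.Poly_Mapping"
    "HOL-Library.Extended_Real"
    "HOL-Computational_Algebra.Fraction_Field"
begin

section \<open>Multivariate polynomials and rational functions\<close>

text \<open>A monomial is a finitely supported exponent function, a polynomial a finitely supported
  function from monomials to coefficients.\<close>

type_synonym ('v, 'a) mpoly = "('v \<Rightarrow>\<^sub>0 nat) \<Rightarrow>\<^sub>0 'a"

definition mp_const :: "'a \<Rightarrow> ('v, 'a::zero) mpoly" where
  "mp_const c = Poly_Mapping.single 0 c"

definition mp_var :: "'v \<Rightarrow> ('v, 'a::zero_neq_one) mpoly" where
  "mp_var v = Poly_Mapping.single (Poly_Mapping.single v 1) 1"

definition mp_vars :: "('v, 'a::zero) mpoly \<Rightarrow> 'v set" where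
  "mp_vars p = (\<Union>m\<in>Poly_Mapping.keys p. Poly_Mapping.keys m)"

definition mp_eval :: "('v \<Rightarrow> 'a) \<Rightarrow> ('v, 'a::comm_semiring_1) mpoly \<Rightarrow> 'a" where
  "mp_eval z p = (\<Sum>m\<in>Poly_Mapping.keys p. Poly_Mapping.lookup p m *
      (\<Prod>v\<in>Poly_Mapping.keys m. z v ^ Poly_Mapping.lookup m v))"

text \<open>The type \<open>ratfun\<close> has countably many indeterminates; the field
  \<open>\<complex>(\<mu>\<^sub>1, \<dots>, \<mu>\<^sub>N)\<close> is the subset \<open>ratfuns N\<close>.\<close>

type_synonym ratfun = "(nat, complex) mpoly fract"

definition ratfuns :: "nat \<Rightarrow> ratfun set" where
  "ratfuns N = {Fract P Q | P Q. mp_vars P \<subseteq> {1..N} \<and> mp_vars Q \<subseteq> {1..N} \<and> Q \<noteq> 0}"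

definition rf_const :: "complex \<Rightarrow> ratfun" where
  "rf_const c = Fract (mp_const c) 1"

definition rf_var :: "nat \<Rightarrow> ratfun" where
  "rf_var k = Fract (mp_var k) 1"

text \<open>Polynomial rings over a field are factorial, so some representing fraction has a denominator
  not vanishing at \<open>\<mu>\<close> iff the reduced denominator does not vanish at \<open>\<mu>\<close>.\<close>

definition rf_regular_at :: "nat \<Rightarrow> ratfun \<Rightarrow> (nat \<Rightarrow> complex) \<Rightarrow> bool" where
  "rf_regular_at N h \<mu> \<longleftrightarrow> (\<exists>P Q. mp_vars P \<subseteq> {1..N} \<and> mp_vars Q \<subseteq> {1..N} \<and>
      mp_eval \<mu> Q \<noteq> 0 \<and> h = Fract P Q)"

definition rf_eval :: "(nat \<Rightarrow> complex) \<Rightarrow> ratfun \<Rightarrow> complex" where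
  "rf_eval \<mu> h = (THE z. \<exists>P Q. mp_eval \<mu> Q \<noteq> 0 \<and> h = Fract P Q \<and> z = mp_eval \<mu> P / mp_eval \<mu> Q)"

definition is_subfield :: "'a::field set \<Rightarrow> bool" where
  "is_subfield F \<longleftrightarrow> 1 \<in> F \<and> (\<forall>x\<in>F. \<forall>y\<in>F. x - y \<in> F \<and> x * y \<in> F) \<and>
      (\<forall>x\<in>F. x \<noteq> 0 \<longrightarrow> inverse x \<in> F)"

definition subfield_generated_over_C :: "ratfun set \<Rightarrow> ratfun set" where
  "subfield_generated_over_C S = \<Inter>{F. is_subfield F \<and> (\<forall>c. rf_const c \<in> F) \<and> S \<subseteq> F}"

section \<open>Linear compartment models\<close>

text \<open>The vertices are \<open>1, \<dots>, nverts\<close> and an edge \<open>i \<rightarrow> j\<close> is the pair \<open>(i, j)\<close>.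
  The parameters are \<open>\<mu>\<^sub>1, \<dots>, \<mu>\<^sub>\<lambda>\<close> with \<open>\<lambda> = npars\<close>, and \<open>par_index j i\<close> is the position
  in this list of \<open>a\<^sub>j\<^sub>i\<close> (for \<open>j = 0\<close>: of the leak parameter \<open>a\<^sub>0\<^sub>i\<close>).
  Positions not taken by these are the additional parameters.\<close>

record compartment_model =
  nverts :: nat
  edges :: "(nat \<times> nat) set"
  inputs :: "nat set"
  nouts :: nat
  leaks :: "nat set"
  npars :: nat
  par_index :: "nat \<Rightarrow> nat \<Rightarrow> nat"
  bcoef :: "nat \<Rightarrow> ratfun"
  ccoef :: "nat \<Rightarrow> ratfun"

definition verts :: "compartment_model \<Rightarrow> nat set" where
  "verts M = {1..nverts M}"

definition outputs :: "compartment_model \<Rightarrow> nat set" where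
  "outputs M = {1..nouts M}"

definition par_pairs :: "compartment_model \<Rightarrow> (nat \<times> nat) set" where
  "par_pairs M = {(j, i). (i, j) \<in> edges M} \<union> {(0, i) | i. i \<in> leaks M}"

definition linear_compartment_model :: "compartment_model \<Rightarrow> bool" where
  "linear_compartment_model M \<longleftrightarrow>
     edges M \<subseteq> verts M \<times> verts M \<and> (\<forall>i. (i, i) \<notin> edges M) \<and>
     inputs M \<subseteq> verts M \<and> leaks M \<subseteq> verts M \<and> outputs M \<subseteq> verts M \<and> 1 \<le> nouts M \<and>
     inj_on (\<lambda>(j, i). par_index M j i) (par_pairs M) \<and>
     (\<forall>(j, i)\<in>par_pairs M. par_index M j i \<in> {1..npars M}) \<and>
     (\<forall>i\<in>inputs M. bcoef M i \<in> ratfuns (npars M) \<and> bcoef M i \<noteq> 0) \<and>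
     (\<forall>i\<in>outputs M. ccoef M i \<in> ratfuns (npars M) \<and> ccoef M i \<noteq> 0)"

definition reachable :: "compartment_model \<Rightarrow> nat \<Rightarrow> nat \<Rightarrow> bool" where
  "reachable M w v \<longleftrightarrow> (w, v) \<in> (edges M)\<^sup>*"  \<comment> \<open>\<open>v\<close> is reachable from \<open>w\<close>\<close>

definition par :: "compartment_model \<Rightarrow> nat \<Rightarrow> nat \<Rightarrow> ratfun" where
  "par M j i = rf_var (par_index M j i)"

definition cmat :: "compartment_model \<Rightarrow> nat \<Rightarrow> nat \<Rightarrow> ratfun" where
  "cmat M i j =
     (if i = j then - (if i \<in> leaks M then par M 0 i else 0) - (\<Sum>k | (i, k) \<in> edges M. par M k i)
      else if (j, i) \<in> edges M then par M i j
      else 0)"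

section \<open>Identifiability\<close>

text \<open>Points of \<open>\<complex>\<^sup>n\<close> and \<open>\<complex>\<^sup>\<lambda>\<close> are functions on \<open>nat\<close> of which only the coordinates \<open>1, \<dots>, n\<close>
  (resp. \<open>1, \<dots>, \<lambda>\<close>) matter; likewise, an element of \<open>(\<complex>\<^sup>\<infinity>(0))\<^sup>\<kappa>\<close> is a family of which only the
  members with index in \<open>inputs M\<close> matter. Elements of \<open>\<complex>\<^sup>\<infinity>(0)\<close> are compared as germs at 0.\<close>

definition analytic_tuples :: "nat set \<Rightarrow> (nat \<Rightarrow> complex \<Rightarrow> complex) set" where
  "analytic_tuples I = {u. \<forall>i\<in>I. u i analytic_on {0}}"

definition Omega :: "compartment_model \<Rightarrow> (nat \<Rightarrow> complex) set" where
  "Omega M = {\<mu>.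
     (\<forall>i\<in>verts M. \<forall>j\<in>verts M. rf_regular_at (npars M) (cmat M i j) \<mu>) \<and>
     (\<forall>i\<in>inputs M. rf_regular_at (npars M) (bcoef M i) \<mu>) \<and>
     (\<forall>i\<in>outputs M. rf_regular_at (npars M) (ccoef M i) \<mu>)}"

definition Omega_of ::
  "compartment_model \<Rightarrow> ratfun \<Rightarrow>
   ((nat \<Rightarrow> complex) \<times> (nat \<Rightarrow> complex) \<times> (nat \<Rightarrow> complex \<Rightarrow> complex)) set" where
  "Omega_of M h =
     UNIV \<times> {\<mu> \<in> Omega M. rf_regular_at (npars M) h \<mu>} \<times> analytic_tuples (inputs M)"

definition is_solution ::
  "compartment_model \<Rightarrow> (nat \<Rightarrow> complex) \<Rightarrow> (nat \<Rightarrow> complex) \<Rightarrow> (nat \<Rightarrow> complex \<Rightarrow> complex) \<Rightarrow>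
   (nat \<Rightarrow> complex \<Rightarrow> complex) \<Rightarrow> bool" where
  "is_solution M x0 \<mu> u x \<longleftrightarrow> x \<in> analytic_tuples (verts M) \<and>
     (\<forall>i\<in>verts M. x i 0 = x0 i \<and>
       (\<forall>\<^sub>F t in nhds 0. (x i has_field_derivative
          (\<Sum>j\<in>verts M. rf_eval \<mu> (cmat M i j) * x j t) +
          (if i \<in> inputs M then rf_eval \<mu> (bcoef M i) * u i t else 0)) (at t)))"

text \<open>The solution is unique as a tuple of germs, so the choice below does not affect the
  germs of the outputs, which are all that is used of them.\<close>

definition output_fun ::
  "compartment_model \<Rightarrow> (nat \<Rightarrow> complex) \<Rightarrow> (nat \<Rightarrow> complex) \<Rightarrow> (nat \<Rightarrow> complex \<Rightarrow> complex) \<Rightarrow>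
   nat \<Rightarrow> complex \<Rightarrow> complex" where
  "output_fun M x0 \<mu> u i t = rf_eval \<mu> (ccoef M i) * (SOME x. is_solution M x0 \<mu> u x) i t"

definition same_germs ::
  "nat set \<Rightarrow> (nat \<Rightarrow> complex \<Rightarrow> complex) \<Rightarrow> (nat \<Rightarrow> complex \<Rightarrow> complex) \<Rightarrow> bool" where
  "same_germs I y z \<longleftrightarrow> (\<forall>i\<in>I. \<forall>\<^sub>F t in nhds 0. y i t = z i t)"

definition S_set ::
  "compartment_model \<Rightarrow> ratfun \<Rightarrow> (nat \<Rightarrow> complex) \<Rightarrow> (nat \<Rightarrow> complex) \<Rightarrow>
   (nat \<Rightarrow> complex \<Rightarrow> complex) \<Rightarrow> complex set" where
  "S_set M h x0 \<mu> u = {rf_eval \<mu>' h | x0' \<mu>'. (x0', \<mu>', u) \<in> Omega_of M h \<and>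
     same_germs (outputs M) (output_fun M x0 \<mu> u) (output_fun M x0' \<mu>' u)}"

text \<open>Nonempty Zariski open subsets of the affine space with coordinates \<open>V\<close>.\<close>

definition zariski_affine :: "'v set \<Rightarrow> ('v \<Rightarrow> complex) set set" where
  "zariski_affine V = {T. T \<noteq> {} \<and> (\<exists>P. mp_vars P \<subseteq> V \<and> T = {z. mp_eval z P \<noteq> 0})}"

text \<open>Nonempty Zariski open subsets of a power of \<open>\<complex>\<^sup>\<infinity>(0)\<close>; the indeterminate \<open>(i, k)\<close> stands for
  \<open>z\<^sub>i\<^sup>(\<^sup>k\<^sup>)\<close>.\<close>

definition zariski_analytic :: "nat set \<Rightarrow> (nat \<Rightarrow> complex \<Rightarrow> complex) set set" where
  "zariski_analytic I = {U. U \<noteq> {} \<and> (\<exists>P. mp_vars P \<subseteq> I \<times> UNIV \<and>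
     U = {z \<in> analytic_tuples I. mp_eval (\<lambda>(i, k). (deriv ^^ k) (z i) 0) P \<noteq> 0})}"

text \<open>In \<open>\<complex>\<^sup>n \<times> \<complex>\<^sup>\<lambda>\<close>, the coordinates are \<open>Inl i\<close> for the initial values and \<open>Inr k\<close> for the
  parameters.\<close>

definition identifiable :: "compartment_model \<Rightarrow> ratfun \<Rightarrow> bool" where
  "identifiable M h \<longleftrightarrow>
     (\<exists>\<Theta>\<in>zariski_affine (Inl ` verts M \<union> Inr ` {1..npars M}). \<exists>U\<in>zariski_analytic (inputs M).
        \<forall>x0 \<mu> u. case_sum x0 \<mu> \<in> \<Theta> \<and> u \<in> U \<and> (x0, \<mu>, u) \<in> Omega_of M h \<longrightarrow>
          card (S_set M h x0 \<mu> u) = 1)"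

definition identifiable_field :: "compartment_model \<Rightarrow> ratfun set" where
  "identifiable_field M = {h \<in> ratfuns (npars M). identifiable M h}"

section \<open>Input-output equations\<close>

datatype dindet = State nat | Output nat | Input nat

text \<open>The indeterminate \<open>(z, k)\<close> stands for \<open>z\<^sup>(\<^sup>k\<^sup>)\<close>.\<close>

type_synonym dpoly = "(dindet \<times> nat, ratfun) mpoly"

definition dpolys :: "compartment_model \<Rightarrow> dindet set \<Rightarrow> dpoly set" where
  "dpolys M Z = {p. mp_vars p \<subseteq> Z \<times> UNIV \<and> (\<forall>m. Poly_Mapping.lookup p m \<in> ratfuns (npars M))}"

text \<open>The derivation with \<open>c' = 0\<close> for constants \<open>c\<close> and \<open>(z\<^sup>(\<^sup>k\<^sup>))' = z\<^sup>(\<^sup>k\<^sup>+\<^sup>1\<^sup>)\<close>, given on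
  monomials by the Leibniz rule.\<close>

definition dderiv :: "dpoly \<Rightarrow> dpoly" where
  "dderiv p = (\<Sum>m\<in>Poly_Mapping.keys p. \<Sum>(z, k)\<in>Poly_Mapping.keys m.
     Poly_Mapping.single
       (m - Poly_Mapping.single (z, k) 1 + Poly_Mapping.single (z, Suc k) 1)
       (of_nat (Poly_Mapping.lookup m (z, k)) * Poly_Mapping.lookup p m))"

definition differential_ideal :: "dpoly set \<Rightarrow> dpoly set \<Rightarrow> bool" where
  "differential_ideal R I \<longleftrightarrow> I \<subseteq> R \<and> 0 \<in> I \<and> (\<forall>p\<in>I. \<forall>q\<in>I. p + q \<in> I) \<and>
     (\<forall>r\<in>R. \<forall>p\<in>I. r * p \<in> I) \<and> (\<forall>p\<in>I. dderiv p \<in> I)"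

definition all_indets :: "compartment_model \<Rightarrow> dindet set" where
  "all_indets M = State ` verts M \<union> Output ` outputs M \<union> Input ` inputs M"

definition state_eq :: "compartment_model \<Rightarrow> nat \<Rightarrow> dpoly" where
  "state_eq M i = mp_var (State i, 1) -
     ((\<Sum>j\<in>verts M. mp_const (cmat M i j) * mp_var (State j, 0)) +
      (if i \<in> inputs M then mp_const (bcoef M i) * mp_var (Input i, 0) else 0))"

definition output_eq :: "compartment_model \<Rightarrow> nat \<Rightarrow> dpoly" where
  "output_eq M i = mp_var (Output i, 0) - mp_const (ccoef M i) * mp_var (State i, 0)"

definition I_Sigma :: "compartment_model \<Rightarrow> dpoly set" where
  "I_Sigma M = \<Inter>{I. differential_ideal (dpolys M (all_indets M)) I \<and>
     state_eq M ` verts M \<union> output_eq M ` outputs M \<subseteq> I}"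

text \<open>The supremum of the empty set is \<open>-\<infinity>\<close> in \<open>ereal\<close>.\<close>

definition dord :: "dindet \<Rightarrow> dpoly \<Rightarrow> ereal" where
  "dord z p = Sup ((\<lambda>k. ereal (real k)) ` {k. (z, k) \<in> mp_vars p})"

definition dlinear :: "dpoly \<Rightarrow> bool" where
  "dlinear p \<longleftrightarrow> (\<forall>m\<in>Poly_Mapping.keys p. (\<Sum>v\<in>Poly_Mapping.keys m. Poly_Mapping.lookup m v) \<le> 1)"

definition monic_in :: "dindet \<Rightarrow> dpoly \<Rightarrow> bool" where
  "monic_in z p \<longleftrightarrow> (\<exists>k. dord z p = ereal (real k) \<and>
     Poly_Mapping.lookup p (Poly_Mapping.single (z, k) 1) = 1)"  \<comment> \<open>for \<open>p\<close> linear\<close>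

text \<open>\<open>ys 1 < \<dots> < ys m\<close> is the ordering of the outputs. The predicate collects the conditions on
  the \<open>l\<close>-th equation other than minimality of its order in \<open>y\<^sub>l\<close>; for \<open>l = 1\<close> the condition on
  smaller indices is void.\<close>

definition io_candidate ::
  "compartment_model \<Rightarrow> (nat \<Rightarrow> nat) \<Rightarrow> (nat \<Rightarrow> dpoly) \<Rightarrow> nat \<Rightarrow> dpoly \<Rightarrow> bool" where
  "io_candidate M ys p l q \<longleftrightarrow> q \<in> I_Sigma M \<and> dlinear q \<and>
     q \<in> dpolys M ((\<lambda>j. Output (ys j)) ` {1..l} \<union> Input ` inputs M) \<and>
     (\<forall>j\<in>{1..<l}. dord (Output (ys j)) q < dord (Output (ys j)) (p j)) \<and>
     monic_in (Output (ys l)) q"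

definition full_io_equations ::
  "compartment_model \<Rightarrow> (nat \<Rightarrow> nat) \<Rightarrow> (nat \<Rightarrow> dpoly) \<Rightarrow> bool" where
  "full_io_equations M ys p \<longleftrightarrow> bij_betw ys {1..nouts M} (outputs M) \<and>
     (\<forall>l\<in>{1..nouts M}. io_candidate M ys p l (p l) \<and>
        (\<forall>q. io_candidate M ys p l q \<longrightarrow> dord (Output (ys l)) (p l) \<le> dord (Output (ys l)) q))"

definition io_field :: "compartment_model \<Rightarrow> (nat \<Rightarrow> dpoly) \<Rightarrow> ratfun set" where
  "io_field M p = subfield_generated_over_C
     (\<Union>l\<in>{1..nouts M}. Poly_Mapping.lookup (p l) ` Poly_Mapping.keys (p l))"

end

(* The Taylor coefficients of the outputs are y_j^(k) = c_j e_j^T A^k x plus a combination of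
   derivatives of the inputs, so everything is linear algebra with the rows v_(j,k) = c_j e_j^T A^k.
   A full set of input-output equations expresses the rows v_(l,n_l) in a basis
   {v_(j,k) | k < n_j} of the observability space; the coefficients of the inputs follow from those
   of the outputs.

   If h is identifiable but not in the field F of the coefficients, take a point (x0, mu) that is
   generic over a countable field of definition. Then h(mu) lies outside the field L of values at mu
   of elements of F, so some field embedding sigma over L moves h(mu). The parameter sigma(mu) gives
   the same input-output equations, and a suitable initial state matches the first n_j derivatives
   of the outputs, hence all of them, contradicting identifiability.

   Conversely, let (A, [B, x0]) be controllable, the basis rows independent at mu, and let the inputs
   satisfy no constant-coefficient linear relation of low order. Then the derivatives y_j^(k), k < n_j,
   and the low-order derivatives of the inputs are linearly independent over C. Hence any other
   parameter value producing the same output has independent basis rows as well and the same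
   coefficients. The reachability hypothesis enters through generic controllability: letting every
   vertex drain along a shortest path to a leak or an input, with distinct rates, makes the matrix
   of the non-input vertices triangular with distinct eigenvalues, hence cyclic. *)

theory Submission
  imports Defs
begin

section \<open>Evaluation of multivariate polynomials\<close>

text \<open>Independence has to be carried between rows over \<open>ratfun\<close>, rows at a
  complex point, and polynomials in initial state and parameters. \<open>indep_certificate\<close>
  is the bridge: division-free elimination turns independence under one homomorphism into a single
  polynomial whose nonvanishing forces independence under every other one. The obstacle is that
  \<open>S_set\<close> admits every competing parameter in \<open>Omega_of\<close>, where the
  coefficients of the equations might have poles. Independent rows exclude this: a linear system
  over the local ring at a point, with rows independent in the residue field, has its solutions in
  that ring. In the other direction countability replaces automorphisms of \<complex>: finitely many
  rational functions are defined over a countable subring, countably many hypersurfaces do not cover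
  affine space, and the embedding only has to reach the finitely many coordinates of one point. The
  bound \<open>D + card V < D'\<close> on input relations arises because a row may have to be
  multiplied by the matrix up to \<open>card V\<close> times before its iterates become
  dependent.\<close>

definition is_hom :: "('a::comm_ring_1 \<Rightarrow> 'b::comm_ring_1) \<Rightarrow> bool" where
  "is_hom h \<longleftrightarrow> (\<forall>x y. h (x + y) = h x + h y) \<and> (\<forall>x y. h (x * y) = h x * h y) \<and> h 1 = 1"

lemma is_hom_add: "is_hom h \<Longrightarrow> h (x + y) = h x + h y"
  and is_hom_mult: "is_hom h \<Longrightarrow> h (x * y) = h x * h y"
  and is_hom_1: "is_hom h \<Longrightarrow> h 1 = 1"
  by (auto simp: is_hom_def)

lemma is_hom_0: "is_hom h \<Longrightarrow> h 0 = 0"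
  using is_hom_add[of h 0 0] by simp

lemma is_hom_uminus: "is_hom h \<Longrightarrow> h (- x) = - h x"
  using is_hom_add[of h x "- x"] is_hom_0[of h] by (simp add: eq_neg_iff_add_eq_0 add.commute)

lemma is_hom_diff: "is_hom h \<Longrightarrow> h (x - y) = h x - h y"
  using is_hom_add[of h x "- y"] is_hom_uminus[of h y] by simp

lemma is_hom_sum: "is_hom h \<Longrightarrow> h (sum f A) = (\<Sum>a\<in>A. h (f a))"
  by (induction A rule: infinite_finite_induct) (auto simp: is_hom_0 is_hom_add)

lemma is_hom_prod: "is_hom h \<Longrightarrow> h (prod f A) = (\<Prod>a\<in>A. h (f a))"
  by (induction A rule: infinite_finite_induct) (auto simp: is_hom_1 is_hom_mult)

lemma is_hom_power: "is_hom h \<Longrightarrow> h (x ^ n) = h x ^ n"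
  by (induction n) (auto simp: is_hom_1 is_hom_mult)

lemmas is_hom_simps = is_hom_0 is_hom_1 is_hom_add is_hom_mult is_hom_uminus is_hom_diff
  is_hom_sum is_hom_prod is_hom_power

lemma is_hom_id: "is_hom (\<lambda>x. x)"
  by (simp add: is_hom_def)

definition mon_val :: "('v \<Rightarrow> 'b::comm_semiring_1) \<Rightarrow> ('v \<Rightarrow>\<^sub>0 nat) \<Rightarrow> 'b" where
  "mon_val z m = (\<Prod>v\<in>Poly_Mapping.keys m. z v ^ Poly_Mapping.lookup m v)"

text \<open>Coefficients pass through \<open>h\<close> and variables through \<open>z\<close>
  independently: the same definition evaluates in the base ring, in univariate polynomials, in power
  series and in a larger polynomial ring.\<close>

definition mev :: "('a::zero \<Rightarrow> 'b::comm_semiring_1) \<Rightarrow> ('v \<Rightarrow> 'b) \<Rightarrow> ('v, 'a) mpoly \<Rightarrow> 'b" where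
  "mev h z p = (\<Sum>m\<in>Poly_Mapping.keys p. h (Poly_Mapping.lookup p m) * mon_val z m)"

lemma mp_eval_eq_mev: "mp_eval z p = mev (\<lambda>x. x) z p"
  by (simp add: mp_eval_def mev_def mon_val_def)

lemma mon_val_superset:
  assumes "finite A" "Poly_Mapping.keys m \<subseteq> A"
  shows "mon_val z m = (\<Prod>v\<in>A. z v ^ Poly_Mapping.lookup m v)"
  unfolding mon_val_def using assms
  by (intro prod.mono_neutral_left) (auto simp: in_keys_iff)

lemma mon_val_add: "mon_val z (m + n) = mon_val z m * mon_val z n"
proof -
  let ?A = "Poly_Mapping.keys m \<union> Poly_Mapping.keys n"
  have "Poly_Mapping.keys (m + n) \<subseteq> ?A" by (rule Poly_Mapping.keys_add)
  then show ?thesis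
    by (simp add: mon_val_superset[of ?A] lookup_add power_add prod.distrib)
qed

lemma mon_val_0 [simp]: "mon_val z 0 = 1"
  by (simp add: mon_val_def)

lemma mon_val_single [simp]: "mon_val z (Poly_Mapping.single v k) = z v ^ k"
  by (simp add: mon_val_def)

lemma mev_superset:
  assumes "finite A" "Poly_Mapping.keys p \<subseteq> A" "h 0 = 0"
  shows "mev h z p = (\<Sum>m\<in>A. h (Poly_Mapping.lookup p m) * mon_val z m)"
  unfolding mev_def using assms
  by (intro sum.mono_neutral_left) (auto simp: in_keys_iff)

lemma mev_0 [simp]: "mev h z 0 = 0"
  by (simp add: mev_def)

lemma mev_add:
  assumes "is_hom h"
  shows "mev h z (p + q) = mev h z p + mev h z q"
proof -
  let ?A = "Poly_Mapping.keys p \<union> Poly_Mapping.keys q"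
  have "Poly_Mapping.keys (p + q) \<subseteq> ?A" by (rule Poly_Mapping.keys_add)
  then show ?thesis using assms
    by (simp add: mev_superset[of ?A] is_hom_simps lookup_add sum.distrib algebra_simps)
qed

lemma mev_sum:
  assumes "is_hom h"
  shows "mev h z (sum f A) = (\<Sum>a\<in>A. mev h z (f a))"
  by (induction A rule: infinite_finite_induct) (auto simp: mev_add assms)

lemma mev_single:
  assumes "h 0 = 0"
  shows "mev h z (Poly_Mapping.single m c) = h c * mon_val z m"
  using assms by (cases "c = 0") (auto simp: mev_def)

lemma mpoly_sum_single:
  "(p::'a \<Rightarrow>\<^sub>0 'b::comm_monoid_add) = (\<Sum>m\<in>Poly_Mapping.keys p. Poly_Mapping.single m (Poly_Mapping.lookup p m))"
  by (rule poly_mapping_eqI)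
    (auto simp: lookup_sum lookup_single when_def in_keys_iff sum.delta)

lemma mev_mult:
  assumes h: "is_hom h"
  shows "mev h z (p * q) = mev h z p * mev h z q"
proof -
  have h0: "h 0 = 0" using h by (rule is_hom_0)
  have "p * q = (\<Sum>m\<in>Poly_Mapping.keys p. \<Sum>n\<in>Poly_Mapping.keys q.
      Poly_Mapping.single (m + n) (Poly_Mapping.lookup p m * Poly_Mapping.lookup q n))"
    by (subst (1) mpoly_sum_single[of p], subst (1) mpoly_sum_single[of q])
      (simp add: sum_product mult_single)
  then show ?thesis
    by (simp add: mev_sum[OF h] mev_single[where h=h, OF h0] is_hom_mult[OF h] mon_val_add)
      (simp add: mev_def sum_product algebra_simps)
qed

lemma mev_mp_const: "is_hom h \<Longrightarrow> mev h z (mp_const c) = h c"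
  by (simp add: mp_const_def mev_single is_hom_0)

lemma mev_mp_var: "is_hom h \<Longrightarrow> mev h z (mp_var v) = z v"
  by (simp add: mp_var_def mev_single is_hom_0 is_hom_1)

lemma mp_const_1 [simp]: "mp_const 1 = 1"
  by (simp add: mp_const_def)

lemma mp_const_0 [simp]: "mp_const 0 = 0"
  by (simp add: mp_const_def)

lemma is_hom_mev: "is_hom h \<Longrightarrow> is_hom (mev h z)"
  using mev_mp_const[of h z 1] by (simp add: is_hom_def mev_add mev_mult)

lemma is_hom_mp_eval: "is_hom (mp_eval (z::'v \<Rightarrow> 'a::comm_ring_1))"
  using is_hom_mev[OF is_hom_id] by (simp add: mp_eval_eq_mev[abs_def])

lemma mp_eval_const [simp]: "mp_eval (z::'v \<Rightarrow> 'a::comm_ring_1) (mp_const c) = c"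
  by (simp add: mp_eval_eq_mev mev_mp_const is_hom_id)

lemma mp_eval_var [simp]: "mp_eval (z::'v \<Rightarrow> 'a::comm_ring_1) (mp_var v) = z v"
  by (simp add: mp_eval_eq_mev mev_mp_var is_hom_id)

lemma is_hom_mp_const: "is_hom (mp_const :: 'a::comm_ring_1 \<Rightarrow> ('v, 'a) mpoly)"
  by (simp add: is_hom_def mp_const_def single_add mult_single)

lemma hom_mev:
  assumes g: "is_hom g" and h: "is_hom h"
  shows "g (mev h z p) = mev (\<lambda>c. g (h c)) (\<lambda>v. g (z v)) p"
  by (simp add: mev_def mon_val_def is_hom_simps[OF g])

lemma mev_cong:
  assumes "\<And>v. v \<in> mp_vars p \<Longrightarrow> z v = z' v"
    and "\<And>m. h (Poly_Mapping.lookup p m) = h' (Poly_Mapping.lookup p m)"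
  shows "mev h z p = mev h' z' p"
proof -
  have "z v = z' v" if "m \<in> Poly_Mapping.keys p" "v \<in> Poly_Mapping.keys m" for m v
    using assms(1)[of v] that by (auto simp: mp_vars_def)
  then show ?thesis
    unfolding mev_def mon_val_def by (simp add: assms(2))
qed

lemma mp_eval_cong: "(\<And>v. v \<in> mp_vars p \<Longrightarrow> z v = z' v) \<Longrightarrow> mp_eval z p = mp_eval z' p"
  unfolding mp_eval_eq_mev by (rule mev_cong) auto

section \<open>Subrings and polynomials over them\<close>

definition subring_set :: "'a::comm_ring_1 set \<Rightarrow> bool" where
  "subring_set R \<longleftrightarrow> 1 \<in> R \<and> (\<forall>x\<in>R. \<forall>y\<in>R. x - y \<in> R \<and> x * y \<in> R)"

lemma subring_set_1: "subring_set R \<Longrightarrow> 1 \<in> R"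
  and subring_set_diff: "subring_set R \<Longrightarrow> x \<in> R \<Longrightarrow> y \<in> R \<Longrightarrow> x - y \<in> R"
  and subring_set_mult: "subring_set R \<Longrightarrow> x \<in> R \<Longrightarrow> y \<in> R \<Longrightarrow> x * y \<in> R"
  by (auto simp: subring_set_def)

lemma subring_set_0: "subring_set R \<Longrightarrow> 0 \<in> R"
  using subring_set_diff[of R 1 1] subring_set_1[of R] by simp

lemma subring_set_uminus: "subring_set R \<Longrightarrow> x \<in> R \<Longrightarrow> - x \<in> R"
  using subring_set_diff[of R 0 x] subring_set_0[of R] by simp

lemma subring_set_add: "subring_set R \<Longrightarrow> x \<in> R \<Longrightarrow> y \<in> R \<Longrightarrow> x + y \<in> R"
  using subring_set_diff[of R x "- y"] subring_set_uminus[of R y] by simp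

lemma subring_set_sum: "subring_set R \<Longrightarrow> (\<And>a. a \<in> A \<Longrightarrow> f a \<in> R) \<Longrightarrow> sum f A \<in> R"
  by (induction A rule: infinite_finite_induct) (auto simp: subring_set_0 subring_set_add)

lemma subring_set_prod: "subring_set R \<Longrightarrow> (\<And>a. a \<in> A \<Longrightarrow> f a \<in> R) \<Longrightarrow> prod f A \<in> R"
  by (induction A rule: infinite_finite_induct) (auto simp: subring_set_1 subring_set_mult)

lemma subring_set_power: "subring_set R \<Longrightarrow> x \<in> R \<Longrightarrow> x ^ n \<in> R"
  by (induction n) (auto simp: subring_set_1 subring_set_mult)

lemmas subring_set_closed = subring_set_0 subring_set_1 subring_set_diff subring_set_mult
  subring_set_uminus subring_set_add subring_set_sum subring_set_prod subring_set_power

text \<open>The coefficient set \<open>k\<close> varies: \<open>UNIV\<close> when only the variables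
  matter, \<open>ratfuns\<close> for differential polynomials, a countable subring for fields of
  definition.\<close>

definition polys_over :: "'a::zero set \<Rightarrow> 'v set \<Rightarrow> ('v, 'a) mpoly set" where
  "polys_over k V = {p. mp_vars p \<subseteq> V \<and> (\<forall>m. Poly_Mapping.lookup p m \<in> k)}"

lemma mp_vars_diff: "mp_vars (p - q :: ('v, 'a::comm_ring_1) mpoly) \<subseteq> mp_vars p \<union> mp_vars q"
  by (fastforce simp: mp_vars_def in_keys_iff lookup_minus)

lemma mp_vars_mult: "mp_vars (p * q :: ('v, 'a::comm_ring_1) mpoly) \<subseteq> mp_vars p \<union> mp_vars q"
proof
  fix v assume "v \<in> mp_vars (p * q)"
  then obtain m where m: "m \<in> Poly_Mapping.keys (p * q)" "v \<in> Poly_Mapping.keys m"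
    by (auto simp: mp_vars_def)
  from m(1) obtain a b where "m = a + b" "a \<in> Poly_Mapping.keys p" "b \<in> Poly_Mapping.keys q"
    using Poly_Mapping.keys_mult[of p q] by auto
  with m(2) show "v \<in> mp_vars p \<union> mp_vars q"
    using Poly_Mapping.keys_add[of a b] by (auto simp: mp_vars_def)
qed

lemma mp_vars_1 [simp]: "mp_vars 1 = {}"
  by (simp add: mp_vars_def flip: mp_const_1) (simp add: mp_const_def)

lemma mp_vars_const [simp]: "mp_vars (mp_const c) = {}"
  by (simp add: mp_vars_def mp_const_def)

lemma mp_vars_var [simp]: "mp_vars (mp_var v :: ('v, 'a::zero_neq_one) mpoly) = {v}"
  by (simp add: mp_vars_def mp_var_def)

lemma subring_polys_over:
  assumes k: "subring_set k"
  shows "subring_set (polys_over k V)"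
  unfolding subring_set_def
proof (intro conjI ballI)
  show "1 \<in> polys_over k V"
    using k by (auto simp: polys_over_def lookup_one when_def subring_set_closed)
next
  fix x y assume xy: "x \<in> polys_over k V" "y \<in> polys_over k V"
  then show "x - y \<in> polys_over k V"
    using k mp_vars_diff[of x y] by (auto simp: polys_over_def lookup_minus subring_set_closed)
  have "Poly_Mapping.lookup (x * y) m \<in> k" for m
  proof -
    have "x * y = (\<Sum>m\<in>Poly_Mapping.keys x. \<Sum>n\<in>Poly_Mapping.keys y.
        Poly_Mapping.single (m + n) (Poly_Mapping.lookup x m * Poly_Mapping.lookup y n))"
      by (subst (1) mpoly_sum_single[of x], subst (1) mpoly_sum_single[of y])
        (simp add: sum_product mult_single)
    then show ?thesis using k xy
      by (auto simp: lookup_sum lookup_single when_def polys_over_def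
          intro!: subring_set_closed)
  qed
  then show "x * y \<in> polys_over k V"
    using xy mp_vars_mult[of x y] by (auto simp: polys_over_def)
qed

lemma polys_over_const: "c \<in> k \<Longrightarrow> 0 \<in> k \<Longrightarrow> mp_const c \<in> polys_over k V"
  by (auto simp: polys_over_def) (auto simp: mp_const_def lookup_single when_def)

lemma polys_over_var: "subring_set k \<Longrightarrow> v \<in> V \<Longrightarrow> mp_var v \<in> polys_over k V"
  by (auto simp: polys_over_def) (auto simp: mp_var_def lookup_single when_def subring_set_closed)

lemma subring_UNIV: "subring_set UNIV"
  by (simp add: subring_set_def)

lemma mev_in_subring:
  assumes "subring_set R" "\<And>v. v \<in> mp_vars p \<Longrightarrow> z v \<in> R" "\<And>m. h (Poly_Mapping.lookup p m) \<in> R"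
  shows "mev h z p \<in> R"
  unfolding mev_def mon_val_def using assms
  by (intro subring_set_closed) (auto simp: mp_vars_def)

lemma subfield_imp_subring: "is_subfield F \<Longrightarrow> subring_set F"
  by (simp add: is_subfield_def subring_set_def)

lemma subfield_inverse: "is_subfield F \<Longrightarrow> x \<in> F \<Longrightarrow> inverse x \<in> F"
  using subring_set_0[OF subfield_imp_subring] by (cases "x = 0") (auto simp: is_subfield_def)

lemma subfield_divide: "is_subfield F \<Longrightarrow> x \<in> F \<Longrightarrow> y \<in> F \<Longrightarrow> x / y \<in> F"
  by (simp add: divide_inverse subfield_inverse subring_set_mult subfield_imp_subring)

lemmas subfield_closed = subring_set_closed[OF subfield_imp_subring] subfield_inverse subfield_divide

section \<open>Linear algebra by fraction-free elimination\<close>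

text \<open>Scalars come from a subset \<open>F\<close> because the field meant is often
  \<open>ratfuns N\<close>, a proper subset of its type. The column set \<open>S\<close> may be
  infinite, as for the controllability columns and for shifted jets.\<close>

definition indep :: "'a::field set \<Rightarrow> 'j set \<Rightarrow> 's set \<Rightarrow> ('j \<Rightarrow> 's \<Rightarrow> 'a) \<Rightarrow> bool" where
  "indep F J S V \<longleftrightarrow> (\<forall>\<gamma>. (\<forall>j\<in>J. \<gamma> j \<in> F) \<and> (\<forall>s\<in>S. (\<Sum>j\<in>J. \<gamma> j * V j s) = 0) \<longrightarrow> (\<forall>j\<in>J. \<gamma> j = 0))"

lemma indepD:
  "indep F J S V \<Longrightarrow> (\<And>j. j \<in> J \<Longrightarrow> \<gamma> j \<in> F) \<Longrightarrow> (\<And>s. s \<in> S \<Longrightarrow> (\<Sum>j\<in>J. \<gamma> j * V j s) = 0) \<Longrightarrow>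
    j \<in> J \<Longrightarrow> \<gamma> j = 0"
  unfolding indep_def by blast

text \<open>The 2 by 2 minor on rows \<open>r\<close>, \<open>j\<close> and columns
  \<open>s\<close>, \<open>t\<close>: one elimination step with pivot \<open>V r s\<close>, free of
  division so that it stays in a subring and commutes with homomorphisms.\<close>

definition elim :: "('j \<Rightarrow> 's \<Rightarrow> 'a::comm_ring_1) \<Rightarrow> 'j \<Rightarrow> 's \<Rightarrow> 'j \<Rightarrow> 's \<Rightarrow> 'a" where
  "elim V r s j t = V r s * V j t - V j s * V r t"

lemma indep_elim:
  fixes V :: "'j \<Rightarrow> 's \<Rightarrow> 'a::field"
  assumes "finite J" "r \<notin> J" "is_subfield F"
    and V: "\<And>j t. j \<in> insert r J \<Longrightarrow> t \<in> S \<Longrightarrow> V j t \<in> F"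
    and ind: "indep F (insert r J) S V"
  obtains s where "s \<in> S" "V r s \<noteq> 0" "indep F J S (elim V r s)"
proof -
  note cl = subfield_closed[OF assms(3)]
  have "\<exists>s\<in>S. V r s \<noteq> 0"
  proof (rule ccontr)
    assume neg: "\<not> (\<exists>s\<in>S. V r s \<noteq> 0)"
    let ?\<gamma> = "\<lambda>j. if j = r then 1 else 0 :: 'a"
    have "(\<Sum>j\<in>insert r J. ?\<gamma> j * V j s) = 0" if "s \<in> S" for s
      using neg that assms(1,2) by (auto intro!: sum.neutral)
    moreover have "?\<gamma> j \<in> F" for j using cl(1,2) by simp
    ultimately have "?\<gamma> r = 0" using indepD[OF ind, of ?\<gamma> r] by blast
    then show False by simp
  qed
  then obtain s where s: "s \<in> S" "V r s \<noteq> 0" by auto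
  have "indep F J S (elim V r s)"
    unfolding indep_def
  proof (intro allI impI, elim conjE)
    fix \<gamma> assume \<gamma>: "\<forall>j\<in>J. \<gamma> j \<in> F" "\<forall>t\<in>S. (\<Sum>j\<in>J. \<gamma> j * elim V r s j t) = 0"
    \<comment> \<open>Expanding the minors collects all multiples of row \<open>r\<close> into this
      one coefficient.\<close>
    let ?g = "\<lambda>j. if j = r then - (\<Sum>j\<in>J. \<gamma> j * V j s) else \<gamma> j * V r s"
    have "(\<Sum>j\<in>insert r J. ?g j * V j t) = 0" if "t \<in> S" for t
    proof -
      have "(\<Sum>j\<in>J. ?g j * V j t) = (\<Sum>j\<in>J. \<gamma> j * V r s * V j t)"
        using assms(2) by (intro sum.cong) auto
      then have "(\<Sum>j\<in>insert r J. ?g j * V j t) = (\<Sum>j\<in>J. \<gamma> j * elim V r s j t)"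
        using assms(1,2)
        by (simp add: elim_def algebra_simps sum_subtractf sum_distrib_left sum_distrib_right)
      with \<gamma>(2) that show ?thesis by simp
    qed
    moreover have "?g j \<in> F" if "j \<in> insert r J" for j
      using that \<gamma>(1) V s(1) assms(2) by (auto intro!: cl)
    ultimately have "\<forall>j\<in>insert r J. ?g j = 0" using indepD[OF ind, of ?g] by blast
    then show "\<forall>j\<in>J. \<gamma> j = 0" using s(2) assms(2) by (metis insertCI mult_eq_0_iff)
  qed
  with s that show thesis by blast
qed

lemma indep_of_elim:
  assumes "finite J" "r \<notin> J" "s \<in> S" "V r s \<noteq> (0::'a::field)" "indep F J S (elim V r s)"
  shows "indep F (insert r J) S V"
  unfolding indep_def
proof (intro allI impI, elim conjE)
  fix \<gamma> assume g: "\<forall>j\<in>insert r J. \<gamma> j \<in> F" "\<forall>t\<in>S. (\<Sum>j\<in>insert r J. \<gamma> j * V j t) = 0"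
  have eq: "(\<Sum>j\<in>J. \<gamma> j * V j t) = - (\<gamma> r * V r t)" if "t \<in> S" for t
    using g(2) that assms(1,2) by (simp add: eq_neg_iff_add_eq_0 add.commute)
  have "(\<Sum>j\<in>J. \<gamma> j * elim V r s j t) = 0" if t: "t \<in> S" for t
  proof -
    have "(\<Sum>j\<in>J. \<gamma> j * elim V r s j t) = V r s * (\<Sum>j\<in>J. \<gamma> j * V j t) - V r t * (\<Sum>j\<in>J. \<gamma> j * V j s)"
      by (simp add: elim_def algebra_simps sum_subtractf sum_distrib_left)
    then show ?thesis using eq[OF t] eq[OF assms(3)] by simp
  qed
  then have z: "\<forall>j\<in>J. \<gamma> j = 0" using g(1) assms(5) by (auto simp: indep_def)
  then have "\<gamma> r = 0" using eq[OF assms(3)] assms(4) by simp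
  with z show "\<forall>j\<in>insert r J. \<gamma> j = 0" by simp
qed

lemma elim_hom: "is_hom h \<Longrightarrow> (\<lambda>j t. h (elim V r s j t)) = elim (\<lambda>j t. h (V j t)) r s"
  by (simp add: elim_def fun_eq_iff is_hom_simps)

text \<open>The certificate \<open>P\<close> is the product of the successive pivots found under
  \<open>\<phi>\<close>. Elimination commutes with homomorphisms, so as long as
  \<open>\<psi>\<close> keeps \<open>P\<close> nonzero the same pivots work under
  \<open>\<psi>\<close>.\<close>

lemma indep_certificate:
  fixes \<phi> :: "'r::comm_ring_1 \<Rightarrow> 'a::field"
  assumes "finite J" "subring_set R" "is_hom \<phi>" "is_subfield F" "\<phi> ` R \<subseteq> F"
    and "\<And>j t. j \<in> J \<Longrightarrow> t \<in> S \<Longrightarrow> V j t \<in> R"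
    and "indep F J S (\<lambda>j t. \<phi> (V j t))"
  shows "\<exists>P\<in>R. \<phi> P \<noteq> 0 \<and> (\<forall>\<psi>::'r \<Rightarrow> 'b::field. is_hom \<psi> \<and> \<psi> P \<noteq> 0 \<longrightarrow> indep UNIV J S (\<lambda>j t. \<psi> (V j t)))"
  using assms(1,6,7)
proof (induction J arbitrary: V rule: finite_induct)
  case empty
  show ?case using assms(2,3)
    by (intro bexI[of _ 1]) (auto simp: indep_def is_hom_1 subring_set_1)
next
  case (insert r J)
  have "\<phi> (V j t) \<in> F" if "j \<in> insert r J" "t \<in> S" for j t
    using insert.prems(1)[OF that] assms(5) by blast
  then obtain s where s: "s \<in> S" "\<phi> (V r s) \<noteq> 0" "indep F J S (elim (\<lambda>j t. \<phi> (V j t)) r s)"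
    using indep_elim[OF insert.hyps(1,2) assms(4) _ insert.prems(2)] by blast
  have inR: "elim V r s j t \<in> R" if "j \<in> J" "t \<in> S" for j t
    unfolding elim_def using that s(1) insert.prems(1) assms(2) by (intro subring_set_closed) auto
  obtain P where P: "P \<in> R" "\<phi> P \<noteq> 0"
    "\<And>\<psi>::'r \<Rightarrow> 'b. is_hom \<psi> \<and> \<psi> P \<noteq> 0 \<longrightarrow> indep UNIV J S (\<lambda>j t. \<psi> (elim V r s j t))"
    using insert.IH[of "elim V r s", OF inR] s(3) unfolding elim_hom[OF assms(3)] by blast
  show ?case
  proof (intro bexI[of _ "P * V r s"] conjI allI impI, goal_cases)
    case 1 then show ?case using P(2) s(2) assms(3) by (simp add: is_hom_mult)
  next
    case (2 \<psi>)
    then have h: "is_hom \<psi>" "\<psi> P \<noteq> 0" "\<psi> (V r s) \<noteq> 0" by (auto simp: is_hom_mult)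
    then show ?case
      using indep_of_elim[OF insert.hyps(1,2) s(1), of "\<lambda>j t. \<psi> (V j t)"] P(3)[of \<psi>] elim_hom[OF h(1), of V r s] by simp
  next
    case 3 then show ?case using P(1) s(1) insert.prems(1) assms(2) by (intro subring_set_closed) auto
  qed
qed

text \<open>Elimination clears column \<open>s\<close> in the remaining rows, so coordinate
  \<open>s\<close> of a solution of the reduced system can still be adjusted to satisfy row
  \<open>r\<close>.\<close>

lemma indep_imp_solvable:
  assumes "finite J" "finite S" "indep UNIV J S (V :: 'j \<Rightarrow> 's \<Rightarrow> 'a::field)"
  shows "\<exists>x. \<forall>j\<in>J. (\<Sum>s\<in>S. V j s * x s) = b j"
  using assms(1,3)
proof (induction J arbitrary: V b rule: finite_induct)
  case (insert r J)
  have uf: "is_subfield (UNIV :: 'a set)" by (simp add: is_subfield_def)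
  obtain s where s: "s \<in> S" "V r s \<noteq> 0" "indep UNIV J S (elim V r s)"
    using indep_elim[OF insert.hyps(1,2) uf _ insert.prems] by blast
  obtain x where x: "\<And>j. j \<in> J \<Longrightarrow> (\<Sum>t\<in>S. elim V r s j t * x t) = V r s * b j - V j s * b r"
    using insert.IH[OF s(3), of "\<lambda>j. V r s * b j - V j s * b r"] by blast
  let ?d = "(b r - (\<Sum>t\<in>S. V r t * x t)) / V r s"
  let ?x = "\<lambda>t. x t + (if t = s then ?d else 0)"
  have sum: "(\<Sum>t\<in>S. V j t * ?x t) = (\<Sum>t\<in>S. V j t * x t) + V j s * ?d" for j
    using s(1) assms(2) by (simp add: algebra_simps sum.distrib if_distrib[of "(*) _"] sum.delta cong: if_cong)
  have r: "(\<Sum>t\<in>S. V r t * ?x t) = b r"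
    using s(2) by (simp add: sum)
  moreover have "(\<Sum>t\<in>S. V j t * ?x t) = b j" if "j \<in> J" for j
  proof -
    have "V r s * (\<Sum>t\<in>S. V j t * x t) - V j s * (\<Sum>t\<in>S. V r t * x t) = V r s * b j - V j s * b r"
      using x[OF that] by (simp add: elim_def algebra_simps sum_subtractf sum_distrib_left)
    then have "V r s * (\<Sum>t\<in>S. V j t * x t) + V j s * (b r - (\<Sum>t\<in>S. V r t * x t)) = V r s * b j"
      by (simp add: algebra_simps)
    then show ?thesis using s(2) unfolding sum by (simp add: field_simps)
  qed
  ultimately show ?case by (intro exI[of _ ?x]) auto
qed simp

text \<open>Induction on the columns: a pivot in column \<open>s\<close> removes one row together
  with that column, and a column that vanishes on \<open>J\<close> is simply dropped.\<close>

lemma dependent_if_card_less: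
  assumes "finite S" "finite J" "card S < card J" "is_subfield F"
    and "\<And>j t. j \<in> J \<Longrightarrow> t \<in> S \<Longrightarrow> V j t \<in> F"
  shows "\<not> indep F J S V"
  using assms(1-3,5)
proof (induction S arbitrary: J V rule: finite_induct)
  case empty
  then obtain j where "j \<in> J" by fastforce
  then show ?case using subfield_closed(2)[OF assms(4)]
    by (auto simp: indep_def intro!: exI[of _ "\<lambda>_. 1"])
next
  case (insert s S)
  show ?case
  proof
    assume ind: "indep F J (insert s S) V"
    have "J \<noteq> {}" using insert.prems by auto
    show False
    proof (cases "\<exists>r\<in>J. V r s \<noteq> 0")
      case False
      then have "indep F J S V" using ind by (auto simp: indep_def)
      then show False using insert.IH[of J V] insert.prems insert.hyps by auto
    next
      case True
      then obtain r where r: "r \<in> J" "V r s \<noteq> 0" by auto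
      let ?J = "J - {r}"
      have J: "J = insert r ?J" "r \<notin> ?J" "finite ?J" using r insert.prems by auto
      note cl = subfield_closed[OF assms(4)]
      have Vr: "V j t \<in> F" if "j \<in> J" "t \<in> insert s S" for j t using insert.prems(3) that by blast
      have "indep F ?J S (elim V r s)"
        unfolding indep_def
      proof (intro allI impI, elim conjE)
        fix \<gamma> assume \<gamma>: "\<forall>j\<in>?J. \<gamma> j \<in> F" "\<forall>t\<in>S. (\<Sum>j\<in>?J. \<gamma> j * elim V r s j t) = 0"
        let ?g = "\<lambda>j. if j = r then - (\<Sum>j\<in>?J. \<gamma> j * V j s) else \<gamma> j * V r s"
        have "(\<Sum>j\<in>J. ?g j * V j t) = 0" if t: "t \<in> insert s S" for t
        proof -
          have e: "(\<Sum>j\<in>?J. ?g j * V j t) = (\<Sum>j\<in>?J. \<gamma> j * V r s * V j t)"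
            by (intro sum.cong) auto
          have "(\<Sum>j\<in>J. ?g j * V j t) = ?g r * V r t + (\<Sum>j\<in>?J. ?g j * V j t)"
            using r(1) insert.prems(1) by (simp add: sum.remove)
          also have "\<dots> = (\<Sum>j\<in>?J. \<gamma> j * elim V r s j t)"
            unfolding e by (simp add: elim_def algebra_simps sum_subtractf sum_distrib_left sum_distrib_right)
          finally have "(\<Sum>j\<in>J. ?g j * V j t) = (\<Sum>j\<in>?J. \<gamma> j * elim V r s j t)" .
          moreover have "elim V r s j s = 0" for j by (simp add: elim_def)
          ultimately show ?thesis using \<gamma>(2) t by (cases "t = s") auto
        qed
        moreover have "?g j \<in> F" if "j \<in> J" for j
          using that \<gamma>(1) Vr r(1) by (auto intro!: cl)
        ultimately have "\<forall>j\<in>J. ?g j = 0" using indepD[OF ind, of ?g] by blast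
        then show "\<forall>j\<in>?J. \<gamma> j = 0" using r(2) by (metis DiffE insertCI mult_eq_0_iff)
      qed
      moreover have "elim V r s j t \<in> F" if "j \<in> ?J" "t \<in> S" for j t
        unfolding elim_def using that Vr r(1) by (auto intro!: cl)
      moreover have "card S < card ?J" using insert.prems insert.hyps r(1) by simp
      ultimately show False using insert.IH[of ?J "elim V r s"] J(3) by blast
    qed
  qed
qed

text \<open>For a local ring \<open>Q\<close> with residue map \<open>\<epsilon>\<close>: a linear system whose rows stay independent in the
  residue field can only have solutions in \<open>Q\<close>.\<close>

lemma local_ring_coefficients:
  fixes \<epsilon> :: "'a::field \<Rightarrow> 'b::field"
  assumes Q: "subring_set Q"
    and \<epsilon>: "\<And>x y. x \<in> Q \<Longrightarrow> y \<in> Q \<Longrightarrow> \<epsilon> (x - y) = \<epsilon> x - \<epsilon> y"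
      "\<And>x y. x \<in> Q \<Longrightarrow> y \<in> Q \<Longrightarrow> \<epsilon> (x * y) = \<epsilon> x * \<epsilon> y"
      "\<And>x. x \<in> Q \<Longrightarrow> \<epsilon> x \<noteq> 0 \<Longrightarrow> inverse x \<in> Q"
    and "finite J" "\<And>j t. j \<in> J \<Longrightarrow> t \<in> S \<Longrightarrow> V j t \<in> Q" "\<And>t. t \<in> S \<Longrightarrow> w t \<in> Q"
    and "indep UNIV J S (\<lambda>j t. \<epsilon> (V j t))"
    and "\<And>t. t \<in> S \<Longrightarrow> (\<Sum>j\<in>J. \<alpha> j * V j t) = w t"
  shows "\<forall>j\<in>J. \<alpha> j \<in> Q"
  using assms(5-9)
proof (induction J arbitrary: V w rule: finite_induct)
  case (insert r J)
  have uf: "is_subfield (UNIV :: 'b set)" by (simp add: is_subfield_def)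
  obtain s where s: "s \<in> S" "\<epsilon> (V r s) \<noteq> 0" "indep UNIV J S (elim (\<lambda>j t. \<epsilon> (V j t)) r s)"
    using indep_elim[OF insert.hyps(1,2) uf _ insert.prems(3)] by blast
  note VQ = insert.prems(1) and wQ = insert.prems(2)
  have e0: "\<epsilon> 0 = 0" using \<epsilon>(1)[of 0 0] subring_set_0[OF Q] by simp
  \<comment> \<open>A nonzero residue makes the pivot a unit of \<open>Q\<close>, so back
    substitution never leaves \<open>Q\<close>.\<close>
  have inv: "inverse (V r s) \<in> Q" "V r s \<noteq> 0" using \<epsilon>(3)[OF VQ] s e0 by auto
  have ind: "indep UNIV J S (\<lambda>j t. \<epsilon> (elim V r s j t))"
  proof -
    have "\<epsilon> (elim V r s j t) = elim (\<lambda>j t. \<epsilon> (V j t)) r s j t" if "j \<in> J" "t \<in> S" for j t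
      using that s(1) VQ by (simp add: elim_def \<epsilon> subring_set_mult[OF Q])
    then show ?thesis using s(3) by (simp add: indep_def)
  qed
  have eq: "(\<Sum>j\<in>J. \<alpha> j * V j t) = w t - \<alpha> r * V r t" if "t \<in> S" for t
    using insert.prems(4)[OF that] insert.hyps by (simp add: algebra_simps)
  have "(\<Sum>j\<in>J. \<alpha> j * elim V r s j t) = V r s * w t - w s * V r t" if t: "t \<in> S" for t
  proof -
    have "(\<Sum>j\<in>J. \<alpha> j * elim V r s j t) = V r s * (\<Sum>j\<in>J. \<alpha> j * V j t) - V r t * (\<Sum>j\<in>J. \<alpha> j * V j s)"
      by (simp add: elim_def algebra_simps sum_subtractf sum_distrib_left)
    then show ?thesis unfolding eq[OF t] eq[OF s(1)] by (simp add: algebra_simps)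
  qed
  then have J: "\<forall>j\<in>J. \<alpha> j \<in> Q"
    using insert.IH[OF _ _ ind, of "\<lambda>t. V r s * w t - w s * V r t"] VQ wQ s(1)
    by (auto simp: elim_def intro!: subring_set_closed[OF Q])
  have "\<alpha> r = (w s - (\<Sum>j\<in>J. \<alpha> j * V j s)) * inverse (V r s)"
    using eq[OF s(1)] inv(2) by (simp add: field_simps)
  also have "\<dots> \<in> Q" using J VQ wQ s(1) inv(1) by (auto intro!: subring_set_closed[OF Q])
  finally show ?case using J by simp
qed simp

section \<open>Points avoiding countably many hypersurfaces\<close>

text \<open>Induction on the variables: with the others fixed, the relation is a univariate
  polynomial in \<open>z v\<close> that vanishes everywhere, so the monomials may be sorted by their
  exponent of \<open>v\<close> and treated class by class.\<close>

lemma distinct_monomials_independent: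
  fixes c :: "'i \<Rightarrow> complex" and e :: "'i \<Rightarrow> 'v \<Rightarrow> nat"
  assumes "finite V" "finite I"
    and "\<And>i j. i \<in> I \<Longrightarrow> j \<in> I \<Longrightarrow> i \<noteq> j \<Longrightarrow> \<exists>v\<in>V. e i v \<noteq> e j v"
    and "\<And>z. (\<Sum>i\<in>I. c i * (\<Prod>v\<in>V. z v ^ e i v)) = 0"
    and "i \<in> I"
  shows "c i = 0"
  using assms
proof (induction V arbitrary: I i rule: finite_induct)
  case empty
  then have "I = {i}" by auto
  with empty.prems(3) show ?case by simp
next
  case (insert v V)
  let ?I = "{j \<in> I. e j v = e i v}"
  have "(\<Sum>j\<in>?I. c j * (\<Prod>w\<in>V. z w ^ e j w)) = 0" for z
  proof -
    define q where "q = (\<Sum>j\<in>I. monom (c j * (\<Prod>w\<in>V. z w ^ e j w)) (e j v))"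
    have "poly q s = 0" for s
    proof -
      have "(\<Prod>w\<in>V. (z(v := s)) w ^ e j w) = (\<Prod>w\<in>V. z w ^ e j w)" for j
        using insert.hyps(2) by (intro prod.cong) auto
      then have "poly q s = (\<Sum>j\<in>I. c j * (\<Prod>w\<in>insert v V. (z(v := s)) w ^ e j w))"
        using insert.hyps by (simp add: q_def poly_sum poly_monom algebra_simps)
      also have "\<dots> = 0" by (rule insert.prems(3))
      finally show ?thesis .
    qed
    then have "q = 0" using poly_all_0_iff_0 by blast
    then have "coeff q (e i v) = 0" by simp
    then show ?thesis
      using insert.prems(1) by (simp add: q_def coeff_sum sum.inter_filter)
  qed
  moreover have "\<exists>w\<in>V. e a w \<noteq> e b w" if "a \<in> ?I" "b \<in> ?I" "a \<noteq> b" for a b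
    using insert.prems(2)[of a b] that by auto
  ultimately show ?case
    using insert.IH[of ?I i] insert.prems(1,4) by auto
qed

lemma finite_mp_vars: "finite (mp_vars p)"
  by (simp add: mp_vars_def)

lemma mpoly_nonzero_imp_nonvanishing:
  assumes "P \<noteq> (0 :: ('v, complex) mpoly)"
  shows "\<exists>z. mp_eval z P \<noteq> 0"
proof (rule ccontr)
  assume neg: "\<not> ?thesis"
  obtain m where m: "m \<in> Poly_Mapping.keys P" using assms by (auto simp flip: keys_eq_empty)
  have "Poly_Mapping.lookup P m = 0"
  proof (rule distinct_monomials_independent[OF finite_mp_vars finite_keys _ _ m, where e = Poly_Mapping.lookup])
    fix a b assume ab: "a \<in> Poly_Mapping.keys P" "b \<in> Poly_Mapping.keys P" "a \<noteq> b"
    then obtain v where "Poly_Mapping.lookup a v \<noteq> Poly_Mapping.lookup b v"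
      by (metis poly_mapping_eqI)
    moreover from this have "v \<in> Poly_Mapping.keys a \<or> v \<in> Poly_Mapping.keys b" by (metis in_keys_iff)
    then have "v \<in> mp_vars P" using ab unfolding mp_vars_def by blast
    ultimately show "\<exists>v\<in>mp_vars P. Poly_Mapping.lookup a v \<noteq> Poly_Mapping.lookup b v" by blast
  next
    fix z :: "'v \<Rightarrow> complex"
    have "mon_val z m = (\<Prod>v\<in>mp_vars P. z v ^ Poly_Mapping.lookup m v)" if "m \<in> Poly_Mapping.keys P" for m
      using that by (intro mon_val_superset finite_mp_vars) (auto simp: mp_vars_def)
    then have "mp_eval z P = (\<Sum>m\<in>Poly_Mapping.keys P. Poly_Mapping.lookup P m *
        (\<Prod>v\<in>mp_vars P. z v ^ Poly_Mapping.lookup m v))"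
      unfolding mp_eval_eq_mev mev_def by (intro sum.cong) auto
    then show "(\<Sum>m\<in>Poly_Mapping.keys P. Poly_Mapping.lookup P m *
        (\<Prod>v\<in>mp_vars P. z v ^ Poly_Mapping.lookup m v)) = 0"
      using neg by simp
  qed
  with m show False by (simp add: in_keys_iff)
qed

lemma is_hom_poly_const: "is_hom (\<lambda>c::'a::comm_ring_1. [:c:])"
  by (simp add: is_hom_def one_pCons)

lemma is_hom_poly_eval: "is_hom (\<lambda>q. poly q (s::'a::comm_ring_1))"
  by (simp add: is_hom_def)

lemma mp_eval_fun_upd_poly:
  fixes P :: "('v, complex) mpoly"
  shows "\<exists>q. \<forall>s. mp_eval (z(v := s)) P = poly q s"
proof (intro exI allI)
  fix s
  let ?q = "mev (\<lambda>c. [:c:]) (\<lambda>w. if w = v then [:0, 1:] else [:z w:]) P"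
  have "poly ?q s = mev (\<lambda>c. c) (\<lambda>w. poly (if w = v then [:0, 1:] else [:z w:]) s) P"
    by (subst hom_mev[OF is_hom_poly_eval is_hom_poly_const]) simp
  also have "\<dots> = mp_eval (z(v := s)) P"
    unfolding mp_eval_eq_mev by (rule mev_cong) auto
  finally show "mp_eval (z(v := s)) P = poly ?q s" by simp
qed

lemma countable_avoid: "countable B \<Longrightarrow> \<exists>s::complex. s \<notin> B"
proof (rule ccontr)
  assume "countable B" "\<not> (\<exists>s. s \<notin> B)"
  then have "countable (UNIV :: complex set)" by (auto elim: countable_subset[rotated])
  then show False using uncountable_UNIV_complex by simp
qed

text \<open>Coordinates are fixed one at a time. The invariant is that for each \<open>P\<close> the
  point fixed so far still extends to a nonzero of \<open>P\<close>, where the extension may depend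
  on \<open>P\<close>. Each step forbids finitely many values per \<open>P\<close>, hence countably
  many in all.\<close>

lemma generic_point_exists:
  fixes \<P> :: "('v, complex) mpoly set"
  assumes "countable \<P>" "finite V"
    and "\<And>P. P \<in> \<P> \<Longrightarrow> mp_vars P \<subseteq> V" "\<And>P. P \<in> \<P> \<Longrightarrow> \<exists>z. mp_eval z P \<noteq> 0"
  shows "\<exists>z. \<forall>P\<in>\<P>. mp_eval z P \<noteq> 0"
proof -
  have "\<exists>z. \<forall>P\<in>\<P>. \<exists>w. (\<forall>v\<in>W. w v = z v) \<and> mp_eval w P \<noteq> 0" if "finite W" for W
    using that
  proof (induction W rule: finite_induct)
    case empty
    then show ?case using assms(4) by auto
  next
    case (insert v W)
    then obtain z where "\<forall>P\<in>\<P>. \<exists>w. (\<forall>v\<in>W. w v = z v) \<and> mp_eval w P \<noteq> 0" by blast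
    then obtain w where w: "\<And>P. P \<in> \<P> \<Longrightarrow> (\<forall>v\<in>W. w P v = z v) \<and> mp_eval (w P) P \<noteq> 0" by metis
    have "finite {s. mp_eval ((w P)(v := s)) P = 0}" if P: "P \<in> \<P>" for P
    proof -
      obtain q where q: "\<And>s. mp_eval ((w P)(v := s)) P = poly q s"
        using mp_eval_fun_upd_poly[of "w P" v P] by blast
      then have "poly q (w P v) \<noteq> 0" using w[OF P] by (metis fun_upd_triv)
      then have "q \<noteq> 0" by auto
      then show ?thesis unfolding q by (rule poly_roots_finite)
    qed
    then have cn: "countable (\<Union>P\<in>\<P>. {s. mp_eval ((w P)(v := s)) P = 0})"
      using assms(1) by (simp add: countable_finite)
    from countable_avoid[OF cn] obtain s where s: "s \<notin> (\<Union>P\<in>\<P>. {s. mp_eval ((w P)(v := s)) P = 0})" ..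
    show ?case
    proof (rule exI[of _ "z(v := s)"], rule ballI)
      fix P assume P: "P \<in> \<P>"
      show "\<exists>w. (\<forall>u\<in>insert v W. w u = (z(v := s)) u) \<and> mp_eval w P \<noteq> 0"
        using s P w[OF P] by (intro exI[of _ "(w P)(v := s)"]) auto
    qed
  qed
  from this[OF assms(2)] obtain z
    where z: "\<forall>P\<in>\<P>. \<exists>w. (\<forall>v\<in>V. w v = z v) \<and> mp_eval w P \<noteq> 0" by blast
  have "mp_eval z P \<noteq> 0" if P: "P \<in> \<P>" for P
  proof -
    obtain w where w: "\<forall>v\<in>V. w v = z v" "mp_eval w P \<noteq> 0" using z P by blast
    have "mp_eval z P = mp_eval w P"
      using w(1) assms(3)[OF P] by (intro mp_eval_cong) auto
    with w(2) show ?thesis by simp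
  qed
  then show ?thesis by blast
qed

section \<open>Values of rational functions\<close>

lemma rf_eval_Fract:
  assumes "mp_eval \<mu> Q \<noteq> 0"
  shows "rf_eval \<mu> (Fract P Q) = mp_eval \<mu> P / mp_eval \<mu> Q"
  unfolding rf_eval_def
proof (rule the_equality)
  fix z assume "\<exists>P' Q'. mp_eval \<mu> Q' \<noteq> 0 \<and> Fract P Q = Fract P' Q' \<and> z = mp_eval \<mu> P' / mp_eval \<mu> Q'"
  then obtain P' Q' where *: "mp_eval \<mu> Q' \<noteq> 0" "Fract P Q = Fract P' Q'" "z = mp_eval \<mu> P' / mp_eval \<mu> Q'"
    by blast
  have nz: "Q \<noteq> 0" "Q' \<noteq> 0" using assms *(1) is_hom_0[OF is_hom_mp_eval] by metis+
  then have "P * Q' = P' * Q" using *(2) by (simp add: eq_fract)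
  then have "mp_eval \<mu> P * mp_eval \<mu> Q' = mp_eval \<mu> P' * mp_eval \<mu> Q"
    by (metis is_hom_mult[OF is_hom_mp_eval])
  then show "z = mp_eval \<mu> P / mp_eval \<mu> Q"
    unfolding *(3) frac_eq_eq[OF *(1) assms] by simp
qed (use assms in blast)

lemma rf_regular_atE:
  assumes "rf_regular_at N h \<mu>"
  obtains P Q where "mp_vars P \<subseteq> {1..N}" "mp_vars Q \<subseteq> {1..N}" "mp_eval \<mu> Q \<noteq> 0" "h = Fract P Q"
    "rf_eval \<mu> h = mp_eval \<mu> P / mp_eval \<mu> Q" "Q \<noteq> 0"
  using assms rf_eval_Fract is_hom_0[OF is_hom_mp_eval] unfolding rf_regular_at_def by metis

text \<open>The local ring of affine \<open>N\<close>-space at \<open>\<mu>\<close>, with residue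
  map \<open>rf_eval \<mu>\<close>.\<close>

definition regular_ring :: "nat \<Rightarrow> (nat \<Rightarrow> complex) \<Rightarrow> ratfun set" where
  "regular_ring N \<mu> = {h. rf_regular_at N h \<mu>}"

lemma polys_over_UNIV: "p \<in> polys_over UNIV V \<longleftrightarrow> mp_vars p \<subseteq> V"
  by (simp add: polys_over_def)

lemmas mp_vars_closed = subring_set_closed[OF subring_polys_over[OF subring_UNIV], unfolded polys_over_UNIV]

lemma regular_diff_mult:
  assumes "rf_regular_at N g \<mu>" "rf_regular_at N h \<mu>"
  shows "rf_regular_at N (g - h) \<mu>" "rf_eval \<mu> (g - h) = rf_eval \<mu> g - rf_eval \<mu> h"
    "rf_regular_at N (g * h) \<mu>" "rf_eval \<mu> (g * h) = rf_eval \<mu> g * rf_eval \<mu> h"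
proof -
  obtain P Q where 1: "mp_vars P \<subseteq> {1..N}" "mp_vars Q \<subseteq> {1..N}" "mp_eval \<mu> Q \<noteq> 0" "g = Fract P Q"
    "rf_eval \<mu> g = mp_eval \<mu> P / mp_eval \<mu> Q" "Q \<noteq> 0" using rf_regular_atE[OF assms(1)] .
  obtain P' Q' where 2: "mp_vars P' \<subseteq> {1..N}" "mp_vars Q' \<subseteq> {1..N}" "mp_eval \<mu> Q' \<noteq> 0" "h = Fract P' Q'"
    "rf_eval \<mu> h = mp_eval \<mu> P' / mp_eval \<mu> Q'" "Q' \<noteq> 0" using rf_regular_atE[OF assms(2)] .
  note hom = is_hom_simps[OF is_hom_mp_eval]
  have d: "g - h = Fract (P * Q' - P' * Q) (Q * Q')" and m: "g * h = Fract (P * P') (Q * Q')"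
    using 1 2 by auto
  have nz: "mp_eval \<mu> (Q * Q') \<noteq> 0" using 1 2 by (simp add: hom)
  have v: "mp_vars (P * Q' - P' * Q) \<subseteq> {1..N} \<and> mp_vars (P * P') \<subseteq> {1..N} \<and> mp_vars (Q * Q') \<subseteq> {1..N}"
    using 1 2 by (intro conjI mp_vars_closed)
  show "rf_regular_at N (g - h) \<mu>" "rf_regular_at N (g * h) \<mu>"
    unfolding rf_regular_at_def using d m nz v by blast+
  show "rf_eval \<mu> (g - h) = rf_eval \<mu> g - rf_eval \<mu> h"
    unfolding d rf_eval_Fract[OF nz] using 1 2 by (simp add: hom field_simps)
  show "rf_eval \<mu> (g * h) = rf_eval \<mu> g * rf_eval \<mu> h"
    unfolding m rf_eval_Fract[OF nz] using 1 2 by (simp add: hom field_simps)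
qed

lemma regular_polynomial:
  assumes "mp_vars P \<subseteq> {1..N}"
  shows "rf_regular_at N (Fract P 1) \<mu>" "rf_eval \<mu> (Fract P 1) = mp_eval \<mu> P"
proof -
  have 1: "mp_eval \<mu> 1 = 1" by (rule is_hom_1[OF is_hom_mp_eval])
  show "rf_regular_at N (Fract P 1) \<mu>" unfolding rf_regular_at_def
    using assms 1 by (intro exI[of _ P] exI[of _ 1]) auto
  show "rf_eval \<mu> (Fract P 1) = mp_eval \<mu> P" using rf_eval_Fract[of \<mu> 1 P] 1 by simp
qed

lemma regular_1: "rf_regular_at N 1 \<mu>" "rf_eval \<mu> 1 = 1"
  using regular_polynomial[of 1 N \<mu>] by (auto simp: One_fract_def is_hom_1[OF is_hom_mp_eval])

lemma subring_regular_ring: "subring_set (regular_ring N \<mu>)"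
  by (auto simp: subring_set_def regular_ring_def regular_1 regular_diff_mult)

lemmas regular_closed = subring_set_closed[OF subring_regular_ring, unfolded regular_ring_def mem_Collect_eq]

lemma rf_eval_0 [simp]: "rf_eval \<mu> 0 = 0"
  using regular_diff_mult(2)[OF regular_1(1) regular_1(1), of \<mu>] by simp

lemma rf_eval_add:
  assumes "rf_regular_at N g \<mu>" "rf_regular_at N h \<mu>"
  shows "rf_eval \<mu> (g + h) = rf_eval \<mu> g + rf_eval \<mu> h"
  using regular_diff_mult(2)[of N 0 \<mu> h] regular_diff_mult(2)[of N g \<mu> "- h"] assms
  by (simp add: regular_closed)

lemma rf_eval_sum:
  assumes "\<And>a. a \<in> A \<Longrightarrow> rf_regular_at N (f a) \<mu>"
  shows "rf_eval \<mu> (sum f A) = (\<Sum>a\<in>A. rf_eval \<mu> (f a))"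
  using assms
proof (induction A rule: infinite_finite_induct)
  case (insert x A)
  then show ?case by (simp add: rf_eval_add[of N] regular_closed)
qed auto

lemma rf_eval_const: "rf_eval \<mu> (rf_const c) = c" and regular_const: "rf_regular_at N (rf_const c) \<mu>"
  using regular_polynomial[of "mp_const c" N \<mu>] regular_polynomial[of "mp_const c" 0 \<mu>]
  by (auto simp: rf_const_def)

lemma regular_inverse:
  assumes "rf_regular_at N h \<mu>" "rf_eval \<mu> h \<noteq> 0"
  shows "rf_regular_at N (inverse h) \<mu>" "rf_eval \<mu> (inverse h) = inverse (rf_eval \<mu> h)"
proof -
  obtain P Q where 1: "mp_vars P \<subseteq> {1..N}" "mp_vars Q \<subseteq> {1..N}" "mp_eval \<mu> Q \<noteq> 0" "h = Fract P Q"
    "rf_eval \<mu> h = mp_eval \<mu> P / mp_eval \<mu> Q" "Q \<noteq> 0" using rf_regular_atE[OF assms(1)] .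
  have P: "mp_eval \<mu> P \<noteq> 0" using assms(2) 1(5) by auto
  show "rf_regular_at N (inverse h) \<mu>" unfolding rf_regular_at_def 1(4) inverse_fract using 1 P by blast
  show "rf_eval \<mu> (inverse h) = inverse (rf_eval \<mu> h)"
    unfolding 1(5) unfolding 1(4) inverse_fract rf_eval_Fract[OF P] by simp
qed

text \<open>The fraction field of the polynomials over \<open>k\<close>. It is a field already when
  \<open>k\<close> is a subring, and fields of definition are produced below only as
  subrings.\<close>

definition ratfuns_over :: "complex set \<Rightarrow> nat \<Rightarrow> ratfun set" where
  "ratfuns_over k N = {Fract P Q | P Q. P \<in> polys_over k {1..N} \<and> Q \<in> polys_over k {1..N} \<and> Q \<noteq> 0}"

lemma ratfuns_eq_over: "ratfuns N = ratfuns_over UNIV N"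
  by (auto simp: ratfuns_def ratfuns_over_def polys_over_def)

lemma subfield_ratfuns_over:
  assumes "subring_set k"
  shows "is_subfield (ratfuns_over k N)"
  unfolding is_subfield_def
proof (intro conjI ballI impI)
  note cl = subring_set_closed[OF subring_polys_over[OF assms, of "{1..N}"]]
  show "1 \<in> ratfuns_over k N"
    unfolding ratfuns_over_def mem_Collect_eq
    using cl(2) by (intro exI[of _ 1]) (simp add: One_fract_def del: One_nat_def)
  fix x assume "x \<in> ratfuns_over k N"
  then obtain P Q where x: "x = Fract P Q" "P \<in> polys_over k {1..N}" "Q \<in> polys_over k {1..N}" "Q \<noteq> 0"
    by (auto simp: ratfuns_over_def)
  {
    fix y assume "y \<in> ratfuns_over k N"
    then obtain P' Q' where y: "y = Fract P' Q'" "P' \<in> polys_over k {1..N}" "Q' \<in> polys_over k {1..N}" "Q' \<noteq> 0"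
      by (auto simp: ratfuns_over_def)
    show "x - y \<in> ratfuns_over k N" unfolding ratfuns_over_def mem_Collect_eq
      using x y by (rule_tac exI[of _ "P * Q' - P' * Q"], rule_tac exI[of _ "Q * Q'"]) (simp add: cl del: One_nat_def)
    show "x * y \<in> ratfuns_over k N" unfolding ratfuns_over_def mem_Collect_eq
      using x y by (rule_tac exI[of _ "P * P'"], rule_tac exI[of _ "Q * Q'"]) (simp add: cl del: One_nat_def)
  }
  assume "x \<noteq> 0"
  then have "P \<noteq> 0" using x(1) by (auto simp: fract_collapse)
  then show "inverse x \<in> ratfuns_over k N"
    using x by (auto simp: ratfuns_over_def)
qed

lemma subfield_ratfuns: "is_subfield (ratfuns N)"
  unfolding ratfuns_eq_over by (rule subfield_ratfuns_over[OF subring_UNIV])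

lemma ratfuns_polynomial: "mp_vars P \<subseteq> {1..N} \<Longrightarrow> Fract P 1 \<in> ratfuns N"
  unfolding ratfuns_def mem_Collect_eq by (rule exI[of _ P], rule exI[of _ 1]) simp

lemma is_hom_Fract: "is_hom (\<lambda>P::'a::idom. Fract P 1)"
  by (auto simp: is_hom_def One_fract_def)

lemma ratfun_generic:
  assumes "h \<in> ratfuns N"
  obtains Q where "mp_vars Q \<subseteq> {1..N}" "Q \<noteq> 0"
    "\<And>\<mu>. mp_eval \<mu> Q \<noteq> 0 \<Longrightarrow> rf_regular_at N h \<mu> \<and> (h \<noteq> 0 \<longrightarrow> rf_eval \<mu> h \<noteq> 0)"
proof -
  obtain P Q where h: "h = Fract P Q" "mp_vars P \<subseteq> {1..N}" "mp_vars Q \<subseteq> {1..N}" "Q \<noteq> 0"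
    using assms by (auto simp: ratfuns_def)
  show thesis
  proof (cases "h = 0")
    case True
    then show thesis using that[of 1] by (simp add: regular_closed)
  next
    case False
    then have P: "P \<noteq> 0" using h by (auto simp: fract_collapse)
    show thesis
    proof (rule that[of "P * Q"])
      show "mp_vars (P * Q) \<subseteq> {1..N}" using h by (intro mp_vars_closed)
      show "P * Q \<noteq> 0" using P h by simp
      fix \<mu> assume "mp_eval \<mu> (P * Q) \<noteq> 0"
      then have "mp_eval \<mu> P \<noteq> 0" "mp_eval \<mu> Q \<noteq> 0" by (auto simp: is_hom_simps[OF is_hom_mp_eval])
      then show "rf_regular_at N h \<mu> \<and> (h \<noteq> 0 \<longrightarrow> rf_eval \<mu> h \<noteq> 0)"
        using h rf_eval_Fract[of \<mu> Q P] unfolding rf_regular_at_def by auto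
    qed
  qed
qed

section \<open>Extending field embeddings\<close>

lemma complex_poly_has_root:
  fixes p :: "complex poly"
  assumes "degree p \<noteq> 0"
  shows "\<exists>w. poly p w = 0"
proof -
  have "\<exists>i\<in>{1..degree p}. coeff p i \<noteq> 0"
    using assms by (intro bexI[of _ "degree p"]) auto
  then obtain w where "(\<Sum>i\<le>degree p. coeff p i * w ^ i) = 0"
    using fundamental_theorem_of_algebra[of "coeff p" "degree p"] by blast
  then show ?thesis by (auto simp: poly_altdef)
qed

text \<open>Countability of \<open>L\<close> belongs to the notion because it leaves room in
  \<complex> for the image of a transcendental element.\<close>

definition embedding :: "complex set \<Rightarrow> (complex \<Rightarrow> complex) \<Rightarrow> bool" where
  "embedding L \<sigma> \<longleftrightarrow> is_subfield L \<and> countable L \<and> \<sigma> 1 = 1 \<and>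
     (\<forall>x\<in>L. \<forall>y\<in>L. \<sigma> (x - y) = \<sigma> x - \<sigma> y \<and> \<sigma> (x * y) = \<sigma> x * \<sigma> y)"

locale embedded_field =
  fixes L :: "complex set" and \<sigma> :: "complex \<Rightarrow> complex"
  assumes emb: "embedding L \<sigma>"
begin

lemma subfield: "is_subfield L" and countable: "countable L"
  using emb by (auto simp: embedding_def)

lemmas closed = subfield_closed[OF subfield]

lemma \<sigma>_1: "\<sigma> 1 = 1"
  and \<sigma>_diff: "x \<in> L \<Longrightarrow> y \<in> L \<Longrightarrow> \<sigma> (x - y) = \<sigma> x - \<sigma> y"
  and \<sigma>_mult: "x \<in> L \<Longrightarrow> y \<in> L \<Longrightarrow> \<sigma> (x * y) = \<sigma> x * \<sigma> y"
  using emb by (auto simp: embedding_def)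

lemma \<sigma>_0: "\<sigma> 0 = 0" using \<sigma>_diff[of 0 0] closed by simp

lemma \<sigma>_add: "x \<in> L \<Longrightarrow> y \<in> L \<Longrightarrow> \<sigma> (x + y) = \<sigma> x + \<sigma> y"
  using \<sigma>_diff[of x "- y"] \<sigma>_diff[of 0 y] closed \<sigma>_0 by simp

lemma \<sigma>_eq_0: "x \<in> L \<Longrightarrow> \<sigma> x = 0 \<Longrightarrow> x = 0"
  using \<sigma>_mult[of x "inverse x"] closed(10)[of x] \<sigma>_1 by (cases "x = 0") auto

lemma \<sigma>_sum: "(\<And>a. a \<in> A \<Longrightarrow> f a \<in> L) \<Longrightarrow> \<sigma> (sum f A) = (\<Sum>a\<in>A. \<sigma> (f a))"
  by (induction A rule: infinite_finite_induct) (auto simp: \<sigma>_0 \<sigma>_add closed)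

lemma \<sigma>_prod: "(\<And>a. a \<in> A \<Longrightarrow> f a \<in> L) \<Longrightarrow> \<sigma> (prod f A) = (\<Prod>a\<in>A. \<sigma> (f a))"
  by (induction A rule: infinite_finite_induct) (auto simp: \<sigma>_1 \<sigma>_mult closed)

lemma \<sigma>_power: "x \<in> L \<Longrightarrow> \<sigma> (x ^ n) = \<sigma> x ^ n"
  by (induction n) (auto simp: \<sigma>_1 \<sigma>_mult closed)

section \<open>Polynomials over the embedded field and conjugate elements\<close>

definition polys :: "complex poly set" where
  "polys = {p. \<forall>i. coeff p i \<in> L}"

lemma subring_polys: "subring_set polys"
  unfolding subring_set_def polys_def by (auto simp: coeff_mult coeff_1 intro!: closed)

lemmas polys_closed = subring_set_closed[OF subring_polys]

lemma polys_const: "c \<in> L \<Longrightarrow> [:c:] \<in> polys"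
  by (auto simp: polys_def coeff_pCons closed split: nat.split)

lemma polys_X: "[:0, 1:] \<in> polys"
  by (auto simp: polys_def coeff_pCons closed split: nat.split)

lemma polys_monom: "c \<in> L \<Longrightarrow> monom c n \<in> polys"
  by (auto simp: polys_def closed)

abbreviation "\<Sigma> \<equiv> map_poly \<sigma>"

lemma coeff_\<Sigma>: "coeff (\<Sigma> p) i = \<sigma> (coeff p i)"
  by (simp add: coeff_map_poly \<sigma>_0)

lemma \<Sigma>_diff: "p \<in> polys \<Longrightarrow> q \<in> polys \<Longrightarrow> \<Sigma> (p - q) = \<Sigma> p - \<Sigma> q"
  by (rule poly_eqI) (auto simp: coeff_\<Sigma> polys_def \<sigma>_diff)

lemma \<Sigma>_add: "p \<in> polys \<Longrightarrow> q \<in> polys \<Longrightarrow> \<Sigma> (p + q) = \<Sigma> p + \<Sigma> q"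
  by (rule poly_eqI) (auto simp: coeff_\<Sigma> polys_def \<sigma>_add)

lemma \<Sigma>_mult: "p \<in> polys \<Longrightarrow> q \<in> polys \<Longrightarrow> \<Sigma> (p * q) = \<Sigma> p * \<Sigma> q"
  by (rule poly_eqI) (auto simp: coeff_\<Sigma> polys_def \<sigma>_mult coeff_mult \<sigma>_sum closed)

lemma degree_\<Sigma>: "p \<in> polys \<Longrightarrow> degree (\<Sigma> p) = degree p"
  by (cases "p = 0") (auto simp: polys_def dest: \<sigma>_eq_0[rotated] intro!: map_poly_degree_eq)

lemma \<Sigma>_const: "\<Sigma> [:c:] = [:\<sigma> c:]"
  by (simp add: map_poly_pCons \<sigma>_0)

lemma \<Sigma>_X: "\<Sigma> [:0, 1:] = [:0, 1:]"
  by (simp add: map_poly_pCons \<sigma>_0 \<sigma>_1)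

lemma \<Sigma>_eq_0: "p \<in> polys \<Longrightarrow> \<Sigma> p = 0 \<Longrightarrow> p = 0"
  by (metis \<sigma>_eq_0 coeff_0 coeff_\<Sigma> mem_Collect_eq poly_eqI polys_def)

lemma division:
  assumes "p \<in> polys" "p \<noteq> 0" "q \<in> polys"
  shows "\<exists>d\<in>polys. \<exists>r\<in>polys. q = p * d + r \<and> (r = 0 \<or> degree r < degree p)"
  using assms(3)
proof (induction "degree q" arbitrary: q rule: less_induct)
  case less
  show ?case
  proof (cases "q = 0 \<or> degree q < degree p")
    case True
    then show ?thesis using less.prems polys_closed
      by (intro bexI[of _ 0] bexI[of _ q]) auto
  next
    case False
    let ?m = "monom (lead_coeff q / lead_coeff p) (degree q - degree p)"
    have lc: "lead_coeff q \<in> L" "lead_coeff p \<in> L" using less.prems assms by (auto simp: polys_def)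
    have m: "?m \<in> polys" by (intro polys_monom closed lc)
    let ?q = "q - p * ?m"
    have q': "?q \<in> polys" using m less.prems assms(1) by (intro polys_closed)
    have deg: "degree (p * ?m) \<le> degree q"
      using False assms(2) degree_mult_le[of p ?m] degree_monom_le[of "lead_coeff q / lead_coeff p" "degree q - degree p"]
      by linarith
    have "coeff ?q (degree q) = 0"
      using False assms(2) by (simp add: mult.commute[of p] coeff_monom_mult)
    then have "?q = 0 \<or> degree ?q < degree q"
      using deg by (metis degree_diff_le eq_zero_or_degree_less order_refl)
    then show ?thesis
    proof
      assume "?q = 0"
      then show ?thesis using m polys_closed(1) by (intro bexI[of _ ?m] bexI[of _ 0]) auto
    next
      assume "degree ?q < degree q"
      from less.hyps[OF this q'] obtain d r where dr: "d \<in> polys" "r \<in> polys" "?q = p * d + r"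
        "r = 0 \<or> degree r < degree p" by blast
      then have "q = p * (d + ?m) + r" by (simp add: algebra_simps)
      then show ?thesis using dr m polys_closed(6)[of d ?m] by blast
    qed
  qed
qed

text \<open>The condition for \<open>\<sigma>\<close> to extend to the field generated by
  \<open>z\<close> with \<open>z\<close> going to \<open>w\<close>: one direction makes the
  extension well defined, the other keeps denominators nonzero.\<close>

definition conj_pair :: "complex \<Rightarrow> complex \<Rightarrow> bool" where
  "conj_pair z w \<longleftrightarrow> (\<forall>q\<in>polys. poly q z = 0 \<longleftrightarrow> poly (\<Sigma> q) w = 0)"

definition min_poly :: "complex \<Rightarrow> complex poly \<Rightarrow> bool" where
  "min_poly z p \<longleftrightarrow> p \<in> polys \<and> p \<noteq> 0 \<and> poly p z = 0 \<and>
     (\<forall>q\<in>polys. q \<noteq> 0 \<and> poly q z = 0 \<longrightarrow> degree p \<le> degree q)"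

lemma min_poly_degree:
  assumes "min_poly z p"
  shows "degree p \<noteq> 0"
proof
  assume "degree p = 0"
  then obtain c where "p = [:c:]" by (rule degree_eq_zeroE)
  with assms show False by (simp add: min_poly_def)
qed

lemma min_poly_exists:
  assumes "q \<in> polys" "q \<noteq> 0" "poly q z = 0"
  obtains p where "min_poly z p"
proof -
  let ?P = "\<lambda>p. p \<in> polys \<and> p \<noteq> 0 \<and> poly p z = 0"
  have "\<exists>p. ?P p \<and> (\<forall>q. ?P q \<longrightarrow> degree p \<le> degree q)"
    by (rule ex_has_least_nat[where k=q]) (use assms in blast)
  then show thesis using that by (auto simp: min_poly_def)
qed

lemma min_poly_dvd:
  assumes "min_poly z p" "q \<in> polys" "poly q z = 0"
  obtains d where "d \<in> polys" "q = p * d"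
proof -
  obtain d r where dr: "d \<in> polys" "r \<in> polys" "q = p * d + r" "r = 0 \<or> degree r < degree p"
    using division[of p q] assms by (auto simp: min_poly_def)
  have "poly r z = 0" using assms dr(3) by (simp add: min_poly_def)
  then have "r = 0" using dr(2,4) assms(1) by (force simp: min_poly_def)
  then show thesis using that dr by simp
qed

text \<open>The direction from \<open>w\<close> back to \<open>z\<close> is irreducibility in
  disguise. Let \<open>g\<close> have least degree among the nonzero polynomials whose image
  vanishes at \<open>w\<close>; it divides \<open>p\<close>. If \<open>g\<close> did not vanish at
  \<open>z\<close>, the cofactor would, so by minimality of \<open>p\<close> it would have full
  degree and \<open>g\<close> would be constant. Hence \<open>g\<close> vanishes at
  \<open>z\<close>, and it divides \<open>q\<close>.\<close>

lemma min_poly_root_conj: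
  assumes p: "min_poly z p" and w: "poly (\<Sigma> p) w = 0"
  shows "conj_pair z w"
  unfolding conj_pair_def
proof (intro ballI iffI)
  fix q assume q: "q \<in> polys" "poly q z = 0"
  then obtain d where "d \<in> polys" "q = p * d" using min_poly_dvd[OF p] by blast
  then show "poly (\<Sigma> q) w = 0" using w p by (simp add: \<Sigma>_mult min_poly_def)
next
  fix q assume q: "q \<in> polys" "poly (\<Sigma> q) w = 0"
  have pp: "p \<in> polys" "p \<noteq> 0" "poly p z = 0" using p by (auto simp: min_poly_def)
  show "poly q z = 0"
  proof (cases "q = 0")
    case False
    let ?P = "\<lambda>p. p \<in> polys \<and> p \<noteq> 0 \<and> poly (\<Sigma> p) w = 0"
    have "\<exists>p. ?P p \<and> (\<forall>q. ?P q \<longrightarrow> degree p \<le> degree q)"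
      by (rule ex_has_least_nat[where k=q]) (use q False in blast)
    then obtain g where g: "g \<in> polys" "g \<noteq> 0" "poly (\<Sigma> g) w = 0"
      and gmin: "\<And>q. ?P q \<Longrightarrow> degree g \<le> degree q" by blast
    have dvd: "\<exists>d\<in>polys. f = g * d" if f: "f \<in> polys" "poly (\<Sigma> f) w = 0" for f
    proof -
      obtain d r where dr: "d \<in> polys" "r \<in> polys" "f = g * d + r" "r = 0 \<or> degree r < degree g"
        using division[of g f] g f by blast
      have "\<Sigma> f = \<Sigma> g * \<Sigma> d + \<Sigma> r"
        unfolding dr(3) using dr(1,2) g(1) polys_closed(4)[of g d] by (simp add: \<Sigma>_add \<Sigma>_mult)
      then have "poly (\<Sigma> r) w = 0" using f g by simp
      then have "r = 0" using dr(2,4) gmin[of r] by force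
      then show ?thesis using dr by auto
    qed
    have "poly g z = 0"
    proof (rule ccontr)
      assume gz: "poly g z \<noteq> 0"
      obtain d where d: "d \<in> polys" "p = g * d" using dvd[OF pp(1) w] by blast
      then have "d \<noteq> 0" "poly d z = 0" using pp gz by auto
      then have "degree p \<le> degree d" using p d(1) by (auto simp: min_poly_def)
      moreover have "degree p = degree g + degree d"
        unfolding d(2) by (rule degree_mult_eq) (use pp(2) d(2) in auto)
      ultimately have "degree g = 0" by simp
      then obtain c where "g = [:c:]" by (metis degree_eq_zeroE)
      moreover have "coeff g 0 \<in> L" using g(1) by (auto simp: polys_def)
      ultimately show False using g \<sigma>_eq_0[of c] by (auto simp: \<Sigma>_const)
    qed
    then show ?thesis using dvd[OF q] by auto
  qed simp
qed

lemma countable_polys: "countable polys"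
proof -
  have "polys \<subseteq> Poly ` {xs. set xs \<subseteq> L}"
  proof
    fix p assume "p \<in> polys"
    then have "set (coeffs p) \<subseteq> L"
      by (auto simp: polys_def coeffs_def)
    then show "p \<in> Poly ` {xs. set xs \<subseteq> L}"
      by (metis (mono_tags, lifting) Poly_coeffs image_iff mem_Collect_eq)
  qed
  moreover have "countable {xs. set xs \<subseteq> L}"
    using countable_lists[OF countable] by (simp add: lists_eq_set)
  ultimately show ?thesis by (meson countable_image countable_subset)
qed

text \<open>Any \<open>w\<close> transcendental over the image field serves; only countably many
  values are excluded, so a further prescribed value \<open>a\<close> can be avoided as
  well.\<close>

lemma transcendental_conj:
  assumes z: "\<And>q. q \<in> polys \<Longrightarrow> q \<noteq> 0 \<Longrightarrow> poly q z \<noteq> 0"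
  shows "\<exists>w. w \<noteq> a \<and> conj_pair z w"
proof -
  let ?B = "\<Union>q\<in>polys - {0}. {w. poly (\<Sigma> q) w = 0}"
  have "finite {w. poly (\<Sigma> q) w = 0}" if "q \<in> polys - {0}" for q
    using that \<Sigma>_eq_0[of q] by (intro poly_roots_finite) auto
  then have "countable (insert a ?B)"
    using countable_polys by (intro countable_insert countable_UN) (auto intro: countable_finite)
  from countable_avoid[OF this] obtain w where w: "w \<notin> insert a ?B" ..
  then have wB: "w \<notin> ?B" and "w \<noteq> a" by (simp_all only: insert_iff de_Morgan_disj simp_thms)
  moreover have "conj_pair z w"
    unfolding conj_pair_def
  proof (intro ballI)
    fix q assume q: "q \<in> polys"
    show "poly q z = 0 \<longleftrightarrow> poly (\<Sigma> q) w = 0"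
      by (cases "q = 0") (use z[OF q] wB q in auto)
  qed
  ultimately show ?thesis by blast
qed

lemma conj_exists: "\<exists>w. conj_pair z w"
proof (cases "\<exists>q\<in>polys. q \<noteq> 0 \<and> poly q z = 0")
  case False
  then have "poly q z \<noteq> 0" if "q \<in> polys" "q \<noteq> 0" for q using that by blast
  from transcendental_conj[OF this, of z] show ?thesis by blast
next
  case True
  then obtain p where p: "min_poly z p" using min_poly_exists by blast
  have "degree (\<Sigma> p) \<noteq> 0"
    using p degree_\<Sigma> min_poly_degree[OF p] by (simp add: min_poly_def)
  then obtain w where "poly (\<Sigma> p) w = 0"
    using complex_poly_has_root[of "\<Sigma> p"] by auto
  then show ?thesis using min_poly_root_conj[OF p] by blast
qed

text \<open>An algebraic \<open>z\<close> outside \<open>L\<close> has a minimal polynomial of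
  degree at least two, which is separable in characteristic zero and therefore has a root other than
  \<open>z\<close>.\<close>

lemma conj_moving:
  assumes "z \<notin> L" and id: "\<And>x. x \<in> L \<Longrightarrow> \<sigma> x = x"
  shows "\<exists>w. w \<noteq> z \<and> conj_pair z w"
proof (cases "\<exists>q\<in>polys. q \<noteq> 0 \<and> poly q z = 0")
  case False
  then have "poly q z \<noteq> 0" if "q \<in> polys" "q \<noteq> 0" for q using that by blast
  from transcendental_conj[OF this, of z] show ?thesis by blast
next
  case True
  then obtain p where p: "min_poly z p" using min_poly_exists by blast
  then have pp: "p \<in> polys" "p \<noteq> 0" "poly p z = 0" by (auto simp: min_poly_def)
  have \<Sigma>p: "\<Sigma> p = p" using pp(1) by (intro poly_eqI) (auto simp: coeff_\<Sigma> id polys_def)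
  have d0: "degree p \<noteq> 0" by (rule min_poly_degree[OF p])
  have d1: "degree p \<noteq> 1"
  proof
    assume "degree p = 1"
    then have "p = [:coeff p 0, coeff p 1:]"
      by (intro poly_eqI) (auto simp: coeff_pCons coeff_eq_0 split: nat.split)
    then have eq: "coeff p 0 + z * coeff p 1 = 0" using pp(3)
      by (metis add.right_neutral mult_zero_right poly_0 poly_pCons)
    have "coeff p 1 \<noteq> 0" using \<open>degree p = 1\<close> by (metis leading_coeff_0_iff pp(2))
    then have "z = (0 - coeff p 0) / coeff p 1" using eq by (simp add: field_simps eq_neg_iff_add_eq_0)
    also have "\<dots> \<in> L" using pp(1) by (intro closed) (auto simp: polys_def)
    finally show False using assms(1) by simp
  qed
  obtain g where g: "p = [:- z, 1:] * g" using pp(3) by (auto simp: poly_eq_0_iff_dvd)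
  have "g \<noteq> 0" using pp(2) g by auto
  then have "degree g = degree p - 1" unfolding g by (subst degree_mult_eq) auto
  then have "degree g \<noteq> 0" using d0 d1 by simp
  then obtain w where w: "poly g w = 0"
    using complex_poly_has_root[of g] by auto
  have "w \<noteq> z"
  proof
    assume "w = z"
    \<comment> \<open>A double root would also be a root of the derivative, which is nonzero and of
      smaller degree than the minimal polynomial.\<close>
    then have "poly (pderiv p) z = 0" using w unfolding g by (simp add: pderiv_mult pderiv_pCons del: mult_pCons_left)
    moreover have "pderiv p \<in> polys"
    proof -
      have "of_nat n \<in> L" for n by (induction n) (auto intro: closed)
      then show ?thesis using pp(1) by (auto simp: polys_def coeff_pderiv intro!: closed simp del: of_nat_Suc)
    qed
    moreover have "pderiv p \<noteq> 0" using d0 by (simp add: pderiv_eq_0_iff)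
    ultimately have "degree p \<le> degree (pderiv p)" using p by (auto simp: min_poly_def)
    then show False using d0 by (simp add: degree_pderiv)
  qed
  moreover have "poly p w = 0" using w g by simp
  ultimately show ?thesis using min_poly_root_conj[OF p, of w] \<Sigma>p by auto
qed

text \<open>\<open>L'\<close> is the simple extension of \<open>L\<close> by \<open>z\<close>,
  realised as the values at \<open>z\<close> of quotients of polynomials over
  \<open>L\<close>.\<close>

lemma extend_conj:
  assumes zw: "conj_pair z w"
  shows "\<exists>L' \<sigma>'. embedding L' \<sigma>' \<and> L \<subseteq> L' \<and> z \<in> L' \<and> (\<forall>x\<in>L. \<sigma>' x = \<sigma> x) \<and> \<sigma>' z = w"
proof -
  let ?R = "\<lambda>x p q. p \<in> polys \<and> q \<in> polys \<and> poly q z \<noteq> 0 \<and> x = poly p z / poly q z"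
  define L' where "L' = {x. \<exists>p q. ?R x p q}"
  define \<sigma>' where "\<sigma>' = (\<lambda>x. THE y. \<exists>p q. ?R x p q \<and> y = poly (\<Sigma> p) w / poly (\<Sigma> q) w)"
  have nz: "poly (\<Sigma> q) w \<noteq> 0" if "q \<in> polys" "poly q z \<noteq> 0" for q
    using zw that by (auto simp: conj_pair_def)
  have val: "\<sigma>' x = poly (\<Sigma> p) w / poly (\<Sigma> q) w" if x: "?R x p q" for x p q
    unfolding \<sigma>'_def
  proof (rule the_equality)
    show "\<exists>p' q'. ?R x p' q' \<and> poly (\<Sigma> p) w / poly (\<Sigma> q) w = poly (\<Sigma> p') w / poly (\<Sigma> q') w"
      using x by blast
    fix y assume "\<exists>p q. ?R x p q \<and> y = poly (\<Sigma> p) w / poly (\<Sigma> q) w"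
    then obtain p' q' where r: "?R x p' q'" and y: "y = poly (\<Sigma> p') w / poly (\<Sigma> q') w" by blast
    \<comment> \<open>Two representations of the same element differ by a polynomial vanishing at
      \<open>z\<close>; conjugacy makes its image vanish at \<open>w\<close>.\<close>
    have "poly (p * q' - p' * q) z = 0" using x r by (auto simp: field_simps)
    moreover have "p * q' - p' * q \<in> polys" using x r by (auto intro!: polys_closed)
    ultimately have "poly (\<Sigma> (p * q' - p' * q)) w = 0" using zw unfolding conj_pair_def by blast
    then have "poly (\<Sigma> p) w * poly (\<Sigma> q') w = poly (\<Sigma> p') w * poly (\<Sigma> q) w"
      using x r by (simp add: \<Sigma>_diff \<Sigma>_mult polys_closed)
    then show "y = poly (\<Sigma> p) w / poly (\<Sigma> q) w"
      using y nz x r by (simp add: frac_eq_eq)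
  qed
  have one: "[:1:] \<in> polys" using polys_const[of 1] closed by simp
  have Lr: "?R x [:x:] [:1:]" if "x \<in> L" for x
    using that one by (simp add: polys_const)
  have sub: "?R (x - y) (p * q' - p' * q) (q * q')"
    and mul: "?R (x * y) (p * p') (q * q')" if "?R x p q" "?R y p' q'" for x y p q p' q'
    using that by (auto intro!: polys_closed simp: field_simps)
  have "is_subfield L'"
    unfolding is_subfield_def
  proof (intro conjI ballI impI)
    show "1 \<in> L'" unfolding L'_def using Lr[of 1] closed by blast
    fix x assume "x \<in> L'"
    then obtain p q where x: "?R x p q" by (auto simp: L'_def)
    {
      fix y assume "y \<in> L'"
      then obtain p' q' where y: "?R y p' q'" by (auto simp: L'_def)
      show "x - y \<in> L'" "x * y \<in> L'" unfolding L'_def using sub[OF x y] mul[OF x y] by blast+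
    }
    assume "x \<noteq> 0"
    then have "?R (inverse x) q p" using x by auto
    then show "inverse x \<in> L'" unfolding L'_def by blast
  qed
  moreover have "countable L'"
  proof -
    have "L' \<subseteq> (\<lambda>(p, q). poly p z / poly q z) ` (polys \<times> polys)" by (auto simp: L'_def)
    then show ?thesis using countable_polys by (meson countable_SIGMA countable_image countable_subset)
  qed
  moreover have "\<sigma>' x = \<sigma> x" if "x \<in> L" for x
    using val[OF Lr[OF that]] by (simp add: \<Sigma>_const \<sigma>_1)
  moreover have "\<sigma>' (x - y) = \<sigma>' x - \<sigma>' y \<and> \<sigma>' (x * y) = \<sigma>' x * \<sigma>' y" if xy: "x \<in> L'" "y \<in> L'" for x y
  proof -
    obtain p q p' q' where x: "?R x p q" and y: "?R y p' q'" using xy by (auto simp: L'_def)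
    then have m: "p * q' \<in> polys" "p' * q \<in> polys" by (auto intro: polys_closed)
    have n: "poly (\<Sigma> q) w \<noteq> 0" "poly (\<Sigma> q') w \<noteq> 0" using nz x y by auto
    have pq: "p \<in> polys" "q \<in> polys" "p' \<in> polys" "q' \<in> polys" using x y by auto
    show ?thesis
      unfolding val[OF sub[OF x y]] val[OF mul[OF x y]] val[OF x] val[OF y]
      using pq m n by (simp add: \<Sigma>_diff \<Sigma>_mult) (simp add: field_simps)
  qed
  moreover have "?R z [:0, 1:] [:1:]" using one polys_X by simp
  then have "z \<in> L'" "\<sigma>' z = w"
    using val[of "[:0, 1:]" "[:1:]" z] unfolding L'_def by (blast, simp add: \<Sigma>_X \<Sigma>_const \<sigma>_1)
  moreover have "L \<subseteq> L'" unfolding L'_def using Lr by blast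
  moreover have "\<sigma>' 1 = 1" using val[OF Lr[of 1]] closed(2) by (simp add: \<Sigma>_const \<sigma>_1)
  ultimately show ?thesis unfolding embedding_def by blast
qed

end

lemma embedding_extends_finite:
  assumes "finite Z" "embedding L \<sigma>"
  shows "\<exists>L' \<sigma>'. embedding L' \<sigma>' \<and> L \<union> Z \<subseteq> L' \<and> (\<forall>x\<in>L. \<sigma>' x = \<sigma> x)"
  using assms(1)
proof (induction Z rule: finite_induct)
  case empty
  then show ?case using assms(2) by auto
next
  case (insert z Z)
  then obtain L1 \<sigma>1 where 1: "embedding L1 \<sigma>1" "L \<union> Z \<subseteq> L1" "\<forall>x\<in>L. \<sigma>1 x = \<sigma> x" by blast
  interpret embedded_field L1 \<sigma>1 by standard (rule 1)
  obtain w where "conj_pair z w" using conj_exists by blast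
  then obtain L' \<sigma>' where 2: "embedding L' \<sigma>'" "L1 \<subseteq> L'" "z \<in> L'" "\<forall>x\<in>L1. \<sigma>' x = \<sigma>1 x"
    using extend_conj by blast
  show ?case using 1 2 by (intro exI[of _ L'] exI[of _ \<sigma>']) auto
qed

text \<open>Only the image of \<open>a\<close> is prescribed, so \<open>a\<close> is adjoined first
  and the elements of \<open>Z\<close> are then adjoined with arbitrary conjugates as
  images.\<close>

lemma moving_embedding:
  assumes "is_subfield L" "countable L" "a \<notin> L" "finite Z"
  obtains L' \<sigma> where "embedding L' \<sigma>" "L \<subseteq> L'" "a \<in> L'" "Z \<subseteq> L'" "\<And>x. x \<in> L \<Longrightarrow> \<sigma> x = x" "\<sigma> a \<noteq> a"
proof -
  have "embedding L (\<lambda>x. x)" using assms by (simp add: embedding_def)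
  then interpret embedded_field L "\<lambda>x. x" by (rule embedded_field.intro)
  obtain w where w: "w \<noteq> a" "conj_pair a w" using conj_moving[OF assms(3)] by blast
  obtain L1 \<sigma>1 where 1: "embedding L1 \<sigma>1" "L \<subseteq> L1" "a \<in> L1" "\<forall>x\<in>L. \<sigma>1 x = x" "\<sigma>1 a = w"
    using extend_conj[OF w(2)] by blast
  obtain L' \<sigma>' where 2: "embedding L' \<sigma>'" "L1 \<union> Z \<subseteq> L'" "\<forall>x\<in>L1. \<sigma>' x = \<sigma>1 x"
    using embedding_extends_finite[OF assms(4) 1(1)] by blast
  show thesis by (rule that[OF 2(1)]) (use 1 2 w in auto)
qed

section \<open>Linear systems in terms of the Taylor coefficients of inputs and outputs\<close>

definition jet :: "(complex \<Rightarrow> complex) \<Rightarrow> nat \<Rightarrow> complex" where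
  "jet f k = (deriv ^^ k) f 0"

lemma analytic_has_fps: "f analytic_on {0} \<Longrightarrow> f has_fps_expansion fps_expansion f 0"
  using analytic_at_imp_has_fps_expansion_0 by auto

lemma jet_fps: "f has_fps_expansion F \<Longrightarrow> jet f k = fact k * fps_nth F k"
  using fps_nth_fps_expansion[of f F k] by (simp add: jet_def)

lemma jet_eq_imp_germ_eq:
  assumes "f has_fps_expansion F" "g has_fps_expansion G" "\<And>k. jet f k = jet g k"
  shows "\<forall>\<^sub>F t in nhds 0. f t = g t"
proof -
  have "fps_nth F k = fps_nth G k" for k
    using assms(3)[of k] unfolding jet_fps[OF assms(1)] jet_fps[OF assms(2)] by simp
  then have "F = G" by (rule fps_ext)
  then have "(\<lambda>t. f t - g t) has_fps_expansion 0"
    using has_fps_expansion_diff[OF assms(1,2)] by simp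
  then show ?thesis by (simp add: has_fps_expansion_0_iff)
qed

lemma germ_eq_imp_jet_eq:
  assumes "\<forall>\<^sub>F t in nhds 0. f t = g t"
  shows "jet f k = jet g k"
  unfolding jet_def using assms by (rule higher_deriv_cong_ev) simp

lemma jet_cmult: "f has_fps_expansion F \<Longrightarrow> jet (\<lambda>t. c * f t) k = c * jet f k"
  using jet_fps[OF has_fps_expansion_cmult_left[of f F c]] jet_fps[of f F] by simp

text \<open>The derivatives at 0 dictated by a linear system whose matrix is constant. The ring is
  kept general: it is \<complex> for actual solutions, \<open>ratfun\<close> for formal
  trajectories, and the ring of differential polynomials for reduction modulo the ideal.\<close>

fun sys_jet :: "nat set \<Rightarrow> (nat \<Rightarrow> nat \<Rightarrow> 'a::comm_ring_1) \<Rightarrow> (nat \<Rightarrow> 'a) \<Rightarrow> (nat \<Rightarrow> nat \<Rightarrow> 'a) \<Rightarrow> nat \<Rightarrow> nat \<Rightarrow> 'a" where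
  "sys_jet S A x0 w 0 i = x0 i"
| "sys_jet S A x0 w (Suc k) i = (\<Sum>j\<in>S. A i j * sys_jet S A x0 w k j) + w i k"

lemma has_fps_expansion_sum:
  "(\<And>j. j \<in> S \<Longrightarrow> f j has_fps_expansion F j) \<Longrightarrow>
    (\<lambda>t. \<Sum>j\<in>S. f j t :: complex) has_fps_expansion (\<Sum>j\<in>S. F j)"
  by (induction S rule: infinite_finite_induct) (auto intro: has_fps_expansion_add)

lemma linear_ode_jets:
  assumes "finite S" "\<And>i. i \<in> S \<Longrightarrow> x i analytic_on {0}" "\<And>i. i \<in> S \<Longrightarrow> w i analytic_on {0}"
    and "\<And>i. i \<in> S \<Longrightarrow> x i 0 = x0 i"
    and "\<And>i. i \<in> S \<Longrightarrow> \<forall>\<^sub>F t in nhds 0. (x i has_field_derivative (\<Sum>j\<in>S. A i j * x j t) + w i t) (at t)"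
    and "i \<in> S"
  shows "jet (x i) k = sys_jet S A x0 (\<lambda>i. jet (w i)) k i"
  using assms(6)
proof (induction k arbitrary: i)
  case 0
  then show ?case using assms(4) by (simp add: jet_def)
next
  case (Suc k)
  let ?F = "\<lambda>i. fps_expansion (x i) 0" and ?W = "\<lambda>i. fps_expansion (w i) 0"
  note F = analytic_has_fps[OF assms(2)] and W = analytic_has_fps[OF assms(3)]
  have "\<forall>\<^sub>F t in nhds 0. deriv (x i) t = (\<Sum>j\<in>S. A i j * x j t) + w i t"
    using assms(5)[OF Suc.prems] by (rule eventually_mono) (rule DERIV_imp_deriv)
  then have "jet (deriv (x i)) k = jet (\<lambda>t. (\<Sum>j\<in>S. A i j * x j t) + w i t) k"
    by (rule germ_eq_imp_jet_eq)
  also have "\<dots> = fact k * fps_nth ((\<Sum>j\<in>S. fps_const (A i j) * ?F j) + ?W i) k"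
    by (intro jet_fps has_fps_expansion_add has_fps_expansion_sum has_fps_expansion_cmult_left F W Suc.prems)
  also have "\<dots> = (\<Sum>j\<in>S. A i j * jet (x j) k) + jet (w i) k"
    using jet_fps[OF F] jet_fps[OF W] Suc.prems
    by (simp add: fps_sum_nth algebra_simps sum_distrib_left)
  also have "\<dots> = sys_jet S A x0 (\<lambda>i. jet (w i)) (Suc k) i"
    using Suc.IH by simp
  finally have "jet (deriv (x i)) k = sys_jet S A x0 (\<lambda>i. jet (w i)) (Suc k) i" .
  moreover have "jet (x i) (Suc k) = jet (deriv (x i)) k"
    by (simp only: jet_def funpow_Suc_right o_apply)
  ultimately show ?case by simp
qed

section \<open>Convergence of the formal solution\<close>

lemma fps_conv_radius_pos_if_geometric:
  assumes "\<And>k. norm (fps_nth F k) \<le> D * \<rho> ^ k" "\<rho> > 0"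
  shows "fps_conv_radius (F :: complex fps) > 0"
proof -
  \<comment> \<open>Half the reciprocal of the growth rate, so that the terms are dominated by
    \<open>D * (1 / 2) ^ k\<close>.\<close>
  let ?r = "1 / (2 * \<rho>)"
  have "summable (\<lambda>k. fps_nth F k * of_real ?r ^ k)"
  proof (rule summable_comparison_test)
    have "norm (fps_nth F k * of_real ?r ^ k) \<le> D * (1 / 2) ^ k" for k
    proof -
      have "norm (fps_nth F k * of_real ?r ^ k) = norm (fps_nth F k) * ?r ^ k"
        using assms(2) by (simp add: norm_mult norm_power norm_divide)
      also have "\<dots> \<le> (D * \<rho> ^ k) * ?r ^ k"
        using assms by (intro mult_right_mono) auto
      also have "\<dots> = D * (1 / 2) ^ k" using assms(2) by (simp add: power_divide power_mult_distrib)
      finally show ?thesis .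
    qed
    then show "\<exists>N. \<forall>n\<ge>N. norm (fps_nth F n * of_real ?r ^ n) \<le> D * (1 / 2) ^ n" by blast
    show "summable (\<lambda>n. D * (1 / 2) ^ n)" by (intro summable_mult summable_geometric) simp
  qed
  then have "fps_conv_radius F \<ge> norm (of_real ?r :: complex)"
    unfolding fps_conv_radius_def by (rule conv_radius_geI)
  moreover have "ereal (norm (of_real ?r :: complex)) > 0" using assms(2) by simp
  ultimately show ?thesis by (rule less_le_trans[rotated])
qed

lemma geometric_bound_if_fps_conv_radius_pos:
  assumes "fps_conv_radius (F :: complex fps) > 0"
  obtains D \<rho> where "D > 0" "\<rho> > 0" "\<And>k. norm (fps_nth F k) \<le> D * \<rho> ^ k"
proof -
  obtain r where r: "ereal r < fps_conv_radius F" "r > 0"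
    using ereal_dense2[OF assms] by (metis ereal_less(2) zero_ereal_def)
  have "summable (\<lambda>k. fps_nth F k * of_real r ^ k)"
    using r unfolding fps_conv_radius_def by (intro summable_in_conv_radius) simp
  then have "Bseq (\<lambda>k. fps_nth F k * of_real r ^ k)"
    using summable_LIMSEQ_zero convergentI convergent_imp_Bseq by blast
  then obtain K where K: "K > 0" "\<And>k. norm (fps_nth F k * of_real r ^ k) \<le> K"
    by (auto simp: Bseq_def)
  show thesis
  proof (rule that[of K "1 / r"])
    fix k
    have "norm (fps_nth F k) * r ^ k \<le> K" using K(2)[of k] r by (simp add: norm_mult norm_power)
    then show "norm (fps_nth F k) \<le> K * (1 / r) ^ k" using r by (simp add: power_divide field_simps)
  qed (use K r in auto)
qed

text \<open>\<open>output_fun\<close> selects a solution by choice, so its properties depend on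
  existence. The candidate is the formal power series solution; a geometric bound on its
  coefficients gives a positive radius of convergence.\<close>

lemma linear_ode_solution_exists:
  fixes S :: "nat set"
  assumes "finite S" "\<And>i. i \<in> S \<Longrightarrow> w i analytic_on {0}"
  shows "\<exists>x. \<forall>i\<in>S. x i analytic_on {0} \<and> x i 0 = x0 i \<and>
    (\<forall>\<^sub>F t in nhds 0. (x i has_field_derivative (\<Sum>j\<in>S. A i j * x j t) + w i t) (at t))"
proof -
  define F where "F i = Abs_fps (\<lambda>k. sys_jet S A x0 (\<lambda>i. jet (w i)) k i / fact k)" for i
  let ?W = "\<lambda>i. fps_expansion (w i) 0"
  note W = analytic_has_fps[OF assms(2)]
  have rec: "of_nat (Suc k) * fps_nth (F i) (Suc k) = (\<Sum>j\<in>S. A i j * fps_nth (F j) k) + fps_nth (?W i) k"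
    if "i \<in> S" for i k
  proof -
    have "of_nat (Suc k) * fps_nth (F i) (Suc k) =
        ((\<Sum>j\<in>S. A i j * sys_jet S A x0 (\<lambda>i. jet (w i)) k j) + jet (w i) k) / fact k"
      using of_nat_neq_0[of k, where 'a=complex] by (simp add: F_def del: of_nat_Suc)
    then show ?thesis
      unfolding jet_fps[OF W[OF that]] by (simp add: F_def add_divide_distrib sum_divide_distrib)
  qed
  have "\<exists>D \<rho>. D > 0 \<and> \<rho> > 0 \<and> (\<forall>k. norm (fps_nth (?W i) k) \<le> D * \<rho> ^ k)" if "i \<in> S" for i
    using geometric_bound_if_fps_conv_radius_pos[of "?W i"] W[OF that]
    unfolding has_fps_expansion_def by metis
  then obtain Dw \<rho>w where Dw: "\<And>i. i \<in> S \<Longrightarrow> Dw i > 0" "\<And>i. i \<in> S \<Longrightarrow> \<rho>w i > 0"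
    "\<And>i k. i \<in> S \<Longrightarrow> norm (fps_nth (?W i) k) \<le> Dw i * \<rho>w i ^ k" by metis
  \<comment> \<open>Constants of the majorant \<open>D * \<rho> ^ k\<close>: \<open>D\<close>
    exceeds the initial values and the constants of the inputs, while \<open>\<rho>\<close> exceeds
    the growth rates of the inputs and every absolute row sum of \<open>A\<close> plus one, the
    extra one absorbing the input term.\<close>
  define a where "a = (\<Sum>i\<in>S. \<Sum>j\<in>S. norm (A i j))"
  define D where "D = 1 + (\<Sum>i\<in>S. norm (x0 i)) + (\<Sum>i\<in>S. Dw i)"
  define \<rho> where "\<rho> = 1 + a + (\<Sum>i\<in>S. \<rho>w i)"
  have a0: "a \<ge> 0" by (auto simp: a_def intro!: sum_nonneg)
  have sDw: "(\<Sum>i\<in>S. Dw i) \<ge> 0" "(\<Sum>i\<in>S. \<rho>w i) \<ge> 0" "(\<Sum>i\<in>S. norm (x0 i)) \<ge> 0"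
    using less_imp_le[OF Dw(1)] less_imp_le[OF Dw(2)] by (auto intro!: sum_nonneg)
  have mem: "f i \<le> (\<Sum>i\<in>S. f i)" if "i \<in> S" "\<And>i. i \<in> S \<Longrightarrow> f i \<ge> 0" for f :: "nat \<Rightarrow> real" and i
    using that assms(1) by (intro member_le_sum) auto
  have D0: "D > 0" and \<rho>1: "\<rho> \<ge> 1 + a" "\<rho> > 0" using a0 sDw by (auto simp: D_def \<rho>_def)
  have bound: "\<forall>i\<in>S. norm (fps_nth (F i) k) \<le> D * \<rho> ^ k" for k
  proof (induction k)
    case 0
    have "norm (x0 i) \<le> D" if "i \<in> S" for i
      using mem[OF that, of "\<lambda>i. norm (x0 i)"] sDw by (simp add: D_def)
    then show ?case by (simp add: F_def)
  next
    case (Suc k)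
    show ?case
    proof
      fix i assume i: "i \<in> S"
      have "norm (fps_nth (F i) (Suc k)) \<le> real (Suc k) * norm (fps_nth (F i) (Suc k))"
        by (simp add: mult_le_cancel_right1)
      also have "\<dots> = norm (of_nat (Suc k) * fps_nth (F i) (Suc k))"
        by (simp add: norm_mult del: of_nat_Suc)
      also have "\<dots> \<le> (\<Sum>j\<in>S. norm (A i j * fps_nth (F j) k)) + norm (fps_nth (?W i) k)"
        unfolding rec[OF i] by (intro order_trans[OF norm_triangle_ineq] add_mono norm_sum order_refl)
      also have "\<dots> \<le> (\<Sum>j\<in>S. norm (A i j) * (D * \<rho> ^ k)) + D * \<rho> ^ k"
      proof (intro add_mono sum_mono)
        fix j assume "j \<in> S"
        then show "norm (A i j * fps_nth (F j) k) \<le> norm (A i j) * (D * \<rho> ^ k)"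
          using Suc.IH by (auto simp: norm_mult intro!: mult_left_mono)
      next
        have "\<rho>w i \<le> \<rho>" using mem[OF i, of \<rho>w] Dw(2) a0 by (force simp: \<rho>_def)
        moreover have "Dw i \<le> D" using mem[OF i, of Dw] Dw(1) sDw by (force simp: D_def)
        ultimately have "Dw i * \<rho>w i ^ k \<le> D * \<rho> ^ k"
          using Dw(1,2)[OF i] D0 \<rho>1 by (intro mult_mono power_mono) auto
        then show "norm (fps_nth (?W i) k) \<le> D * \<rho> ^ k" using Dw(3)[OF i, of k] by simp
      qed
      also have "\<dots> = ((\<Sum>j\<in>S. norm (A i j)) + 1) * (D * \<rho> ^ k)"
        by (simp add: algebra_simps sum_distrib_left)
      also have "\<dots> \<le> \<rho> * (D * \<rho> ^ k)"
      proof (rule mult_right_mono)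
        have "(\<Sum>j\<in>S. norm (A i j)) \<le> a"
          unfolding a_def by (rule mem[OF i]) (auto intro: sum_nonneg)
        then show "(\<Sum>j\<in>S. norm (A i j)) + 1 \<le> \<rho>" using \<rho>1 by simp
        show "0 \<le> D * \<rho> ^ k" using D0 \<rho>1 by simp
      qed
      finally show "norm (fps_nth (F i) (Suc k)) \<le> D * \<rho> ^ Suc k" by (simp add: algebra_simps)
    qed
  qed
  have conv: "fps_conv_radius (F i) > 0" if "i \<in> S" for i
    using bound that \<rho>1 by (intro fps_conv_radius_pos_if_geometric[of _ D \<rho>]) auto
  let ?x = "\<lambda>i. eval_fps (F i)"
  have xF: "?x i has_fps_expansion F i" if "i \<in> S" for i
    using conv[OF that] by (rule eval_fps_has_fps_expansion)
  have "?x i analytic_on {0} \<and> ?x i 0 = x0 i \<and>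
    (\<forall>\<^sub>F t in nhds 0. (?x i has_field_derivative (\<Sum>j\<in>S. A i j * ?x j t) + w i t) (at t))" if i: "i \<in> S" for i
  proof (intro conjI)
    show "?x i analytic_on {0}" using xF[OF i] by (rule has_fps_expansion_imp_analytic_0)
    show "?x i 0 = x0 i" by (simp add: eval_fps_at_0 F_def)
    have "\<forall>\<^sub>F t in nhds (0::complex). t \<in> eball 0 (fps_conv_radius (F i))"
      using conv[OF i] by (intro eventually_nhds_in_open) (auto simp: zero_ereal_def)
    then have der: "\<forall>\<^sub>F t in nhds 0. (?x i has_field_derivative eval_fps (fps_deriv (F i)) t) (at t)"
      by (rule eventually_mono) (auto intro!: has_field_derivative_eval_fps simp: in_eball_iff)
    have "fps_deriv (F i) = (\<Sum>j\<in>S. fps_const (A i j) * F j) + ?W i"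
      by (rule fps_ext) (use rec[OF i] in \<open>simp add: fps_sum_nth del: of_nat_Suc\<close>)
    moreover have "(\<lambda>t. (\<Sum>j\<in>S. A i j * ?x j t) + w i t) has_fps_expansion
        (\<Sum>j\<in>S. fps_const (A i j) * F j) + ?W i"
      by (intro has_fps_expansion_add has_fps_expansion_sum has_fps_expansion_cmult_left xF W i)
    ultimately have "\<forall>\<^sub>F t in nhds 0. eval_fps (fps_deriv (F i)) t = (\<Sum>j\<in>S. A i j * ?x j t) + w i t"
      by (simp add: has_fps_expansion_def)
    with der show "\<forall>\<^sub>F t in nhds 0. (?x i has_field_derivative (\<Sum>j\<in>S. A i j * ?x j t) + w i t) (at t)"
      by eventually_elim simp
  qed
  then show ?thesis by (intro exI[of _ ?x]) blast
qed

definition A_at :: "compartment_model \<Rightarrow> (nat \<Rightarrow> complex) \<Rightarrow> nat \<Rightarrow> nat \<Rightarrow> complex" where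
  "A_at M \<mu> i j = rf_eval \<mu> (cmat M i j)"

definition w_at :: "compartment_model \<Rightarrow> (nat \<Rightarrow> complex) \<Rightarrow> (nat \<Rightarrow> nat \<Rightarrow> complex) \<Rightarrow> nat \<Rightarrow> nat \<Rightarrow> complex" where
  "w_at M \<mu> U i k = (if i \<in> inputs M then rf_eval \<mu> (bcoef M i) * U i k else 0)"

definition x_jet :: "compartment_model \<Rightarrow> (nat \<Rightarrow> complex) \<Rightarrow> (nat \<Rightarrow> complex) \<Rightarrow> (nat \<Rightarrow> complex \<Rightarrow> complex) \<Rightarrow> nat \<Rightarrow> nat \<Rightarrow> complex" where
  "x_jet M x0 \<mu> u k i = sys_jet (verts M) (A_at M \<mu>) x0 (w_at M \<mu> (\<lambda>i. jet (u i))) k i"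

lemma output_jets:
  assumes "u \<in> analytic_tuples (inputs M)" "i \<in> verts M"
  shows "\<exists>F. output_fun M x0 \<mu> u i has_fps_expansion F"
    and "jet (output_fun M x0 \<mu> u i) k = rf_eval \<mu> (ccoef M i) * x_jet M x0 \<mu> u k i"
proof -
  let ?w = "\<lambda>i t. if i \<in> inputs M then rf_eval \<mu> (bcoef M i) * u i t else 0"
  let ?S = "verts M"
  have fin: "finite ?S" by (simp add: verts_def)
  have w: "?w i analytic_on {0}" for i
    using assms(1) by (cases "i \<in> inputs M") (auto simp: analytic_tuples_def intro!: analytic_intros)
  have wj: "jet (?w i) = w_at M \<mu> (\<lambda>i. jet (u i)) i" for i
  proof (cases "i \<in> inputs M")
    case True
    then have "u i has_fps_expansion fps_expansion (u i) 0"
      using assms(1) by (intro analytic_has_fps) (auto simp: analytic_tuples_def)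
    then show ?thesis using True by (simp add: w_at_def jet_cmult fun_eq_iff)
  next
    case False
    have "(\<lambda>_::complex. 0::complex) has_fps_expansion 0" by simp
    then show ?thesis using False jet_fps[of "\<lambda>_. 0" 0] by (simp add: w_at_def fun_eq_iff)
  qed
  obtain x where "\<forall>i\<in>?S. x i analytic_on {0} \<and> x i 0 = x0 i \<and>
    (\<forall>\<^sub>F t in nhds 0. (x i has_field_derivative (\<Sum>j\<in>?S. rf_eval \<mu> (cmat M i j) * x j t) + ?w i t) (at t))"
    using linear_ode_solution_exists[of ?S ?w x0 "\<lambda>i j. rf_eval \<mu> (cmat M i j)", OF fin w] by blast
  then have "\<exists>x. is_solution M x0 \<mu> u x"
    unfolding is_solution_def analytic_tuples_def by blast
  then have sol: "is_solution M x0 \<mu> u (SOME x. is_solution M x0 \<mu> u x)" by (rule someI_ex)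
  define x where "x = (SOME x. is_solution M x0 \<mu> u x)"
  have x: "x i analytic_on {0}" "x i 0 = x0 i"
    "\<forall>\<^sub>F t in nhds 0. (x i has_field_derivative (\<Sum>j\<in>?S. A_at M \<mu> i j * x j t) + ?w i t) (at t)"
    if "i \<in> ?S" for i
    using sol[folded x_def] that unfolding is_solution_def analytic_tuples_def A_at_def by blast+
  have j: "jet (x i) k = x_jet M x0 \<mu> u k i"
    unfolding x_jet_def wj[symmetric] by (rule linear_ode_jets[OF fin x(1) w x(2,3) assms(2)])
  have o: "output_fun M x0 \<mu> u i = (\<lambda>t. rf_eval \<mu> (ccoef M i) * x i t)"
    by (simp add: output_fun_def x_def fun_eq_iff)
  have F: "x i has_fps_expansion fps_expansion (x i) 0"
    by (rule analytic_has_fps[OF x(1)[OF assms(2)]])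
  show "\<exists>F. output_fun M x0 \<mu> u i has_fps_expansion F"
    unfolding o using has_fps_expansion_cmult_left[OF F] by blast
  show "jet (output_fun M x0 \<mu> u i) k = rf_eval \<mu> (ccoef M i) * x_jet M x0 \<mu> u k i"
    unfolding o using jet_cmult[OF F] j by simp
qed

text \<open>Analytic germs are determined by their Taylor coefficients at 0; through this
  equivalence the condition in \<open>S_set\<close> becomes purely algebraic.\<close>

lemma same_germs_iff_jets:
  assumes "u \<in> analytic_tuples (inputs M)" "outputs M \<subseteq> verts M"
  shows "same_germs (outputs M) (output_fun M x0 \<mu> u) (output_fun M x0' \<mu>' u) \<longleftrightarrow>
    (\<forall>i\<in>outputs M. \<forall>k. rf_eval \<mu> (ccoef M i) * x_jet M x0 \<mu> u k i = rf_eval \<mu>' (ccoef M i) * x_jet M x0' \<mu>' u k i)"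
  (is "_ \<longleftrightarrow> ?R")
proof
  assume L: "same_germs (outputs M) (output_fun M x0 \<mu> u) (output_fun M x0' \<mu>' u)"
  show ?R
  proof (intro ballI allI)
    fix i k assume i: "i \<in> outputs M"
    then have "jet (output_fun M x0 \<mu> u i) k = jet (output_fun M x0' \<mu>' u i) k"
      using L unfolding same_germs_def by (intro germ_eq_imp_jet_eq) blast
    then show "rf_eval \<mu> (ccoef M i) * x_jet M x0 \<mu> u k i = rf_eval \<mu>' (ccoef M i) * x_jet M x0' \<mu>' u k i"
      using output_jets(2)[OF assms(1)] i assms(2) by auto
  qed
next
  assume R: ?R
  show "same_germs (outputs M) (output_fun M x0 \<mu> u) (output_fun M x0' \<mu>' u)"
    unfolding same_germs_def
  proof
    fix i assume i: "i \<in> outputs M"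
    then have iv: "i \<in> verts M" using assms(2) by auto
    obtain F G where "output_fun M x0 \<mu> u i has_fps_expansion F" "output_fun M x0' \<mu>' u i has_fps_expansion G"
      using output_jets(1)[OF assms(1) iv] by meson
    then show "\<forall>\<^sub>F t in nhds 0. output_fun M x0 \<mu> u i t = output_fun M x0' \<mu>' u i t"
      by (rule jet_eq_imp_germ_eq) (use R i output_jets(2)[OF assms(1) iv] in auto)
  qed
qed

section \<open>Matrix powers and solution jets\<close>

lemma sum_delta_mult:
  assumes "finite S" "i \<in> S"
  shows "(\<Sum>s\<in>S. (if i = s then 1 else 0) * f s) = (f i :: 'a::comm_ring_1)"
  using assms by (subst sum.remove[of S i]) (auto intro!: sum.neutral split: if_splits)

fun mpow :: "nat set \<Rightarrow> (nat \<Rightarrow> nat \<Rightarrow> 'a::comm_ring_1) \<Rightarrow> nat \<Rightarrow> nat \<Rightarrow> nat \<Rightarrow> 'a" where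
  "mpow S A 0 i j = (if i = j then 1 else 0)"
| "mpow S A (Suc k) i j = (\<Sum>s\<in>S. A i s * mpow S A k s j)"

lemma mpow_Suc_right:
  assumes "finite S" "i \<in> S" "j \<in> S"
  shows "mpow S A (Suc k) i j = (\<Sum>s\<in>S. mpow S A k i s * A s j)"
  using assms(2)
proof (induction k arbitrary: i)
  case 0
  then show ?case using assms by (simp add: if_distrib if_distribR sum.delta sum.delta' cong: if_cong)
next
  case (Suc k)
  have "mpow S A (Suc (Suc k)) i j = (\<Sum>s\<in>S. A i s * (\<Sum>r\<in>S. mpow S A k s r * A r j))"
    using Suc.IH by simp
  also have "\<dots> = (\<Sum>r\<in>S. (\<Sum>s\<in>S. A i s * mpow S A k s r) * A r j)"
    by (simp add: sum_distrib_left sum_distrib_right mult.assoc) (rule sum.swap)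
  finally show ?case by simp
qed

lemma hom_mpow: "is_hom h \<Longrightarrow> h (mpow S A k i j) = mpow S (\<lambda>i j. h (A i j)) k i j"
  by (induction k arbitrary: i) (auto simp: is_hom_simps)

lemma mpow_cong: "(\<And>i j. i \<in> S \<Longrightarrow> j \<in> S \<Longrightarrow> A i j = B i j) \<Longrightarrow> i \<in> S \<Longrightarrow> mpow S A k i j = mpow S B k i j"
  by (induction k arbitrary: i) auto

text \<open>Discrete variation of constants. It starts at order \<open>t\<close> instead of 0
  because relations among derivatives are later used at all shifts.\<close>

lemma sys_jet_shift:
  assumes "finite S" "i \<in> S"
  shows "sys_jet S A x0 w (t + k) i = (\<Sum>s\<in>S. mpow S A k i s * sys_jet S A x0 w t s) +
    (\<Sum>r<k. \<Sum>s\<in>S. mpow S A (k - 1 - r) i s * w s (t + r))"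
  using assms(2)
proof (induction k arbitrary: i)
  case 0
  then show ?case using assms(1) by (simp add: sum_delta_mult)
next
  case (Suc k)
  let ?X = "sys_jet S A x0 w"
  have "?X (t + Suc k) i = (\<Sum>j\<in>S. A i j * ((\<Sum>s\<in>S. mpow S A k j s * ?X t s) +
      (\<Sum>r<k. \<Sum>s\<in>S. mpow S A (k - 1 - r) j s * w s (t + r)))) + w i (t + k)"
    using Suc.IH by simp
  also have "\<dots> = (\<Sum>s\<in>S. mpow S A (Suc k) i s * ?X t s) +
      (\<Sum>r<k. \<Sum>s\<in>S. mpow S A (Suc (k - 1 - r)) i s * w s (t + r)) + w i (t + k)"
  proof -
    have "(\<Sum>j\<in>S. A i j * (\<Sum>s\<in>S. mpow S A k j s * ?X t s)) = (\<Sum>s\<in>S. mpow S A (Suc k) i s * ?X t s)"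
      by (simp add: sum_distrib_left sum_distrib_right mult.assoc) (rule sum.swap)
    moreover have "(\<Sum>j\<in>S. A i j * (\<Sum>r<k. \<Sum>s\<in>S. mpow S A (k - 1 - r) j s * w s (t + r))) =
        (\<Sum>r<k. \<Sum>s\<in>S. mpow S A (Suc (k - 1 - r)) i s * w s (t + r))"
    proof -
      have "(\<Sum>j\<in>S. A i j * (\<Sum>r<k. \<Sum>s\<in>S. mpow S A (k - 1 - r) j s * w s (t + r))) =
          (\<Sum>r<k. \<Sum>j\<in>S. \<Sum>s\<in>S. A i j * mpow S A (k - 1 - r) j s * w s (t + r))"
        by (simp add: sum_distrib_left mult.assoc) (rule sum.swap)
      also have "\<dots> = (\<Sum>r<k. \<Sum>s\<in>S. \<Sum>j\<in>S. A i j * mpow S A (k - 1 - r) j s * w s (t + r))"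
        by (intro sum.cong refl sum.swap)
      finally show ?thesis by (simp add: sum_distrib_right)
    qed
    ultimately show ?thesis by (simp add: algebra_simps sum.distrib)
  qed
  also have "w i (t + k) = (\<Sum>s\<in>S. mpow S A (Suc k - 1 - k) i s * w s (t + k))"
    using assms(1) Suc.prems by (simp add: sum_delta_mult)
  also have "(\<Sum>r<k. \<Sum>s\<in>S. mpow S A (Suc (k - 1 - r)) i s * w s (t + r)) =
      (\<Sum>r<k. \<Sum>s\<in>S. mpow S A (Suc k - 1 - r) i s * w s (t + r))"
    by (intro sum.cong refl) (simp add: Suc_diff_Suc del: mpow.simps)
  finally show ?case by (simp add: add.assoc del: mpow.simps)
qed

text \<open>The row vector to which the linear differential operator with coefficients
  \<open>a\<close>, applied to the coordinates in \<open>Y\<close>, reduces on the state.\<close>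

definition row_of :: "nat set \<Rightarrow> (nat \<Rightarrow> nat \<Rightarrow> 'a::comm_ring_1) \<Rightarrow> nat set \<Rightarrow> nat \<Rightarrow> (nat \<Rightarrow> nat \<Rightarrow> 'a) \<Rightarrow> nat \<Rightarrow> 'a" where
  "row_of S A Y D a s = (\<Sum>j\<in>Y. \<Sum>k<D. a j k * mpow S A k j s)"

text \<open>The companion of \<open>row_of\<close> on the inputs: the factor of the
  \<open>r\<close>-th derivative of the forcing at \<open>s\<close>. A \<open>k\<close>-th
  derivative of the state involves the forcing only up to order \<open>k - 1\<close>, hence the
  range \<open>r < k\<close>.\<close>

definition inp_of :: "nat set \<Rightarrow> (nat \<Rightarrow> nat \<Rightarrow> 'a::comm_ring_1) \<Rightarrow> nat set \<Rightarrow> nat \<Rightarrow> (nat \<Rightarrow> nat \<Rightarrow> 'a) \<Rightarrow> nat \<Rightarrow> nat \<Rightarrow> 'a" where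
  "inp_of S A Y D a s r = (\<Sum>j\<in>Y. \<Sum>k\<in>{r<..<D}. a j k * mpow S A (k - 1 - r) j s)"

text \<open>One identity serves three rings: \<complex> for numerical trajectories,
  \<open>ratfun\<close> for formal ones, and differential polynomials for reduction modulo the
  ideal.\<close>

lemma sys_jet_combination:
  assumes "finite S" "Y \<subseteq> S"
  shows "(\<Sum>j\<in>Y. \<Sum>k<D. a j k * sys_jet S A x0 w (t + k) j) =
    (\<Sum>s\<in>S. row_of S A Y D a s * sys_jet S A x0 w t s) + (\<Sum>r<D. \<Sum>s\<in>S. inp_of S A Y D a s r * w s (t + r))"
proof -
  have "(\<Sum>j\<in>Y. \<Sum>k<D. a j k * sys_jet S A x0 w (t + k) j) =
     (\<Sum>j\<in>Y. \<Sum>k<D. (\<Sum>s\<in>S. a j k * mpow S A k j s * sys_jet S A x0 w t s) +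
        (\<Sum>r<k. \<Sum>s\<in>S. a j k * mpow S A (k - 1 - r) j s * w s (t + r)))"
    using assms by (intro sum.cong refl) (subst sys_jet_shift, auto simp: algebra_simps sum_distrib_left)
  also have "\<dots> = (\<Sum>j\<in>Y. \<Sum>k<D. \<Sum>s\<in>S. a j k * mpow S A k j s * sys_jet S A x0 w t s) +
      (\<Sum>j\<in>Y. \<Sum>k<D. \<Sum>r<k. \<Sum>s\<in>S. a j k * mpow S A (k - 1 - r) j s * w s (t + r))"
    by (simp add: sum.distrib)
  also have "(\<Sum>j\<in>Y. \<Sum>k<D. \<Sum>s\<in>S. a j k * mpow S A k j s * sys_jet S A x0 w t s) =
      (\<Sum>j\<in>Y. \<Sum>s\<in>S. \<Sum>k<D. a j k * mpow S A k j s * sys_jet S A x0 w t s)"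
    by (intro sum.cong refl sum.swap)
  also have "\<dots> = (\<Sum>s\<in>S. row_of S A Y D a s * sys_jet S A x0 w t s)"
    unfolding row_of_def by (subst sum.swap) (simp add: sum_distrib_right)
  also have "(\<Sum>j\<in>Y. \<Sum>k<D. \<Sum>r<k. \<Sum>s\<in>S. a j k * mpow S A (k - 1 - r) j s * w s (t + r)) =
      (\<Sum>j\<in>Y. \<Sum>r<D. \<Sum>k\<in>{r<..<D}. \<Sum>s\<in>S. a j k * mpow S A (k - 1 - r) j s * w s (t + r))"
  proof (rule sum.cong[OF refl])
    fix j
    let ?f = "\<lambda>k r. \<Sum>s\<in>S. a j k * mpow S A (k - 1 - r) j s * w s (t + r)"
    have "(\<Sum>k<D. \<Sum>r<k. ?f k r) = (\<Sum>k<D. \<Sum>r | r \<in> {..<D} \<and> r < k. ?f k r)"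
      by (intro sum.cong) auto
    also have "\<dots> = (\<Sum>r<D. \<Sum>k | k \<in> {..<D} \<and> r < k. ?f k r)"
      by (rule sum.swap_restrict) auto
    also have "\<dots> = (\<Sum>r<D. \<Sum>k\<in>{r<..<D}. ?f k r)"
      by (intro sum.cong) auto
    finally show "(\<Sum>k<D. \<Sum>r<k. ?f k r) = (\<Sum>r<D. \<Sum>k\<in>{r<..<D}. ?f k r)" .
  qed
  also have "\<dots> = (\<Sum>r<D. \<Sum>j\<in>Y. \<Sum>s\<in>S. \<Sum>k\<in>{r<..<D}. a j k * mpow S A (k - 1 - r) j s * w s (t + r))"
    by (subst sum.swap) (intro sum.cong refl sum.swap)
  also have "\<dots> = (\<Sum>r<D. \<Sum>s\<in>S. inp_of S A Y D a s r * w s (t + r))"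
    unfolding inp_of_def sum_distrib_right by (rule sum.cong[OF refl], rule sum.swap)
  finally show ?thesis .
qed

lemma sys_jet_no_input:
  assumes "finite S" "i \<in> S"
  shows "sys_jet S A x0 (\<lambda>_ _. 0) k i = (\<Sum>s\<in>S. mpow S A k i s * x0 s)"
  using sys_jet_shift[OF assms, of A x0 "\<lambda>_ _. 0" 0 k] by simp

section \<open>The linear part of the input-output ideal\<close>

text \<open>The part of \<open>dderiv\<close> that belongs to one monomial, with the coefficient as
  a separate argument so that additivity can be stated for a fixed monomial.\<close>

definition dmon :: "'c::semiring_1 \<Rightarrow> (dindet \<times> nat \<Rightarrow>\<^sub>0 nat) \<Rightarrow> (dindet \<times> nat, 'c) mpoly" where
  "dmon c m = (\<Sum>(z, k)\<in>Poly_Mapping.keys m. Poly_Mapping.single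
      (m - Poly_Mapping.single (z, k) 1 + Poly_Mapping.single (z, Suc k) 1)
      (of_nat (Poly_Mapping.lookup m (z, k)) * c))"

lemma dderiv_superset:
  assumes "finite A" "Poly_Mapping.keys p \<subseteq> A"
  shows "dderiv p = (\<Sum>m\<in>A. dmon (Poly_Mapping.lookup p m) m)"
  unfolding dderiv_def dmon_def[symmetric] using assms
  by (intro sum.mono_neutral_left) (auto simp: in_keys_iff dmon_def)

lemma dmon_add: "dmon (c + d) m = dmon c m + dmon d m"
  by (simp add: dmon_def distrib_left single_add sum.distrib split_def)

lemma dderiv_add: "dderiv (p + q) = dderiv p + dderiv q"
proof -
  let ?A = "Poly_Mapping.keys p \<union> Poly_Mapping.keys q"
  have "Poly_Mapping.keys (p + q) \<subseteq> ?A" by (rule Poly_Mapping.keys_add)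
  then show ?thesis
    by (simp add: dderiv_superset[of ?A] lookup_add dmon_add sum.distrib)
qed

lemma dderiv_0 [simp]: "dderiv 0 = 0"
  by (simp add: dderiv_def)

lemma dderiv_diff: "dderiv (p - q) = dderiv p - dderiv q"
  using dderiv_add[of "p - q" q] by simp

lemma dderiv_sum: "dderiv (sum f A) = (\<Sum>a\<in>A. dderiv (f a))"
  by (induction A rule: infinite_finite_induct) (auto simp: dderiv_add)

lemma const_mult_var: "mp_const c * mp_var v = (Poly_Mapping.single (Poly_Mapping.single v 1) c :: ('v, 'a::comm_ring_1) mpoly)"
  by (simp add: mp_const_def mp_var_def mult_single)

lemma dderiv_const_mult_var: "dderiv (mp_const c * mp_var (z, k)) = mp_const c * mp_var (z, Suc k)"
proof -
  have "dderiv (mp_const c * mp_var (z, k)) = dmon c (Poly_Mapping.single (z, k) 1)"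
    unfolding const_mult_var by (subst dderiv_superset[of "{Poly_Mapping.single (z, k) 1}"]) (auto simp: lookup_single)
  also have "\<dots> = mp_const c * mp_var (z, Suc k)"
    by (simp add: dmon_def const_mult_var)
  finally show ?thesis .
qed

lemma dderiv_var: "dderiv (mp_var (z, k)) = mp_var (z, Suc k)"
  using dderiv_const_mult_var[of 1 z k] by simp

lemma dpolys_eq: "dpolys M Z = polys_over (ratfuns (npars M)) (Z \<times> UNIV)"
  by (auto simp: dpolys_def polys_over_def)

lemma subring_dpolys: "subring_set (dpolys M Z)"
  unfolding dpolys_eq by (intro subring_polys_over subfield_imp_subring subfield_ratfuns)

lemmas dpolys_closed = subring_set_closed[OF subring_dpolys]

lemma dpolys_const: "c \<in> ratfuns (npars M) \<Longrightarrow> mp_const c \<in> dpolys M Z"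
  unfolding dpolys_eq by (intro polys_over_const subfield_closed(1)[OF subfield_ratfuns])

lemma dpolys_var: "z \<in> Z \<Longrightarrow> mp_var (z, k) \<in> dpolys M Z"
  unfolding dpolys_eq by (intro polys_over_var subfield_imp_subring subfield_ratfuns) auto

lemma single_in_dpolys:
  assumes "c \<in> ratfuns (npars M)" "Poly_Mapping.keys m \<subseteq> Z \<times> UNIV"
  shows "Poly_Mapping.single m c \<in> dpolys M Z"
  using assms subfield_closed(1)[OF subfield_ratfuns]
  by (auto simp: dpolys_def mp_vars_def lookup_single when_def)

lemma dderiv_in_dpolys:
  assumes "p \<in> dpolys M Z"
  shows "dderiv p \<in> dpolys M Z"
  unfolding dderiv_def split_def
proof (intro dpolys_closed(7) single_in_dpolys)
  fix m v assume m: "m \<in> Poly_Mapping.keys p" and v: "v \<in> Poly_Mapping.keys m"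
  have "of_nat n \<in> ratfuns (npars M)" for n
    by (induction n) (auto intro: subfield_closed[OF subfield_ratfuns])
  then show "of_nat (Poly_Mapping.lookup m (fst v, snd v)) * Poly_Mapping.lookup p m \<in> ratfuns (npars M)"
    using assms by (intro subfield_closed[OF subfield_ratfuns]) (auto simp: dpolys_def)
  have km: "Poly_Mapping.keys m \<subseteq> Z \<times> UNIV"
    using assms m unfolding dpolys_def mp_vars_def by blast
  have "Poly_Mapping.keys (m - Poly_Mapping.single (fst v, snd v) 1) \<subseteq> Poly_Mapping.keys m"
    by (auto simp: in_keys_iff lookup_minus)
  with km v show "Poly_Mapping.keys (m - Poly_Mapping.single (fst v, snd v) 1 +
      Poly_Mapping.single (fst v, Suc (snd v)) 1) \<subseteq> Z \<times> UNIV"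
    using Poly_Mapping.keys_add[of "m - Poly_Mapping.single (fst v, snd v) 1" "Poly_Mapping.single (fst v, Suc (snd v)) 1"]
    by fastforce
qed

text \<open>Exponential generating series, so that \<open>fps_deriv\<close> shifts the sequence.\<close>

definition egf :: "(nat \<Rightarrow> ratfun) \<Rightarrow> ratfun fps" where
  "egf a = Abs_fps (\<lambda>k. a k / of_nat (fact k))"

text \<open>Characteristic zero, on which the division by factorials in \<open>egf\<close>
  rests.\<close>

lemma ratfun_of_nat_eq_0 [simp]: "(of_nat n :: ratfun) = 0 \<longleftrightarrow> n = 0"
  unfolding of_nat_fract Zero_fract_def by (simp add: eq_fract)

lemma fps_deriv_egf: "fps_deriv (egf a) = egf (\<lambda>k. a (Suc k))"
proof (rule fps_ext)
  fix k
  have nz: "(of_nat (Suc k) :: ratfun) \<noteq> 0" "(of_nat (fact k) :: ratfun) \<noteq> 0"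
    by (simp_all del: of_nat_Suc)
  have "(of_nat (fact (Suc k)) :: ratfun) = of_nat (Suc k) * of_nat (fact k)"
    by (simp only: fact_Suc of_nat_mult of_nat_id)
  then show "fps_nth (fps_deriv (egf a)) k = fps_nth (egf (\<lambda>k. a (Suc k))) k"
    using nz by (simp add: egf_def field_simps del: of_nat_Suc fact_Suc)
qed

lemma egf_add: "egf (\<lambda>k. a k + b k) = egf a + egf b"
  and egf_cmult: "egf (\<lambda>k. c * a k) = fps_const c * egf a"
  and egf_0: "egf (\<lambda>k. 0) = 0"
  by (rule fps_ext; simp add: egf_def add_divide_distrib)+

lemma egf_sum: "egf (\<lambda>k. \<Sum>j\<in>S. f j k) = (\<Sum>j\<in>S. egf (f j))"
  by (induction S rule: infinite_finite_induct) (auto simp: egf_0 egf_add)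

text \<open>The indeterminate for a \<open>k\<close>-th derivative receives the \<open>k\<close>-th
  derivative of a formal series, so evaluation intertwines \<open>dderiv\<close> with
  \<open>fps_deriv\<close>.\<close>

definition seq_val :: "(dindet \<Rightarrow> nat \<Rightarrow> ratfun) \<Rightarrow> dindet \<times> nat \<Rightarrow> ratfun fps" where
  "seq_val \<xi> = (\<lambda>(z, k). egf (\<lambda>t. \<xi> z (k + t)))"

lemma is_hom_fps_const: "is_hom (fps_const :: 'a::comm_ring_1 \<Rightarrow> _)"
  by (simp add: is_hom_def)

lemma fps_deriv_seq_val: "fps_deriv (seq_val \<xi> (z, k)) = seq_val \<xi> (z, Suc k)"
  by (simp add: seq_val_def fps_deriv_egf)

lemma fps_deriv_prod_power:
  fixes f :: "'v \<Rightarrow> 'a::comm_ring_1 fps"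
  assumes "finite A"
  shows "fps_deriv (\<Prod>v\<in>A. f v ^ e v) =
    (\<Sum>v\<in>A. of_nat (e v) * (f v ^ (e v - 1) * (\<Prod>w\<in>A - {v}. f w ^ e w)) * fps_deriv (f v))"
  using assms
proof (induction A rule: finite_induct)
  case (insert x A)
  let ?P = "\<Prod>v\<in>A. f v ^ e v"
  have "(\<Sum>v\<in>A. of_nat (e v) * (f v ^ (e v - 1) * (\<Prod>w\<in>insert x A - {v}. f w ^ e w)) * fps_deriv (f v)) =
      (\<Sum>v\<in>A. f x ^ e x * (of_nat (e v) * (f v ^ (e v - 1) * (\<Prod>w\<in>A - {v}. f w ^ e w)) * fps_deriv (f v)))"
  proof (rule sum.cong[OF refl])
    fix v assume "v \<in> A"
    then have "insert x A - {v} = insert x (A - {v})" using insert.hyps by auto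
    then show "of_nat (e v) * (f v ^ (e v - 1) * (\<Prod>w\<in>insert x A - {v}. f w ^ e w)) * fps_deriv (f v) =
        f x ^ e x * (of_nat (e v) * (f v ^ (e v - 1) * (\<Prod>w\<in>A - {v}. f w ^ e w)) * fps_deriv (f v))"
      using insert.hyps by (simp add: algebra_simps)
  qed
  also have "\<dots> = f x ^ e x * fps_deriv ?P"
    by (simp add: insert.IH sum_distrib_left)
  finally have 1: "(\<Sum>v\<in>A. of_nat (e v) * (f v ^ (e v - 1) * (\<Prod>w\<in>insert x A - {v}. f w ^ e w)) * fps_deriv (f v)) =
      f x ^ e x * fps_deriv ?P" .
  have "fps_deriv (\<Prod>v\<in>insert x A. f v ^ e v) = f x ^ e x * fps_deriv ?P + fps_deriv (f x ^ e x) * ?P"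
    using insert.hyps by simp
  also have "fps_deriv (f x ^ e x) * ?P =
      of_nat (e x) * (f x ^ (e x - 1) * (\<Prod>w\<in>insert x A - {x}. f w ^ e w)) * fps_deriv (f x)"
    using insert.hyps by (simp add: fps_deriv_power fps_of_nat algebra_simps)
  finally show ?case unfolding sum.insert[OF insert.hyps] 1 by (simp add: add.commute)
qed simp

lemma mev_dmon:
  "mev fps_const (seq_val \<xi>) (dmon c m) = fps_deriv (fps_const c * mon_val (seq_val \<xi>) m)"
proof -
  let ?z = "seq_val \<xi>"
  have "mev fps_const ?z (dmon c m) = (\<Sum>v\<in>Poly_Mapping.keys m. fps_const (of_nat (Poly_Mapping.lookup m v) * c) *
      (mon_val ?z (m - Poly_Mapping.single v 1) * fps_deriv (?z v)))"
    unfolding dmon_def split_def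
    by (simp add: mev_sum[OF is_hom_fps_const] mev_single mon_val_add fps_deriv_seq_val[symmetric])
  also have "\<dots> = (\<Sum>v\<in>Poly_Mapping.keys m. fps_const c * (of_nat (Poly_Mapping.lookup m v) *
      (?z v ^ (Poly_Mapping.lookup m v - 1) * (\<Prod>w\<in>Poly_Mapping.keys m - {v}. ?z w ^ Poly_Mapping.lookup m w)) * fps_deriv (?z v)))"
  proof (rule sum.cong[OF refl])
    fix v assume v: "v \<in> Poly_Mapping.keys m"
    have "mon_val ?z (m - Poly_Mapping.single v 1) =
        (\<Prod>w\<in>Poly_Mapping.keys m. ?z w ^ Poly_Mapping.lookup (m - Poly_Mapping.single v 1) w)"
      by (rule mon_val_superset) (auto simp: in_keys_iff lookup_minus)
    also have "\<dots> = ?z v ^ (Poly_Mapping.lookup m v - 1) *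
        (\<Prod>w\<in>Poly_Mapping.keys m - {v}. ?z w ^ Poly_Mapping.lookup (m - Poly_Mapping.single v 1) w)"
      using v by (subst prod.remove[of _ v]) (auto simp: lookup_minus lookup_single)
    also have "(\<Prod>w\<in>Poly_Mapping.keys m - {v}. ?z w ^ Poly_Mapping.lookup (m - Poly_Mapping.single v 1) w) =
        (\<Prod>w\<in>Poly_Mapping.keys m - {v}. ?z w ^ Poly_Mapping.lookup m w)"
      by (intro prod.cong) (auto simp: lookup_minus lookup_single when_def)
    finally show "fps_const (of_nat (Poly_Mapping.lookup m v) * c) *
      (mon_val ?z (m - Poly_Mapping.single v 1) * fps_deriv (?z v)) = fps_const c * (of_nat (Poly_Mapping.lookup m v) *
      (?z v ^ (Poly_Mapping.lookup m v - 1) * (\<Prod>w\<in>Poly_Mapping.keys m - {v}. ?z w ^ Poly_Mapping.lookup m w)) * fps_deriv (?z v))"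
      by (simp add: fps_const_mult[symmetric] fps_of_nat algebra_simps del: fps_const_mult)
  qed
  also have "\<dots> = fps_deriv (fps_const c * mon_val ?z m)"
    by (simp add: mon_val_def fps_deriv_prod_power sum_distrib_left)
  finally show ?thesis .
qed

lemma mev_dderiv: "mev fps_const (seq_val \<xi>) (dderiv p) = fps_deriv (mev fps_const (seq_val \<xi>) p)"
  unfolding dderiv_superset[OF finite_keys order_refl] mev_sum[OF is_hom_fps_const] mev_dmon
  by (simp add: mev_def fps_deriv_sum)

text \<open>A formal trajectory over \<open>ratfun\<close> with arbitrary initial state and
  arbitrary input sequence. No convergence is involved, so both can be used as free test
  data.\<close>

definition sol_seq :: "compartment_model \<Rightarrow> (nat \<Rightarrow> ratfun) \<Rightarrow> (nat \<Rightarrow> nat \<Rightarrow> ratfun) \<Rightarrow> dindet \<Rightarrow> nat \<Rightarrow> ratfun" where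
  "sol_seq M x0 U z t = (let X = sys_jet (verts M) (cmat M) x0 (\<lambda>i k. if i \<in> inputs M then bcoef M i * U i k else 0) in
     case z of State i \<Rightarrow> X t i | Output i \<Rightarrow> ccoef M i * X t i | Input i \<Rightarrow> U i t)"

text \<open>The entries of the matrix are polynomials, hence regular everywhere: the conditions in
  \<open>Omega\<close> bear only on \<open>bcoef\<close> and \<open>ccoef\<close>. The explicit
  values are used at the special point for controllability.\<close>

lemma cmat_in_ratfuns:
  assumes "linear_compartment_model M" "i \<in> verts M" "j \<in> verts M"
  obtains P where "cmat M i j = Fract P 1" "mp_vars P \<subseteq> {1..npars M}"
    "\<And>\<mu>. mp_eval \<mu> P = (if i = j then - (if i \<in> leaks M then \<mu> (par_index M 0 i) else 0) -
        (\<Sum>k | (i, k) \<in> edges M. \<mu> (par_index M k i))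
      else if (j, i) \<in> edges M then \<mu> (par_index M i j) else 0)"
proof -
  let ?x = "\<lambda>j i. mp_var (par_index M j i) :: (nat, complex) mpoly"
  let ?P = "if i = j then - (if i \<in> leaks M then ?x 0 i else 0) - (\<Sum>k | (i, k) \<in> edges M. ?x k i)
      else if (j, i) \<in> edges M then ?x i j else 0"
  define \<phi> where "\<phi> = (\<lambda>P::(nat, complex) mpoly. Fract P 1)"
  have "is_hom \<phi>" unfolding \<phi>_def by (rule is_hom_Fract)
  note hF = is_hom_simps[OF this] and hE = is_hom_simps[OF is_hom_mp_eval]
  have idx: "par_index M j i \<in> {1..npars M}" if "(j, i) \<in> par_pairs M" for j i
    using assms(1) that by (auto simp: linear_compartment_model_def)
  show thesis
  proof (rule that[of ?P])
    have "cmat M i j = (if i = j then - (if i \<in> leaks M then \<phi> (?x 0 i) else 0) - (\<Sum>k | (i, k) \<in> edges M. \<phi> (?x k i))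
      else if (j, i) \<in> edges M then \<phi> (?x i j) else 0)"
      by (simp add: cmat_def par_def rf_var_def \<phi>_def)
    also have "\<dots> = \<phi> ?P"
      by (simp add: hF)
    finally show "cmat M i j = Fract ?P 1" by (simp add: \<phi>_def)
    have "?P \<in> polys_over UNIV {1..npars M}"
      using idx by (auto simp: par_pairs_def
        intro!: subring_set_closed[OF subring_polys_over[OF subring_UNIV]] polys_over_var[OF subring_UNIV]
        simp del: One_nat_def atLeastAtMost_iff)
    then show "mp_vars ?P \<subseteq> {1..npars M}" by (simp add: polys_over_UNIV)
    show "mp_eval \<mu> ?P = (if i = j then - (if i \<in> leaks M then \<mu> (par_index M 0 i) else 0) -
        (\<Sum>k | (i, k) \<in> edges M. \<mu> (par_index M k i))
      else if (j, i) \<in> edges M then \<mu> (par_index M i j) else 0)" for \<mu>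
      by (simp add: hE)
  qed
qed

lemma finite_verts [simp]: "finite (verts M)"
  by (simp add: verts_def)

lemma finite_outputs [simp]: "finite (outputs M)"
  by (simp add: outputs_def)

context
  fixes M :: compartment_model
  assumes lcm: "linear_compartment_model M"
begin

lemma outputs_subset: "outputs M \<subseteq> verts M" and inputs_subset: "inputs M \<subseteq> verts M"
  and bcoef_ratfun: "i \<in> inputs M \<Longrightarrow> bcoef M i \<in> ratfuns (npars M)"
  and bcoef_nonzero: "i \<in> inputs M \<Longrightarrow> bcoef M i \<noteq> 0"
  and ccoef_ratfun: "i \<in> outputs M \<Longrightarrow> ccoef M i \<in> ratfuns (npars M)"
  and ccoef_nonzero: "i \<in> outputs M \<Longrightarrow> ccoef M i \<noteq> 0"
  using lcm by (auto simp: linear_compartment_model_def)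

lemma finite_inputs: "finite (inputs M)"
  using inputs_subset finite_verts finite_subset by blast

lemma cmat_ratfun: "i \<in> verts M \<Longrightarrow> j \<in> verts M \<Longrightarrow> cmat M i j \<in> ratfuns (npars M)"
  using cmat_in_ratfuns[OF lcm, of i j] ratfuns_polynomial by metis

lemma state_eq_dpoly: "i \<in> verts M \<Longrightarrow> state_eq M i \<in> dpolys M (all_indets M)"
  unfolding state_eq_def
  by (auto simp: all_indets_def intro!: dpolys_closed dpolys_var dpolys_const cmat_ratfun bcoef_ratfun)

lemma output_eq_dpoly: "i \<in> outputs M \<Longrightarrow> output_eq M i \<in> dpolys M (all_indets M)"
  unfolding output_eq_def using outputs_subset
  by (auto simp: all_indets_def intro!: dpolys_closed dpolys_var dpolys_const ccoef_ratfun)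

text \<open>The differential polynomials vanishing on one trajectory form a differential ideal that
  contains the generators, hence contains the smallest such ideal.\<close>

lemma I_Sigma_vanishes_on_solutions:
  assumes "q \<in> I_Sigma M"
  shows "mev fps_const (seq_val (sol_seq M x0 U)) q = 0"
proof -
  let ?ev = "mev fps_const (seq_val (sol_seq M x0 U))"
  note hom = is_hom_simps[OF is_hom_mev[OF is_hom_fps_const, of "seq_val (sol_seq M x0 U)"]]
  note ev = hom mev_mp_const[OF is_hom_fps_const] mev_mp_var[OF is_hom_fps_const]
  define X where "X = sys_jet (verts M) (cmat M) x0 (\<lambda>i k. if i \<in> inputs M then bcoef M i * U i k else 0)"
  have vals: "seq_val (sol_seq M x0 U) (State i, k) = egf (\<lambda>t. X (k + t) i)"
    "seq_val (sol_seq M x0 U) (Output i, k) = egf (\<lambda>t. ccoef M i * X (k + t) i)"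
    "seq_val (sol_seq M x0 U) (Input i, k) = egf (\<lambda>t. U i (k + t))" for i k
    by (simp_all add: seq_val_def sol_seq_def Let_def X_def)
  let ?J = "{p \<in> dpolys M (all_indets M). ?ev p = 0}"
  have "differential_ideal (dpolys M (all_indets M)) ?J"
    unfolding differential_ideal_def
    by (auto simp: hom mev_dderiv intro!: dpolys_closed dderiv_in_dpolys)
  moreover have "?ev (state_eq M i) = 0" if i: "i \<in> verts M" for i
  proof -
    have "(\<lambda>t. X (1 + t) i) = (\<lambda>t. (\<Sum>j\<in>verts M. cmat M i j * X t j) + (if i \<in> inputs M then bcoef M i * U i t else 0))"
      by (simp add: X_def fun_eq_iff)
    then have "egf (\<lambda>t. X (1 + t) i) = (\<Sum>j\<in>verts M. fps_const (cmat M i j) * egf (\<lambda>t. X t j)) +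
        (if i \<in> inputs M then fps_const (bcoef M i) * egf (U i) else 0)"
      by (simp add: egf_add egf_sum egf_cmult egf_0)
    then show ?thesis by (simp add: state_eq_def ev vals)
  qed
  moreover have "?ev (output_eq M i) = 0" for i
    by (simp add: output_eq_def ev vals egf_cmult)
  ultimately have "I_Sigma M \<subseteq> ?J"
    unfolding I_Sigma_def using state_eq_dpoly output_eq_dpoly by (intro Inter_lower) auto
  then show ?thesis using assms by blast
qed

text \<open>The counterpart to vanishing on trajectories: modulo the ideal, every derivative of a
  state or output reduces to states of order zero and derivatives of inputs. The reduced form
  \<open>L\<close> is the system run inside the ring of differential polynomials.\<close>

lemma var_minus_jet_in_ideal:
  assumes I: "differential_ideal (dpolys M (all_indets M)) I"
    and gens: "state_eq M ` verts M \<union> output_eq M ` outputs M \<subseteq> I"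
  defines "w \<equiv> \<lambda>i k. if i \<in> inputs M then mp_const (bcoef M i) * mp_var (Input i, k) else 0"
  defines "L \<equiv> sys_jet (verts M) (\<lambda>i j. mp_const (cmat M i j)) (\<lambda>i. mp_var (State i, 0)) w"
  shows "i \<in> verts M \<Longrightarrow> mp_var (State i, k) - L k i \<in> I"
    and "i \<in> outputs M \<Longrightarrow> mp_var (Output i, k) - mp_const (ccoef M i) * L k i \<in> I"
proof -
  let ?R = "dpolys M (all_indets M)"
  have I0: "0 \<in> I" and Iadd: "\<And>p q. p \<in> I \<Longrightarrow> q \<in> I \<Longrightarrow> p + q \<in> I"
    and Imult: "\<And>r p. r \<in> ?R \<Longrightarrow> p \<in> I \<Longrightarrow> r * p \<in> I" and Ider: "\<And>p. p \<in> I \<Longrightarrow> dderiv p \<in> I"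
    using I by (auto simp: differential_ideal_def)
  have Isum: "(\<And>a. a \<in> A \<Longrightarrow> f a \<in> I) \<Longrightarrow> sum f A \<in> I" for f :: "nat \<Rightarrow> _" and A
    by (induction A rule: infinite_finite_induct) (auto simp: I0 Iadd)
  have dw: "dderiv (w i k) = w i (Suc k)" for i k
    by (simp add: w_def dderiv_const_mult_var)
  have st: "mp_var (State i, Suc k) - ((\<Sum>j\<in>verts M. mp_const (cmat M i j) * mp_var (State j, k)) + w i k) \<in> I"
    if "i \<in> verts M" for i k
  proof (induction k)
    case 0
    then show ?case using gens that by (auto simp: state_eq_def w_def)
  next
    case (Suc k)
    from Ider[OF this] show ?case
      by (simp add: dderiv_diff dderiv_add dderiv_sum dderiv_var dderiv_const_mult_var dw)
  qed
  show S: "mp_var (State i, k) - L k i \<in> I" if "i \<in> verts M" for i k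
    using that
  proof (induction k arbitrary: i)
    case 0
    then show ?case by (simp add: L_def I0)
  next
    case (Suc k)
    \<comment> \<open>Adding this element replaces the state derivatives on the right-hand side by
      their reductions.\<close>
    have "(\<Sum>j\<in>verts M. mp_const (cmat M i j) * (mp_var (State j, k) - L k j)) \<in> I"
      using Suc by (intro Isum Imult dpolys_const cmat_ratfun) auto
    from Iadd[OF st[OF Suc.prems, of k] this] show ?case
      by (simp add: L_def algebra_simps sum_subtractf)
  qed
  have out: "mp_var (Output i, k) - mp_const (ccoef M i) * mp_var (State i, k) \<in> I" if "i \<in> outputs M" for i k
  proof (induction k)
    case 0
    then show ?case using gens that by (auto simp: output_eq_def)
  next
    case (Suc k)
    from Ider[OF this] show ?case
      by (simp add: dderiv_diff dderiv_var dderiv_const_mult_var)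
  qed
  show "mp_var (Output i, k) - mp_const (ccoef M i) * L k i \<in> I" if "i \<in> outputs M"
  proof -
    have "mp_const (ccoef M i) * (mp_var (State i, k) - L k i) \<in> I"
      using that outputs_subset by (intro Imult S dpolys_const ccoef_ratfun) auto
    from Iadd[OF out[OF that, of k] this] show ?thesis by (simp add: algebra_simps)
  qed
qed

end

section \<open>Generic controllability\<close>

text \<open>Back substitution for \<open>A - ev\<close>: the index \<open>n\<close> of largest
  \<open>d\<close> is inserted last, its row vanishes off the diagonal, and so its coordinate is
  solved for first.\<close>

lemma triangular_solvable:
  fixes A :: "nat \<Rightarrow> nat \<Rightarrow> 'a::field" and d :: "nat \<Rightarrow> nat"
  assumes "finite S" "\<And>i j. i \<in> S \<Longrightarrow> j \<in> S \<Longrightarrow> i \<noteq> j \<Longrightarrow> A i j \<noteq> 0 \<Longrightarrow> d i < d j"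
    and "\<And>i. i \<in> S \<Longrightarrow> A i i \<noteq> ev"
  shows "\<exists>x. \<forall>i\<in>S. (\<Sum>j\<in>S. A i j * x j) - ev * x i = b i"
  using assms
proof (induction S arbitrary: b rule: finite_ranking_induct[where f = d])
  case (insert n S)
  show ?case
  proof (cases "n \<in> S")
    case True
    then show ?thesis using insert by (simp add: insert_absorb)
  next
    case False
    let ?xn = "b n / (A n n - ev)"
    obtain x where x: "\<forall>i\<in>S. (\<Sum>j\<in>S. A i j * x j) - ev * x i = b i - A i n * ?xn"
      using insert.IH[of "\<lambda>i. b i - A i n * ?xn"] insert.prems by auto
    let ?x = "x(n := ?xn)"
    have S: "(\<Sum>j\<in>S. A i j * ?x j) = (\<Sum>j\<in>S. A i j * x j)" for i
      using False by (intro sum.cong) auto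
    have n0: "(\<Sum>j\<in>S. A n j * x j) = 0"
    proof (rule sum.neutral, rule ballI)
      fix j assume j: "j \<in> S"
      then have "A n j = 0" using insert.prems(1)[of n j] insert.hyps(2)[OF j] False by force
      then show "A n j * x j = 0" by simp
    qed
    have "(\<Sum>j\<in>insert n S. A i j * ?x j) - ev * ?x i = b i" if "i \<in> insert n S" for i
    proof (cases "i = n")
      case True
      have "A n n - ev \<noteq> 0" using insert.prems(2)[of n] by simp
      then have "(A n n - ev) * ?xn = b n" by simp
      then have "A n n * ?xn - ev * ?xn = b n" by (simp only: left_diff_distrib)
      then show ?thesis using True insert.hyps(1) False n0 unfolding sum.insert[OF insert.hyps(1) False] S by simp
    next
      case ne: False
      then show ?thesis using x that unfolding sum.insert[OF insert.hyps(1) False] S by (auto simp: algebra_simps)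
    qed
    then show ?thesis by blast
  qed
qed simp

text \<open>A cyclic vector by induction. The new vector \<open>x\<close> is chosen so that
  \<open>A - A n n\<close> maps it to the old cyclic vector \<open>z\<close> on \<open>S\<close> and
  to 0 at \<open>n\<close>. A functional killing the orbit of \<open>x\<close> then kills the orbit
  of \<open>z\<close>, so it is supported at \<open>n\<close>, where \<open>x\<close> has coordinate
  1.\<close>

lemma triangular_cyclic:
  fixes A :: "nat \<Rightarrow> nat \<Rightarrow> 'a::field" and d :: "nat \<Rightarrow> nat"
  assumes "finite S" "\<And>i j. i \<in> S \<Longrightarrow> j \<in> S \<Longrightarrow> i \<noteq> j \<Longrightarrow> A i j \<noteq> 0 \<Longrightarrow> d i < d j"
    and "inj_on (\<lambda>i. A i i) S"
  shows "\<exists>x. \<forall>\<gamma>. (\<forall>k. (\<Sum>j\<in>S. \<gamma> j * sys_jet S A x (\<lambda>_ _. 0) k j) = 0) \<longrightarrow> (\<forall>j\<in>S. \<gamma> j = 0)"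
  using assms
proof (induction S rule: finite_ranking_induct[where f = d])
  case (insert n S)
  show ?case
  proof (cases "n \<in> S")
    case True
    then show ?thesis using insert by (simp add: insert_absorb)
  next
    case nS: False
    let ?T = "insert n S" and ?ev = "A n n"
    have "inj_on (\<lambda>i. A i i) S" using insert.prems(2) by (auto simp: inj_on_def)
    then obtain z where z0: "\<forall>\<gamma>. (\<forall>k. (\<Sum>j\<in>S. \<gamma> j * sys_jet S A z (\<lambda>_ _. 0) k j) = 0) \<longrightarrow> (\<forall>j\<in>S. \<gamma> j = 0)"
      using insert.IH insert.prems(1) by (metis insertCI)
    have z: "\<gamma> j = 0" if "\<And>k. (\<Sum>j\<in>S. \<gamma> j * sys_jet S A z (\<lambda>_ _. 0) k j) = 0" "j \<in> S" for \<gamma> j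
      using z0 that by blast
    have "A i i \<noteq> ?ev" if "i \<in> S" for i
      using insert.prems(2) that nS by (auto simp: inj_on_def)
    moreover have "d i < d j" if "i \<in> S" "j \<in> S" "i \<noteq> j" "A i j \<noteq> 0" for i j
      using insert.prems(1) that by blast
    \<comment> \<open>Distinct diagonal entries keep \<open>A n n\<close> off the diagonal of the
      block on \<open>S\<close>, so this block minus \<open>A n n\<close> is invertible. The term
      \<open>A i n\<close> compensates for the coordinate 1 at \<open>n\<close>.\<close>
    ultimately have "\<exists>y. \<forall>i\<in>S. (\<Sum>j\<in>S. A i j * y j) - ?ev * y i = z i - A i n"
      by (intro triangular_solvable[OF insert.hyps(1), where d = d]) auto
    then obtain y where y: "\<And>i. i \<in> S \<Longrightarrow> (\<Sum>j\<in>S. A i j * y j) - ?ev * y i = z i - A i n" by blast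
    let ?x = "y(n := 1)"
    let ?X = "sys_jet ?T A ?x (\<lambda>_ _. 0)" and ?Z = "sys_jet S A z (\<lambda>_ _. 0)"
    \<comment> \<open>\<open>D k\<close> is the orbit of the image of \<open>x\<close> under
      \<open>A - A n n\<close>; it coincides with the orbit of \<open>z\<close> on \<open>S\<close>
      and vanishes at \<open>n\<close>.\<close>
    define D where "D k i = ?X (Suc k) i - ?ev * ?X k i" for k i
    have An: "A n j = 0" if "j \<in> S" for j
      using insert.prems(1)[of n j] insert.hyps(2)[OF that] nS that by force
    have D: "D k n = 0 \<and> (\<forall>i\<in>S. D k i = ?Z k i)" for k
    proof (induction k)
      case 0
      have S: "(\<Sum>j\<in>S. A i j * ?x j) = (\<Sum>j\<in>S. A i j * y j)" for i
        using nS by (intro sum.cong) auto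
      have "(\<Sum>j\<in>S. A n j * y j) = 0" using An by simp
      moreover have "D 0 i = z i" if "i \<in> S" for i
        using y[OF that] nS that unfolding D_def sys_jet.simps sum.insert[OF insert.hyps(1) nS] S by (auto simp: algebra_simps)
      ultimately show ?case
        using nS unfolding D_def sys_jet.simps sum.insert[OF insert.hyps(1) nS] S by (auto simp: D_def)
    next
      case (Suc k)
      have step: "D (Suc k) i = (\<Sum>j\<in>?T. A i j * D k j)" for i
        by (simp add: D_def algebra_simps sum_subtractf sum_distrib_left del: sum.insert)
      have "D (Suc k) i = (\<Sum>j\<in>S. A i j * ?Z k j)" for i
        unfolding step sum.insert[OF insert.hyps(1) nS] using Suc.IH by simp
      then show ?case using An by simp
    qed
    show ?thesis
    proof (intro exI[of _ ?x] allI impI)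
      fix \<gamma> assume \<gamma>: "\<forall>k. (\<Sum>j\<in>?T. \<gamma> j * ?X k j) = 0"
      have orth: "(\<Sum>j\<in>S. \<gamma> j * ?Z k j) = 0" for k
      proof -
        have "(\<Sum>j\<in>?T. \<gamma> j * D k j) = (\<Sum>j\<in>?T. \<gamma> j * ?X (Suc k) j) - ?ev * (\<Sum>j\<in>?T. \<gamma> j * ?X k j)"
          unfolding D_def by (simp add: algebra_simps sum_subtractf sum_distrib_left del: sum.insert sys_jet.simps)
        also have "\<dots> = 0" using \<gamma> by (simp del: sum.insert sys_jet.simps)
        finally show ?thesis unfolding sum.insert[OF insert.hyps(1) nS] using D[of k] by simp
      qed
      have S: "\<gamma> j = 0" if "j \<in> S" for j by (rule z[of \<gamma>, OF orth that])
      have "(\<Sum>j\<in>S. \<gamma> j * ?X 0 j) = 0" by (rule sum.neutral) (simp add: S)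
      moreover have "(\<Sum>j\<in>?T. \<gamma> j * ?X 0 j) = 0" using \<gamma> by blast
      ultimately have "\<gamma> n = 0" unfolding sum.insert[OF insert.hyps(1) nS] by simp
      with S show "\<forall>j\<in>?T. \<gamma> j = 0" by auto
    qed
  qed
qed simp

text \<open>The controllability matrix of the pair consisting of \<open>A\<close> and the input
  directions together with \<open>x0\<close>, which is the column family \<open>None\<close>. The
  factors \<open>bcoef\<close> are omitted from the input columns; where it matters their values are
  nonzero.\<close>

definition ctrl :: "nat set \<Rightarrow> (nat \<Rightarrow> nat \<Rightarrow> 'a::comm_ring_1) \<Rightarrow> (nat \<Rightarrow> 'a) \<Rightarrow> nat \<Rightarrow> nat \<times> nat option \<Rightarrow> 'a" where
  "ctrl S A x0 j = (\<lambda>(k, c). case c of Some i \<Rightarrow> mpow S A k j i | None \<Rightarrow> (\<Sum>s\<in>S. mpow S A k j s * x0 s))"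

abbreviation "ctrl_idx M \<equiv> (UNIV :: nat set) \<times> insert None (Some ` inputs M)"

text \<open>At the special point every vertex that is not an input drains, with a rate equal to its number,
  along a shortest path to a leak or an input, and all other flows vanish.\<close>

lemma controllable_point_exists:
  assumes lcm: "linear_compartment_model M"
    and reach: "\<And>w. w \<in> verts M \<Longrightarrow> \<exists>v\<in>leaks M \<union> inputs M. reachable M w v"
  shows "\<exists>\<mu> x0. indep UNIV (verts M) (ctrl_idx M) (ctrl (verts M) (A_at M \<mu>) x0)"
proof -
  let ?T = "leaks M \<union> inputs M"
  \<comment> \<open>The distance to the nearest leak or input. It drops along the chosen outgoing
    edge and therefore orders the matrix triangularly.\<close>
  define d where "d w = (LEAST m. \<exists>v\<in>?T. (w, v) \<in> edges M ^^ m)" for w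
  have next_hop: "\<exists>p. (w, p) \<in> edges M \<and> d p < d w" if w: "w \<in> verts M" "w \<notin> ?T" for w
  proof -
    have "\<exists>m. \<exists>v\<in>?T. (w, v) \<in> edges M ^^ m"
      using reach[OF w(1)] unfolding reachable_def by (auto simp: rtrancl_power)
    then have "\<exists>v\<in>?T. (w, v) \<in> edges M ^^ d w" unfolding d_def by (rule LeastI_ex)
    then obtain v where v: "v \<in> ?T" "(w, v) \<in> edges M ^^ d w" by blast
    then obtain m where m: "d w = Suc m" using w(2) by (cases "d w") auto
    then obtain p where p: "(w, p) \<in> edges M" "(p, v) \<in> edges M ^^ m"
      using v(2) by (metis relpow_Suc_D2)
    have "d p \<le> m" unfolding d_def using p(2) v(1) by (intro Least_le) blast
    then show ?thesis using p(1) m by auto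
  qed
  define nh where "nh w = (SOME p. (w, p) \<in> edges M \<and> d p < d w)" for w
  have nh: "(w, nh w) \<in> edges M" "d (nh w) < d w" if "w \<in> verts M" "w \<notin> ?T" for w
    using someI_ex[OF next_hop[OF that]] by (auto simp: nh_def)
  define val :: "nat \<times> nat \<Rightarrow> complex" where "val = (\<lambda>(j, i).
    if i \<in> inputs M then 0 else if i \<in> leaks M then (if j = 0 then of_nat i else 0)
    else if j = nh i then of_nat i else 0)"
  let ?idx = "\<lambda>(j, i). par_index M j i"
  define \<mu> where "\<mu> m = val (inv_into (par_pairs M) ?idx m)" for m
  have inj: "inj_on ?idx (par_pairs M)" and edges: "edges M \<subseteq> verts M \<times> verts M" "\<And>i. (i, i) \<notin> edges M"
    and leaks: "leaks M \<subseteq> verts M"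
    using lcm by (auto simp: linear_compartment_model_def)
  have \<mu>: "\<mu> (par_index M j i) = val (j, i)" if "(j, i) \<in> par_pairs M" for j i
    using inv_into_f_f[OF inj that] by (simp add: \<mu>_def)
  have pairs: "(i, k) \<in> edges M \<Longrightarrow> (k, i) \<in> par_pairs M" "i \<in> leaks M \<Longrightarrow> (0, i) \<in> par_pairs M" for i k
    by (auto simp: par_pairs_def)
  have edge_pos: "k \<noteq> 0" if "(i, k) \<in> edges M" for i k
    using edges(1) that by (auto simp: verts_def)
  have A: "A_at M \<mu> i j = (if i = j then - (if i \<in> leaks M then \<mu> (par_index M 0 i) else 0) -
        (\<Sum>k | (i, k) \<in> edges M. \<mu> (par_index M k i))
      else if (j, i) \<in> edges M then \<mu> (par_index M i j) else 0)" if "i \<in> verts M" "j \<in> verts M" for i j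
  proof (rule cmat_in_ratfuns[OF lcm that])
    fix P assume P: "cmat M i j = Fract P 1" "mp_vars P \<subseteq> {1..npars M}"
      "\<And>\<mu>. mp_eval \<mu> P = (if i = j then - (if i \<in> leaks M then \<mu> (par_index M 0 i) else 0) -
        (\<Sum>k | (i, k) \<in> edges M. \<mu> (par_index M k i))
      else if (j, i) \<in> edges M then \<mu> (par_index M i j) else 0)"
    show ?thesis unfolding A_at_def P(1) regular_polynomial(2)[OF P(2)] by (rule P(3))
  qed
  let ?A = "A_at M \<mu>" and ?V = "verts M"
  let ?W = "?V - inputs M"
  have fin_out: "finite {k. (i, k) \<in> edges M}" for i
    using edges(1) finite_subset[of "{k. (i, k) \<in> edges M}" ?V] by auto
  \<comment> \<open>Nothing flows out of an input vertex at this point, so the remaining vertices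
    form an autonomous subsystem.\<close>
  have col0: "?A i j = 0" if "i \<in> ?V" "j \<in> inputs M" for i j
  proof -
    have "j \<in> ?V" using that(2) lcm by (auto simp: linear_compartment_model_def)
    moreover have "(\<Sum>k | (j, k) \<in> edges M. \<mu> (par_index M k j)) = 0"
      by (rule sum.neutral) (auto simp: \<mu> pairs val_def that(2))
    ultimately show ?thesis using that by (auto simp: A \<mu> pairs val_def)
  qed
  have diag: "?A i i = - of_nat i" if "i \<in> ?W" for i
  proof (cases "i \<in> leaks M")
    case True
    have "(\<Sum>k | (i, k) \<in> edges M. \<mu> (par_index M k i)) = 0"
      using that True edge_pos by (intro sum.neutral) (auto simp: \<mu> pairs val_def)
    then show ?thesis using that True by (simp add: A \<mu> pairs val_def)
  next
    case False
    then have n: "(i, nh i) \<in> edges M" using nh(1)[of i] that by auto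
    have "(\<Sum>k | (i, k) \<in> edges M. \<mu> (par_index M k i)) = (\<Sum>k | (i, k) \<in> edges M. if k = nh i then of_nat i else 0)"
      using that False by (intro sum.cong) (auto simp: \<mu> pairs val_def)
    also have "\<dots> = of_nat i" using n fin_out by (simp add: sum.delta)
    finally show ?thesis using that False by (simp add: A)
  qed
  have tri: "d i < d j" if "i \<in> ?W" "j \<in> ?W" "i \<noteq> j" "?A i j \<noteq> 0" for i j
  proof -
    have e: "(j, i) \<in> edges M" "val (i, j) \<noteq> 0"
      using that by (auto simp: A \<mu> pairs split: if_splits)
    then have "j \<notin> leaks M" "i = nh j"
      using that edge_pos by (auto simp: val_def split: if_splits)
    then show ?thesis using nh(2)[of j] that by auto
  qed
  obtain x where x: "\<And>\<gamma> j. (\<And>k. (\<Sum>j\<in>?W. \<gamma> j * sys_jet ?W ?A x (\<lambda>_ _. 0) k j) = 0) \<Longrightarrow> j \<in> ?W \<Longrightarrow> \<gamma> j = 0"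
  proof -
    have "inj_on (\<lambda>i. ?A i i) ?W" unfolding inj_on_def using diag by simp
    then have "\<exists>x. \<forall>\<gamma>. (\<forall>k. (\<Sum>j\<in>?W. \<gamma> j * sys_jet ?W ?A x (\<lambda>_ _. 0) k j) = 0) \<longrightarrow> (\<forall>j\<in>?W. \<gamma> j = 0)"
      by (rule triangular_cyclic[where d = d, rotated 2]) (simp, rule tri)
    then obtain x where x0: "\<forall>\<gamma>. (\<forall>k. (\<Sum>j\<in>?W. \<gamma> j * sys_jet ?W ?A x (\<lambda>_ _. 0) k j) = 0) \<longrightarrow> (\<forall>j\<in>?W. \<gamma> j = 0)" ..
    show thesis by (rule that[of x]) (use x0 in blast)
  qed
  have VW: "sys_jet ?V ?A x (\<lambda>_ _. 0) k i = sys_jet ?W ?A x (\<lambda>_ _. 0) k i" if "i \<in> ?V" for k i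
    using that
  proof (induction k arbitrary: i)
    case (Suc k)
    have "(\<Sum>j\<in>?V. ?A i j * sys_jet ?V ?A x (\<lambda>_ _. 0) k j) = (\<Sum>j\<in>?W. ?A i j * sys_jet ?V ?A x (\<lambda>_ _. 0) k j)"
      using col0[OF Suc.prems] by (intro sum.mono_neutral_right) auto
    also have "\<dots> = (\<Sum>j\<in>?W. ?A i j * sys_jet ?W ?A x (\<lambda>_ _. 0) k j)"
      using Suc.IH by (intro sum.cong) auto
    finally show ?case by simp
  qed simp
  have "indep UNIV ?V (ctrl_idx M) (ctrl ?V ?A x)"
    unfolding indep_def
  proof (intro allI impI, elim conjE)
    fix \<gamma> assume \<gamma>: "\<forall>c\<in>ctrl_idx M. (\<Sum>j\<in>?V. \<gamma> j * ctrl ?V ?A x j c) = 0"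
    \<comment> \<open>The column of order 0 for input \<open>i\<close> is a unit vector and reads
      off \<open>\<gamma> i\<close>, which leaves only the vertices that are not inputs.\<close>
    have inp: "\<gamma> i = 0" if "i \<in> inputs M" for i
    proof -
      have "i \<in> ?V" using that lcm by (auto simp: linear_compartment_model_def)
      moreover have "(\<Sum>j\<in>?V. \<gamma> j * ctrl ?V ?A x j (0, Some i)) = 0" using \<gamma> that by blast
      moreover have "(\<Sum>j\<in>?V. \<gamma> j * ctrl ?V ?A x j (0, Some i)) = (\<Sum>j\<in>?V. (if i = j then 1 else 0) * \<gamma> j)"
        by (intro sum.cong) (auto simp: ctrl_def)
      ultimately show ?thesis by (simp add: sum_delta_mult)
    qed
    have orth: "(\<Sum>j\<in>?W. \<gamma> j * sys_jet ?W ?A x (\<lambda>_ _. 0) k j) = 0" for k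
    proof -
      have "(\<Sum>j\<in>?W. \<gamma> j * sys_jet ?W ?A x (\<lambda>_ _. 0) k j) = (\<Sum>j\<in>?W. \<gamma> j * sys_jet ?V ?A x (\<lambda>_ _. 0) k j)"
        using VW by (intro sum.cong) auto
      also have "\<dots> = (\<Sum>j\<in>?V. \<gamma> j * sys_jet ?V ?A x (\<lambda>_ _. 0) k j)"
        using inp by (intro sum.mono_neutral_left) auto
      also have "\<dots> = (\<Sum>j\<in>?V. \<gamma> j * ctrl ?V ?A x j (k, None))"
        by (intro sum.cong) (auto simp: ctrl_def sys_jet_no_input)
      also have "\<dots> = 0" using \<gamma> by blast
      finally show ?thesis .
    qed
    have "\<gamma> j = 0" if "j \<in> ?W" for j by (rule x[of \<gamma>, OF orth that])
    then show "\<forall>j\<in>?V. \<gamma> j = 0" using inp by (metis DiffI)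
  qed
  then show ?thesis by blast
qed

section \<open>Input-output equations\<close>

definition oc :: "dpoly \<Rightarrow> nat \<Rightarrow> nat \<Rightarrow> ratfun" where
  "oc q j k = Poly_Mapping.lookup q (Poly_Mapping.single (Output j, k) 1)"

definition ic :: "dpoly \<Rightarrow> nat \<Rightarrow> nat \<Rightarrow> ratfun" where
  "ic q i r = Poly_Mapping.lookup q (Poly_Mapping.single (Input i, r) 1)"

definition io_form :: "compartment_model \<Rightarrow> nat \<Rightarrow> ratfun \<Rightarrow> (nat \<Rightarrow> nat \<Rightarrow> ratfun) \<Rightarrow> (nat \<Rightarrow> nat \<Rightarrow> ratfun) \<Rightarrow> dpoly" where
  "io_form M D c a b = mp_const c + (\<Sum>j\<in>outputs M. \<Sum>k<D. mp_const (a j k) * mp_var (Output j, k)) +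
     (\<Sum>i\<in>inputs M. \<Sum>r<D. mp_const (b i r) * mp_var (Input i, r))"

abbreviation "io_indets M \<equiv> Output ` outputs M \<union> Input ` inputs M"

lemma dlinear_keys:
  assumes "dlinear q" "m \<in> Poly_Mapping.keys q"
  shows "m = 0 \<or> (\<exists>v. m = Poly_Mapping.single v 1)"
proof (cases "m = 0")
  case False
  then obtain v where v: "v \<in> Poly_Mapping.keys m" by (auto simp flip: keys_eq_empty)
  have le: "(\<Sum>w\<in>Poly_Mapping.keys m. Poly_Mapping.lookup m w) \<le> 1"
    using assms by (auto simp: dlinear_def)
  have split: "(\<Sum>w\<in>Poly_Mapping.keys m. Poly_Mapping.lookup m w) =
      Poly_Mapping.lookup m v + (\<Sum>w\<in>Poly_Mapping.keys m - {v}. Poly_Mapping.lookup m w)"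
    using v by (simp add: sum.remove)
  have v1: "Poly_Mapping.lookup m v \<ge> 1" using v by (simp add: in_keys_iff)
  have v_eq: "Poly_Mapping.lookup m v = 1" and rest: "(\<Sum>w\<in>Poly_Mapping.keys m - {v}. Poly_Mapping.lookup m w) = 0"
    using le split v1 by linarith+
  have "Poly_Mapping.lookup m w = Poly_Mapping.lookup (Poly_Mapping.single v 1) w" for w
  proof (cases "w \<in> Poly_Mapping.keys m - {v}")
    case True
    then show ?thesis using rest by (auto simp: lookup_single when_def)
  next
    case False
    then show ?thesis using v_eq by (cases "w = v") (simp_all add: lookup_single in_keys_iff)
  qed
  then have "m = Poly_Mapping.single v 1" by (rule poly_mapping_eqI)
  then show ?thesis by blast
qed simp

lemma dlinear_mp_vars:
  assumes "dlinear q"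
  shows "v \<in> mp_vars q \<longleftrightarrow> Poly_Mapping.lookup q (Poly_Mapping.single v 1) \<noteq> 0"
proof
  assume "v \<in> mp_vars q"
  then obtain m where m: "m \<in> Poly_Mapping.keys q" "v \<in> Poly_Mapping.keys m" by (auto simp: mp_vars_def)
  then obtain w where "m = Poly_Mapping.single w 1" using dlinear_keys[OF assms m(1)] by auto
  then have "m = Poly_Mapping.single v 1" using m(2) by simp
  then show "Poly_Mapping.lookup q (Poly_Mapping.single v 1) \<noteq> 0" using m(1) by (simp add: in_keys_iff)
next
  assume "Poly_Mapping.lookup q (Poly_Mapping.single v 1) \<noteq> 0"
  then show "v \<in> mp_vars q"
    by (auto simp: mp_vars_def in_keys_iff intro!: bexI[of _ "Poly_Mapping.single v 1"])
qed

lemma lookup_mp_const: "Poly_Mapping.lookup (mp_const c) m = (if m = 0 then c else 0)"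
  by (auto simp: mp_const_def lookup_single when_def)

lemma single_var_inject: "Poly_Mapping.single v (1::nat) = Poly_Mapping.single w 1 \<longleftrightarrow> v = w"
  by (metis keys_single singleton_inject zero_neq_one)

lemma single_var_neq_0: "Poly_Mapping.single v (1::nat) \<noteq> 0"
  by (metis keys_single keys_zero empty_iff insertI1 zero_neq_one)

context
  fixes M :: compartment_model
  assumes lcm: "linear_compartment_model M"
begin

lemma lookup_io_form:
  "Poly_Mapping.lookup (io_form M D c a b) 0 = c"
  "oc (io_form M D c a b) j k = (if j \<in> outputs M \<and> k < D then a j k else 0)"
  "ic (io_form M D c a b) i r = (if i \<in> inputs M \<and> r < D then b i r else 0)"
proof -
  note s = lookup_add lookup_sum const_mult_var lookup_mp_const lookup_single when_def single_var_neq_0[unfolded One_nat_def] single_var_inject[unfolded One_nat_def]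
  show "Poly_Mapping.lookup (io_form M D c a b) 0 = c"
    by (simp add: io_form_def s)
  have "oc (io_form M D c a b) j k = (\<Sum>j'\<in>outputs M. \<Sum>k'<D. if k' = k then (if j' = j then a j' k' else 0) else 0)"
    by (simp add: io_form_def oc_def s not_sym[OF single_var_neq_0[unfolded One_nat_def]]) (intro sum.cong refl; auto)
  also have "\<dots> = (if j \<in> outputs M \<and> k < D then a j k else 0)"
    by (cases "k < D") (simp_all add: sum.delta)
  finally show "oc (io_form M D c a b) j k = (if j \<in> outputs M \<and> k < D then a j k else 0)" .
  have "ic (io_form M D c a b) i r = (\<Sum>j'\<in>inputs M. \<Sum>k'<D. if k' = r then (if j' = i then b j' k' else 0) else 0)"
    by (simp add: io_form_def ic_def s not_sym[OF single_var_neq_0[unfolded One_nat_def]]) (intro sum.cong refl; auto)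
  also have "\<dots> = (if i \<in> inputs M \<and> r < D then b i r else 0)"
    by (cases "r < D") (simp_all add: sum.delta finite_inputs[OF lcm])
  finally show "ic (io_form M D c a b) i r = (if i \<in> inputs M \<and> r < D then b i r else 0)" .
qed

lemma keys_io_form:
  assumes "m \<in> Poly_Mapping.keys (io_form M D c a b)"
  shows "m = 0 \<or> (\<exists>v\<in>io_indets M \<times> UNIV. m = Poly_Mapping.single v 1)"
proof (rule ccontr)
  assume neg: "\<not> ?thesis"
  have 1: "Poly_Mapping.lookup (mp_const c) m = 0"
    using neg by (auto simp: mp_const_def lookup_single when_def)
  have 2: "Poly_Mapping.lookup (mp_const x * mp_var v) m = 0" if "v \<in> io_indets M \<times> UNIV" for x :: ratfun and v
    using neg that unfolding const_mult_var by (auto simp: lookup_single when_def)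
  have "Poly_Mapping.lookup (io_form M D c a b) m = 0"
    unfolding io_form_def lookup_add lookup_sum 1 by (simp add: 2)
  then show False using assms by (simp add: in_keys_iff)
qed

lemma dlinear_io_form: "dlinear (io_form M D c a b)"
  unfolding dlinear_def by (auto dest!: keys_io_form)

lemma io_form_dpoly:
  assumes "c \<in> ratfuns (npars M)" "\<And>j k. j \<in> outputs M \<Longrightarrow> a j k \<in> ratfuns (npars M)" "\<And>i r. i \<in> inputs M \<Longrightarrow> b i r \<in> ratfuns (npars M)"
  shows "io_form M D c a b \<in> dpolys M (io_indets M)"
  unfolding io_form_def
  using assms by (intro dpolys_closed dpolys_const dpolys_var) auto

lemma io_form_of_dlinear:
  assumes "dlinear q" "q \<in> dpolys M (io_indets M)" "\<And>z k. (z, k) \<in> mp_vars q \<Longrightarrow> k < D"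
  shows "q = io_form M D (Poly_Mapping.lookup q 0) (oc q) (ic q)"
proof (rule poly_mapping_eqI)
  fix m
  let ?f = "io_form M D (Poly_Mapping.lookup q 0) (oc q) (ic q)"
  have vanish: "Poly_Mapping.lookup q (Poly_Mapping.single v 1) = 0" if out: "v \<notin> io_indets M \<times> {..<D}" for v
  proof -
    have "v \<notin> mp_vars q"
    proof
      assume v: "v \<in> mp_vars q"
      then have "v \<in> io_indets M \<times> UNIV" using assms(2) unfolding dpolys_def by blast
      moreover have "snd v < D" using assms(3)[of "fst v" "snd v"] v by simp
      ultimately show False using out by (cases v) auto
    qed
    then show ?thesis using dlinear_mp_vars[OF assms(1), of v] by simp
  qed
  have lin: "Poly_Mapping.lookup q (Poly_Mapping.single v 1) = Poly_Mapping.lookup ?f (Poly_Mapping.single v 1)" for v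
  proof (cases v)
    case (Pair z k)
    show ?thesis
    proof (cases z)
      case (State i)
      have "Poly_Mapping.single v 1 \<notin> Poly_Mapping.keys ?f"
      proof
        assume "Poly_Mapping.single v 1 \<in> Poly_Mapping.keys ?f"
        from keys_io_form[OF this] single_var_neq_0[of v]
        have "\<exists>w\<in>io_indets M \<times> UNIV. Poly_Mapping.single v (1::nat) = Poly_Mapping.single w 1" by (simp only: simp_thms)
        then obtain w where "w \<in> io_indets M \<times> UNIV" "Poly_Mapping.single v (1::nat) = Poly_Mapping.single w 1" by (rule bexE)
        then show False using Pair State unfolding single_var_inject by auto
      qed
      then show ?thesis using vanish[of v] Pair State by (auto simp: in_keys_iff)
    next
      case (Output j)
      have "oc q j k = oc ?f j k"
        unfolding lookup_io_form(2) using vanish[of v] Pair Output by (auto simp: oc_def)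
      then show ?thesis by (simp only: oc_def Pair Output)
    next
      case (Input i)
      have "ic q i k = ic ?f i k"
        unfolding lookup_io_form(3) using vanish[of v] Pair Input by (auto simp: ic_def)
      then show ?thesis by (simp only: ic_def Pair Input)
    qed
  qed
  show "Poly_Mapping.lookup q m = Poly_Mapping.lookup ?f m"
  proof (cases "m = 0 \<or> (\<exists>v. m = Poly_Mapping.single v 1)")
    case True
    then show ?thesis using lin lookup_io_form(1) by auto
  next
    case False
    then have "m \<notin> Poly_Mapping.keys q" "m \<notin> Poly_Mapping.keys ?f"
      using dlinear_keys[OF assms(1)] dlinear_keys[OF dlinear_io_form] by blast+
    then show ?thesis by (simp add: in_keys_iff)
  qed
qed

lemma hom_row_of: "is_hom h \<Longrightarrow> h (row_of S A Y D a s) = row_of S (\<lambda>i j. h (A i j)) Y D (\<lambda>j k. h (a j k)) s"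
  and hom_inp_of: "is_hom h \<Longrightarrow> h (inp_of S A Y D a s r) = inp_of S (\<lambda>i j. h (A i j)) Y D (\<lambda>j k. h (a j k)) s r"
  by (simp_all add: row_of_def inp_of_def is_hom_simps hom_mpow)

text \<open>Turns membership of linear polynomials in the ideal into linear algebra. Forwards, the
  polynomial is tested on all formal trajectories. Backwards, it is a combination of the elements
  \<open>Output\<close> minus reduced form, since the row condition removes the states and the input
  condition cancels the inputs.\<close>

lemma io_form_in_I_Sigma:
  fixes D :: nat and a b :: "nat \<Rightarrow> nat \<Rightarrow> ratfun"
  assumes F: "c \<in> ratfuns (npars M)" "\<And>j k. j \<in> outputs M \<Longrightarrow> a j k \<in> ratfuns (npars M)" "\<And>i r. i \<in> inputs M \<Longrightarrow> b i r \<in> ratfuns (npars M)"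
  defines "R \<equiv> row_of (verts M) (cmat M) (outputs M) D (\<lambda>j k. a j k * ccoef M j)"
    and "N \<equiv> inp_of (verts M) (cmat M) (outputs M) D (\<lambda>j k. a j k * ccoef M j)"
  shows "io_form M D c a b \<in> I_Sigma M \<longleftrightarrow>
    c = 0 \<and> (\<forall>s\<in>verts M. R s = 0) \<and> (\<forall>i\<in>inputs M. \<forall>r<D. b i r + N i r * bcoef M i = 0)"
    (is "?L \<longleftrightarrow> ?R")
proof
  assume L: ?L
  let ?U0 = "\<lambda>_ _. 0 :: ratfun"
  have inputs_fin: "finite (inputs M)" by (rule finite_inputs[OF lcm])
  \<comment> \<open>Only the constant term of the series is compared. As \<open>x0\<close> and
    \<open>U\<close> are arbitrary, an affine form vanishing identically has zero coefficients,
    which unit vectors extract below.\<close>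
  have key: "c + (\<Sum>s\<in>verts M. R s * x0 s) + (\<Sum>i\<in>inputs M. \<Sum>r<D. (b i r + N i r * bcoef M i) * U i r) = 0" for x0 U
  proof -
    let ?w = "\<lambda>i k. if i \<in> inputs M then bcoef M i * U i k else 0"
    let ?X = "sys_jet (verts M) (cmat M) x0 ?w"
    let ?ev = "mev fps_const (seq_val (sol_seq M x0 U))"
    note hom = is_hom_simps[OF is_hom_mev[OF is_hom_fps_const, of "seq_val (sol_seq M x0 U)"]]
      mev_mp_const[OF is_hom_fps_const] mev_mp_var[OF is_hom_fps_const]
    have n0: "fps_nth (seq_val (sol_seq M x0 U) (Output j, k)) 0 = ccoef M j * ?X k j"
      "fps_nth (seq_val (sol_seq M x0 U) (Input j, k)) 0 = U j k" for j k
      by (simp_all add: seq_val_def egf_def sol_seq_def Let_def)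
    have "0 = fps_nth (?ev (io_form M D c a b)) 0"
      using I_Sigma_vanishes_on_solutions[OF lcm L] by simp
    also have "\<dots> = c + (\<Sum>j\<in>outputs M. \<Sum>k<D. a j k * ccoef M j * ?X (0 + k) j) +
        (\<Sum>i\<in>inputs M. \<Sum>r<D. b i r * U i r)"
      by (simp add: io_form_def hom fps_sum_nth n0 mult.assoc)
    also have "(\<Sum>j\<in>outputs M. \<Sum>k<D. a j k * ccoef M j * ?X (0 + k) j) =
        (\<Sum>s\<in>verts M. R s * x0 s) + (\<Sum>r<D. \<Sum>s\<in>verts M. N s r * ?w s (0 + r))"
      unfolding R_def N_def
      by (subst sys_jet_combination[OF finite_verts outputs_subset[OF lcm]]) simp
    also have "(\<Sum>r<D. \<Sum>s\<in>verts M. N s r * ?w s (0 + r)) = (\<Sum>r<D. \<Sum>i\<in>inputs M. N i r * bcoef M i * U i r)"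
      using inputs_subset[OF lcm]
      by (intro sum.cong refl sum.mono_neutral_cong_right) auto
    also have "\<dots> = (\<Sum>i\<in>inputs M. \<Sum>r<D. N i r * bcoef M i * U i r)" by (rule sum.swap)
    finally show ?thesis by (simp add: algebra_simps sum.distrib)
  qed
  have c0: "c = 0" using key[of "\<lambda>_. 0" ?U0] by simp
  moreover have "R s = 0" if "s \<in> verts M" for s
  proof -
    have "(\<Sum>t\<in>verts M. R t * (if s = t then 1 else 0)) = 0" using key[of "\<lambda>t. if s = t then 1 else 0" ?U0] c0 by simp
    moreover have "(\<Sum>t\<in>verts M. R t * (if s = t then 1 else 0)) = (\<Sum>t\<in>verts M. (if s = t then 1 else 0) * R t)"
      by (simp only: mult.commute)
    ultimately show ?thesis using sum_delta_mult[OF finite_verts that, of R] by simp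
  qed
  moreover have "b i r + N i r * bcoef M i = 0" if i: "i \<in> inputs M" "r < D" for i r
  proof -
    let ?B = "\<lambda>i r. b i r + N i r * bcoef M i"
    have "(\<Sum>j\<in>inputs M. \<Sum>k<D. ?B j k * (if j = i \<and> k = r then 1 else 0)) = 0"
      using key[of "\<lambda>_. 0" "\<lambda>j k. if j = i \<and> k = r then 1 else 0"] c0 by simp
    moreover have "(\<Sum>j\<in>inputs M. \<Sum>k<D. ?B j k * (if j = i \<and> k = r then 1 else 0)) =
        (\<Sum>j\<in>inputs M. \<Sum>k<D. if k = r then (if j = i then ?B j k else 0) else 0)"
      by (intro sum.cong refl) auto
    ultimately show ?thesis using i inputs_fin by (simp add: sum.delta)
  qed
  ultimately show ?R by blast
next
  assume R: ?R
  show ?L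
    unfolding I_Sigma_def
  proof (rule InterI, elim CollectE conjE)
    fix I assume I: "differential_ideal (dpolys M (all_indets M)) I"
      and gens: "state_eq M ` verts M \<union> output_eq M ` outputs M \<subseteq> I"
    define w :: "nat \<Rightarrow> nat \<Rightarrow> dpoly" where "w = (\<lambda>i k. if i \<in> inputs M then mp_const (bcoef M i) * mp_var (Input i, k) else 0)"
    define L where "L = sys_jet (verts M) (\<lambda>i j. mp_const (cmat M i j)) (\<lambda>i. mp_var (State i, 0)) w"
    have out: "mp_var (Output i, k) - mp_const (ccoef M i) * L k i \<in> I" if "i \<in> outputs M" for i k
      using var_minus_jet_in_ideal(2)[OF lcm I gens that] unfolding L_def w_def .
    have I0: "0 \<in> I" and Iadd: "\<And>p q. p \<in> I \<Longrightarrow> q \<in> I \<Longrightarrow> p + q \<in> I"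
      and Imult: "\<And>r p. r \<in> dpolys M (all_indets M) \<Longrightarrow> p \<in> I \<Longrightarrow> r * p \<in> I"
      using I by (auto simp: differential_ideal_def)
    have Isum: "(\<And>a. a \<in> A \<Longrightarrow> f a \<in> I) \<Longrightarrow> sum f A \<in> I" for f :: "nat \<Rightarrow> _" and A
      by (induction A rule: infinite_finite_induct) (auto simp: I0 Iadd)
    note hc = is_hom_mp_const[where 'v = "dindet \<times> nat" and 'a = ratfun]
    have "(\<Sum>j\<in>outputs M. \<Sum>k<D. mp_const (a j k * ccoef M j) * L (0 + k) j) =
        (\<Sum>s\<in>verts M. mp_const (R s) * L 0 s) + (\<Sum>r<D. \<Sum>s\<in>verts M. mp_const (N s r) * w s (0 + r))"
      unfolding R_def N_def L_def hom_row_of[OF hc] hom_inp_of[OF hc]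
      by (rule sys_jet_combination[OF finite_verts outputs_subset[OF lcm]])
    also have "(\<Sum>s\<in>verts M. mp_const (R s) * L 0 s) = 0" using R by simp
    also have "(\<Sum>r<D. \<Sum>s\<in>verts M. mp_const (N s r) * w s (0 + r)) =
        (\<Sum>r<D. \<Sum>i\<in>inputs M. mp_const (N i r * bcoef M i) * mp_var (Input i, r))"
      using inputs_subset[OF lcm] unfolding w_def
      by (intro sum.cong refl sum.mono_neutral_cong_right) (auto simp: is_hom_mult[OF hc])
    also have "\<dots> = (\<Sum>i\<in>inputs M. \<Sum>r<D. mp_const (N i r * bcoef M i) * mp_var (Input i, r))" by (rule sum.swap)
    also have "\<dots> = - (\<Sum>i\<in>inputs M. \<Sum>r<D. mp_const (b i r) * mp_var (Input i, r))"
      unfolding sum_negf[symmetric]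
    proof (intro sum.cong refl)
      fix i r assume "i \<in> inputs M" "r \<in> {..<D}"
      then have "N i r * bcoef M i = - b i r" using R by (simp add: eq_neg_iff_add_eq_0 add.commute)
      then show "mp_const (N i r * bcoef M i) * mp_var (Input i, r) = - (mp_const (b i r) * mp_var (Input i, r) :: dpoly)"
        by (simp add: is_hom_uminus[OF hc])
    qed
    finally have eq: "(\<Sum>j\<in>outputs M. \<Sum>k<D. mp_const (a j k * ccoef M j) * L k j) =
      - (\<Sum>i\<in>inputs M. \<Sum>r<D. mp_const (b i r) * mp_var (Input i, r))" by simp
    have "(\<Sum>j\<in>outputs M. \<Sum>k<D. mp_const (a j k) * (mp_var (Output j, k) - mp_const (ccoef M j) * L k j)) \<in> I"
      using F by (intro Isum Imult out dpolys_const) auto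
    also have "(\<Sum>j\<in>outputs M. \<Sum>k<D. mp_const (a j k) * (mp_var (Output j, k) - mp_const (ccoef M j) * L k j)) =
        io_form M D c a b"
      using eq R by (simp add: io_form_def algebra_simps sum_subtractf is_hom_mult[OF hc])
    finally show "io_form M D c a b \<in> I" .
  qed
qed

end

section \<open>Existence and structure of full sets of input-output equations\<close>

lemma dord_empty: "(\<And>k. (z, k) \<notin> mp_vars q) \<Longrightarrow> dord z q = - \<infinity>"
  by (simp add: dord_def bot_ereal_def)

lemma dord_Max:
  assumes "(z, k) \<in> mp_vars q"
  shows "finite {k. (z, k) \<in> mp_vars q}" "dord z q = ereal (real (Max {k. (z, k) \<in> mp_vars q}))"
proof -
  define K where "K = {k. (z, k) \<in> mp_vars q}"
  have fin: "finite K"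
    unfolding K_def by (rule finite_subset[OF _ finite_imageI[OF finite_mp_vars[of q], of snd]]) force
  have mx: "Max K \<in> K" "\<And>k. k \<in> K \<Longrightarrow> k \<le> Max K"
    using Max_in[OF fin] Max_ge[OF fin] assms by (auto simp: K_def)
  have "Sup ((\<lambda>k. ereal (real k)) ` K) = ereal (real (Max K))"
    using mx by (intro antisym Sup_least Sup_upper) auto
  then show "finite {k. (z, k) \<in> mp_vars q}" "dord z q = ereal (real (Max {k. (z, k) \<in> mp_vars q}))"
    using fin by (auto simp: dord_def K_def)
qed

lemma dord_less: "dord z q < ereal (real n) \<longleftrightarrow> (\<forall>k. (z, k) \<in> mp_vars q \<longrightarrow> k < n)"
proof (cases "\<exists>k. (z, k) \<in> mp_vars q")
  case True
  then obtain k where k: "(z, k) \<in> mp_vars q" by blast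
  show ?thesis using Max_less_iff[OF dord_Max(1)[OF k], of n] k unfolding dord_Max(2)[OF k] by auto
qed (simp add: dord_empty)

lemma dord_eq: "dord z q = ereal (real n) \<longleftrightarrow> (z, n) \<in> mp_vars q \<and> (\<forall>k. (z, k) \<in> mp_vars q \<longrightarrow> k \<le> n)"
proof (cases "\<exists>k. (z, k) \<in> mp_vars q")
  case True
  then obtain k where k: "(z, k) \<in> mp_vars q" by blast
  show ?thesis using Max_eq_iff[OF dord_Max(1)[OF k], of n] k unfolding dord_Max(2)[OF k] by auto
qed (auto simp: dord_empty)

definition obs :: "nat set \<Rightarrow> (nat \<Rightarrow> nat \<Rightarrow> 'a::comm_ring_1) \<Rightarrow> (nat \<Rightarrow> 'a) \<Rightarrow> nat \<times> nat \<Rightarrow> nat \<Rightarrow> 'a" where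
  "obs S A c = (\<lambda>(j, k) s. c j * mpow S A k j s)"

abbreviation "obsK M \<equiv> obs (verts M) (cmat M) (ccoef M)"

lemma row_of_obs:
  assumes "finite Y" "J \<subseteq> Y \<times> {..<D}" "\<And>j k. (j, k) \<notin> J \<Longrightarrow> a j k = 0"
  shows "row_of S A Y D (\<lambda>j k. a j k * c j) s = (\<Sum>(j, k)\<in>J. a j k * obs S A c (j, k) s)"
proof -
  have "row_of S A Y D (\<lambda>j k. a j k * c j) s = (\<Sum>(j, k)\<in>Y \<times> {..<D}. a j k * obs S A c (j, k) s)"
    by (simp add: row_of_def obs_def sum.cartesian_product mult.assoc)
  also have "\<dots> = (\<Sum>(j, k)\<in>J. a j k * obs S A c (j, k) s)"
    using assms by (intro sum.mono_neutral_right) auto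
  finally show ?thesis .
qed

definition io_basis :: "(nat \<Rightarrow> nat) \<Rightarrow> (nat \<Rightarrow> nat) \<Rightarrow> nat \<Rightarrow> (nat \<times> nat) set" where
  "io_basis ys n L = {(ys l, k) | l k. l \<in> {1..L} \<and> k < n l}"

lemma finite_io_basis: "finite (io_basis ys n L)"
proof -
  have "io_basis ys n L = (\<Union>l\<in>{1..L}. (\<lambda>k. (ys l, k)) ` {..<n l})" by (auto simp: io_basis_def)
  then show ?thesis by simp
qed

text \<open>An initial segment of a full set, with its orders recorded in \<open>n\<close>, so that
  existence and independence can be proved by induction on \<open>L\<close>.\<close>

definition io_upto :: "compartment_model \<Rightarrow> (nat \<Rightarrow> nat) \<Rightarrow> (nat \<Rightarrow> dpoly) \<Rightarrow> (nat \<Rightarrow> nat) \<Rightarrow> nat \<Rightarrow> bool" where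
  "io_upto M ys p n L \<longleftrightarrow> (\<forall>l\<in>{1..L}. io_candidate M ys p l (p l) \<and>
     (\<forall>q. io_candidate M ys p l q \<longrightarrow> dord (Output (ys l)) (p l) \<le> dord (Output (ys l)) q) \<and>
     dord (Output (ys l)) (p l) = ereal (real (n l)))"

context
  fixes M :: compartment_model and ys :: "nat \<Rightarrow> nat"
  assumes lcm: "linear_compartment_model M"
    and bij: "bij_betw ys {1..nouts M} (outputs M)"
begin

lemma ys_output: "l \<in> {1..nouts M} \<Longrightarrow> ys l \<in> outputs M"
  using bij by (auto simp: bij_betw_def)

lemma ys_eq: "l \<in> {1..nouts M} \<Longrightarrow> l' \<in> {1..nouts M} \<Longrightarrow> ys l = ys l' \<longleftrightarrow> l = l'"
  by (rule inj_on_eq_iff[OF bij_betw_imp_inj_on[OF bij]])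

lemma obsK_ratfun: "j \<in> outputs M \<Longrightarrow> s \<in> verts M \<Longrightarrow> obsK M (j, k) s \<in> ratfuns (npars M)"
proof -
  have "mpow (verts M) (cmat M) k j s \<in> ratfuns (npars M)" if "j \<in> verts M" "s \<in> verts M" for j s
    using that by (induction k arbitrary: j) (auto intro!: subfield_closed[OF subfield_ratfuns] cmat_ratfun[OF lcm])
  then show "j \<in> outputs M \<Longrightarrow> s \<in> verts M \<Longrightarrow> ?thesis"
    using outputs_subset[OF lcm] ccoef_ratfun[OF lcm] unfolding obs_def
    by (auto intro!: subfield_closed[OF subfield_ratfuns])
qed

text \<open>The relation is normalised at its highest derivative of the last output.\<close>

lemma candidate_of_relation:
  assumes up: "io_upto M ys p n L" and L: "Suc L \<in> {1..nouts M}"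
    and J: "J = io_basis ys n L \<union> {ys (Suc L)} \<times> {..<K}"
    and \<gamma>: "\<And>j. j \<in> J \<Longrightarrow> \<gamma> j \<in> ratfuns (npars M)"
    and rel: "\<And>s. s \<in> verts M \<Longrightarrow> (\<Sum>j\<in>J. \<gamma> j * obsK M j s) = 0"
    and nz: "k < K" "\<gamma> (ys (Suc L), k) \<noteq> 0"
  shows "\<exists>q k0. k0 < K \<and> io_candidate M ys p (Suc L) q \<and> dord (Output (ys (Suc L))) q = ereal (real k0)"
proof -
  let ?y = "ys (Suc L)" and ?F = "ratfuns (npars M)"
  define T where "T = {k. k < K \<and> \<gamma> (?y, k) \<noteq> 0}"
  have T: "finite T" "T \<noteq> {}" using nz by (auto simp: T_def)
  define k0 where "k0 = Max T"
  have k0: "k0 < K" "\<gamma> (?y, k0) \<noteq> 0" using Max_in[OF T] by (auto simp: k0_def T_def)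
  have k0_max: "k \<le> k0" if "k < K" "\<gamma> (?y, k) \<noteq> 0" for k
    using Max_ge[OF T(1), of k] that by (auto simp: k0_def T_def)
  have finJ: "finite J" unfolding J by (simp add: finite_io_basis)
  then have "finite (snd ` J)" by simp
  then obtain D where D: "\<And>k. k \<in> snd ` J \<Longrightarrow> k < D" using finite_nat_set_iff_bounded by metis
  define a where "a j k = (if (j, k) \<in> J then \<gamma> (j, k) / \<gamma> (?y, k0) else 0)" for j k
  \<comment> \<open>Forced by \<open>io_form_in_I_Sigma\<close>: the input part has to cancel what
    the output part contributes.\<close>
  define b where "b i r = - (inp_of (verts M) (cmat M) (outputs M) D (\<lambda>j k. a j k * ccoef M j) i r * bcoef M i)" for i r
  let ?q = "io_form M D 0 a b"
  have y0: "(?y, k0) \<in> J" using k0(1) by (simp add: J)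
  have aF: "a j k \<in> ?F" for j k
    using \<gamma> y0 by (auto simp: a_def intro!: subfield_closed[OF subfield_ratfuns])
  have J_sub: "J \<subseteq> outputs M \<times> {..<D}"
  proof
    fix x assume x: "x \<in> J"
    then have "fst x \<in> outputs M" using L ys_output by (auto simp: J io_basis_def)
    moreover have "snd x < D" using D x by blast
    ultimately show "x \<in> outputs M \<times> {..<D}" by (cases x) simp
  qed
  have mpF: "mpow (verts M) (cmat M) k j s \<in> ?F" if "j \<in> verts M" "s \<in> verts M" for k j s
    using that by (induction k arbitrary: j) (auto intro!: subfield_closed[OF subfield_ratfuns] cmat_ratfun[OF lcm])
  have bF: "b i r \<in> ?F" if "i \<in> inputs M" for i r
    unfolding b_def inp_of_def using that outputs_subset[OF lcm] inputs_subset[OF lcm]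
    by (intro subfield_closed[OF subfield_ratfuns] aF mpF bcoef_ratfun[OF lcm] ccoef_ratfun[OF lcm]) auto
  have R0: "row_of (verts M) (cmat M) (outputs M) D (\<lambda>j k. a j k * ccoef M j) s = 0" if "s \<in> verts M" for s
  proof -
    have "row_of (verts M) (cmat M) (outputs M) D (\<lambda>j k. a j k * ccoef M j) s = (\<Sum>(j, k)\<in>J. a j k * obsK M (j, k) s)"
      by (rule row_of_obs[OF finite_outputs J_sub]) (simp add: a_def)
    also have "\<dots> = (\<Sum>j\<in>J. \<gamma> j * obsK M j s) / \<gamma> (?y, k0)"
      by (auto simp: a_def sum_divide_distrib intro!: sum.cong)
    finally show ?thesis using rel[OF that] by simp
  qed
  have q_I: "?q \<in> I_Sigma M"
    using io_form_in_I_Sigma[OF lcm, of 0 a b D] aF bF R0 by (auto simp: b_def subfield_closed(1)[OF subfield_ratfuns])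
  have q_lin: "dlinear ?q" by (rule dlinear_io_form[OF lcm])
  have q_dp: "?q \<in> dpolys M (io_indets M)"
    using aF bF by (intro io_form_dpoly[OF lcm] subfield_closed(1)[OF subfield_ratfuns]) auto
  have var_out: "(Output j, k) \<in> mp_vars ?q \<longleftrightarrow> (j, k) \<in> J \<and> \<gamma> (j, k) \<noteq> 0" for j k
    using dlinear_mp_vars[OF q_lin, of "(Output j, k)"] lookup_io_form(2)[OF lcm, of D 0 a b j k] J_sub k0(2)
    by (auto simp: oc_def a_def)
  have J_y: "(?y, k) \<in> J \<longleftrightarrow> k < K" for k
    using ys_eq L by (auto simp: J io_basis_def)
  have ord: "dord (Output ?y) ?q = ereal (real k0)"
    unfolding dord_eq var_out J_y using k0 k0_max by blast
  have "io_candidate M ys p (Suc L) ?q"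
    unfolding io_candidate_def
  proof (intro conjI ballI)
    show "?q \<in> dpolys M ((\<lambda>j. Output (ys j)) ` {1..Suc L} \<union> Input ` inputs M)"
    proof -
      have "mp_vars ?q \<subseteq> ((\<lambda>j. Output (ys j)) ` {1..Suc L} \<union> Input ` inputs M) \<times> UNIV"
      proof
        fix v assume v: "v \<in> mp_vars ?q"
        then have "v \<in> io_indets M \<times> UNIV" using q_dp by (auto simp: dpolys_def)
        then consider j k where "v = (Output j, k)" | i k where "v = (Input i, k)" "i \<in> inputs M"
          by (cases v) auto
        then show "v \<in> ((\<lambda>j. Output (ys j)) ` {1..Suc L} \<union> Input ` inputs M) \<times> UNIV"
        proof cases
          case 1
          then have "(j, k) \<in> J" using v var_out by simp
          then have "j \<in> ys ` {1..Suc L}" by (auto simp: J io_basis_def)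
          then show ?thesis using 1 by auto
        qed auto
      qed
      then show ?thesis using q_dp by (auto simp: dpolys_def)
    qed
    fix l assume l: "l \<in> {1..<Suc L}"
    then have lL: "l \<in> {1..L}" by auto
    then have "dord (Output (ys l)) (p l) = ereal (real (n l))" using up by (simp add: io_upto_def)
    moreover have "dord (Output (ys l)) ?q < ereal (real (n l))"
      unfolding dord_less var_out
    proof (intro allI impI)
      fix k assume "(ys l, k) \<in> J \<and> \<gamma> (ys l, k) \<noteq> 0"
      then consider l' where "l' \<in> {1..L}" "ys l = ys l'" "k < n l'" | "ys l = ?y" by (auto simp: J io_basis_def)
      then show "k < n l"
      proof cases
        case 1
        then have "l = l'" using ys_eq[of l l'] lL L by auto
        then show ?thesis using 1 by simp
      next
        case 2
        then have "l = Suc L" using ys_eq[of l "Suc L"] lL L by auto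
        then show ?thesis using lL by simp
      qed
    qed
    ultimately show "dord (Output (ys l)) ?q < dord (Output (ys l)) (p l)" by simp
  next
    have "oc ?q ?y k0 = 1" using lookup_io_form(2)[OF lcm, of D 0 a b ?y k0] J_sub y0 k0 by (auto simp: a_def)
    then show "monic_in (Output ?y) ?q" unfolding monic_in_def oc_def using ord by blast
  qed (use q_I q_lin in auto)
  then show ?thesis using k0(1) ord by blast
qed

lemma indep_subset_relation:
  assumes ind: "indep Q J S V" and "J \<subseteq> J'" "finite J'" "\<And>j. j \<in> J' \<Longrightarrow> \<gamma> j \<in> Q"
    and "\<And>s. s \<in> S \<Longrightarrow> (\<Sum>j\<in>J'. \<gamma> j * V j s) = 0" "\<And>j. j \<in> J' - J \<Longrightarrow> \<gamma> j = 0"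
  shows "\<forall>j\<in>J'. \<gamma> j = 0"
proof -
  have eq: "(\<Sum>j\<in>J. \<gamma> j * V j s) = (\<Sum>j\<in>J'. \<gamma> j * V j s)" for s
    using assms(2,3,6) by (intro sum.mono_neutral_left) auto
  have "\<gamma> j = 0" if "j \<in> J" for j
  proof (rule indepD[OF ind, of \<gamma>, OF _ _ that])
    show "\<gamma> i \<in> Q" if "i \<in> J" for i using assms(2,4) that by blast
    show "(\<Sum>j\<in>J. \<gamma> j * V j s) = 0" if "s \<in> S" for s unfolding eq by (rule assms(5)[OF that])
  qed
  with assms(6) show ?thesis by blast
qed

text \<open>A relation that involves the newest output would yield a candidate of order below
  \<open>n (Suc L)\<close>, against minimality; any other relation lives in the previous
  basis.\<close>

lemma io_basis_indep:
  assumes "io_upto M ys p n L" "L \<le> nouts M"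
  shows "indep (ratfuns (npars M)) (io_basis ys n L) (verts M) (obsK M)"
  using assms
proof (induction L)
  case 0
  then show ?case by (simp add: indep_def io_basis_def)
next
  case (Suc L)
  let ?J = "io_basis ys n (Suc L)"
  have "{1..L} \<subseteq> {1..Suc L}" by auto
  then have up: "io_upto M ys p n L" using Suc.prems(1) unfolding io_upto_def by blast
  have SL: "Suc L \<in> {1..nouts M}" using Suc.prems(2) by simp
  have IH: "indep (ratfuns (npars M)) (io_basis ys n L) (verts M) (obsK M)" using Suc.IH up Suc.prems by simp
  have J: "?J = io_basis ys n L \<union> {ys (Suc L)} \<times> {..<n (Suc L)}"
    by (auto simp: io_basis_def le_Suc_eq)
  show ?case
    unfolding indep_def
  proof (intro allI impI, elim conjE)
    fix \<gamma> assume \<gamma>: "\<forall>j\<in>?J. \<gamma> j \<in> ratfuns (npars M)" "\<forall>s\<in>verts M. (\<Sum>j\<in>?J. \<gamma> j * obsK M j s) = 0"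
    have "\<gamma> (ys (Suc L), k) = 0" if k: "k < n (Suc L)" for k
    proof (rule ccontr)
      assume "\<gamma> (ys (Suc L), k) \<noteq> 0"
      then obtain q k0 where q: "k0 < n (Suc L)" "io_candidate M ys p (Suc L) q"
        "dord (Output (ys (Suc L))) q = ereal (real k0)"
        using candidate_of_relation[OF up SL J, of \<gamma> k] \<gamma> k by blast
      then have "ereal (real (n (Suc L))) \<le> ereal (real k0)"
        using Suc.prems(1) unfolding io_upto_def by (metis atLeastAtMost_iff le_add1 order_refl plus_1_eq_Suc)
      then show False using q(1) by simp
    qed
    then show "\<forall>j\<in>?J. \<gamma> j = 0"
      using \<gamma> J by (intro indep_subset_relation[OF IH _ finite_io_basis]) auto
  qed
qed

text \<open>One more row of the new output than the dimension of the state space forces a relation.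
  The earlier rows are independent, so it involves the new output and yields a candidate; one of
  least order is taken.\<close>

lemma io_upto_exists: "L \<le> nouts M \<Longrightarrow> \<exists>p n. io_upto M ys p n L"
proof (induction L)
  case 0
  show ?case by (simp add: io_upto_def)
next
  case (Suc L)
  then obtain p n where up: "io_upto M ys p n L" by auto
  have SL: "Suc L \<in> {1..nouts M}" using Suc.prems by simp
  let ?y = "ys (Suc L)" and ?B = "io_basis ys n L" and ?F = "ratfuns (npars M)"
  let ?K = "Suc (card (verts M))"
  let ?J = "?B \<union> {?y} \<times> {..<?K}"
  have "card ({?y} \<times> {..<?K}) = ?K" by (simp add: card_cartesian_product)
  then have card: "card (verts M) < card ?J"
    using card_mono[of ?J "{?y} \<times> {..<?K}"] finite_io_basis by auto
  have JF: "obsK M j s \<in> ?F" if "j \<in> ?J" "s \<in> verts M" for j s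
  proof -
    have "fst j \<in> outputs M" using that SL ys_output by (auto simp: io_basis_def)
    then show ?thesis using obsK_ratfun[of "fst j" s "snd j"] that by simp
  qed
  have "\<not> indep ?F ?J (verts M) (obsK M)"
    by (rule dependent_if_card_less[OF finite_verts _ card subfield_ratfuns JF]) (simp_all add: finite_io_basis)
  then obtain \<gamma> where \<gamma>: "\<And>j. j \<in> ?J \<Longrightarrow> \<gamma> j \<in> ?F" "\<And>s. s \<in> verts M \<Longrightarrow> (\<Sum>j\<in>?J. \<gamma> j * obsK M j s) = 0"
    "\<exists>j\<in>?J. \<gamma> j \<noteq> 0" unfolding indep_def by blast
  have "\<exists>k<?K. \<gamma> (?y, k) \<noteq> 0"
  proof (rule ccontr)
    assume "\<not> ?thesis"
    then have "\<forall>j\<in>?J. \<gamma> j = 0"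
      using \<gamma> io_basis_indep[OF up] Suc.prems
      by (intro indep_subset_relation[OF io_basis_indep[OF up]]) (auto simp: finite_io_basis)
    then show False using \<gamma>(3) by blast
  qed
  then obtain k where k: "k < ?K" "\<gamma> (?y, k) \<noteq> 0" by blast
  let ?P = "\<lambda>k. \<exists>q. io_candidate M ys p (Suc L) q \<and> dord (Output ?y) q = ereal (real k)"
  have ex: "\<exists>k. ?P k" using candidate_of_relation[OF up SL refl \<gamma>(1,2) k] by blast
  define k0 where "k0 = (LEAST k. ?P k)"
  have "?P k0" unfolding k0_def using ex by (rule LeastI_ex)
  then obtain q where q: "io_candidate M ys p (Suc L) q" "dord (Output ?y) q = ereal (real k0)" by blast
  have min: "dord (Output ?y) q \<le> dord (Output ?y) q'" if q': "io_candidate M ys p (Suc L) q'" for q'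
  proof -
    obtain k' where k': "dord (Output ?y) q' = ereal (real k')"
      using q' by (auto simp: io_candidate_def monic_in_def)
    then have "k0 \<le> k'" unfolding k0_def using q' by (intro Least_le) blast
    then show ?thesis using q(2) k' by simp
  qed
  let ?p = "p(Suc L := q)" and ?n = "n(Suc L := k0)"
  have cand: "io_candidate M ys ?p l = io_candidate M ys p l" if "l \<le> Suc L" for l
    using that by (intro ext) (auto simp: io_candidate_def)
  have "io_upto M ys ?p ?n (Suc L)"
    unfolding io_upto_def
  proof
    fix l assume l: "l \<in> {1..Suc L}"
    show "io_candidate M ys ?p l (?p l) \<and> (\<forall>q. io_candidate M ys ?p l q \<longrightarrow>
      dord (Output (ys l)) (?p l) \<le> dord (Output (ys l)) q) \<and> dord (Output (ys l)) (?p l) = ereal (real (?n l))"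
    proof (cases "l = Suc L")
      case True
      then show ?thesis using q min by (simp add: cand)
    next
      case False
      then have l': "l \<in> {1..L}" "l \<le> Suc L" using l by auto
      then show ?thesis
        using up unfolding io_upto_def cand[OF l'(2)] fun_upd_other[OF False] by blast
    qed
  qed
  then show ?case by blast
qed

end

lemma full_io_equations_exist:
  assumes "linear_compartment_model M"
  shows "\<exists>ys p. full_io_equations M ys p"
proof -
  have bij: "bij_betw (\<lambda>l. l) {1..nouts M} (outputs M)"
    by (simp add: outputs_def bij_betw_def)
  obtain p n where "io_upto M (\<lambda>l. l) p n (nouts M)"
    using io_upto_exists[OF assms bij order_refl] by blast
  then show ?thesis using bij unfolding full_io_equations_def io_upto_def by blast
qed

text \<open>The equations indexed by their leading outputs. The basis \<open>J\<close> consists of the derivatives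
  of the outputs below the orders of the equations.\<close>

lemma full_io_equations_structure:
  assumes lcm: "linear_compartment_model M" and full: "full_io_equations M ys p"
  obtains n P D where
    "(\<Union>l\<in>{1..nouts M}. Poly_Mapping.lookup (p l) ` Poly_Mapping.keys (p l)) =
      (\<Union>l\<in>outputs M. Poly_Mapping.lookup (P l) ` Poly_Mapping.keys (P l))"
    "indep (ratfuns (npars M)) {(j, k). j \<in> outputs M \<and> k < n j} (verts M) (obsK M)"
    "\<And>l. l \<in> outputs M \<Longrightarrow> P l \<in> I_Sigma M \<and> P l \<in> dpolys M (io_indets M) \<and>
      P l = io_form M D 0 (oc (P l)) (ic (P l)) \<and> oc (P l) l (n l) = 1 \<and> n l < D \<and>
      (\<forall>j k. oc (P l) j k \<noteq> 0 \<longrightarrow> j \<in> outputs M \<and> k < D \<and> (k < n j \<or> j = l \<and> k = n l))"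
proof -
  have bij: "bij_betw ys {1..nouts M} (outputs M)" using full by (simp add: full_io_equations_def)
  have cand: "io_candidate M ys p l (p l)" if "l \<in> {1..nouts M}" for l
    using full that by (simp add: full_io_equations_def)
  have "\<exists>k. dord (Output (ys l)) (p l) = ereal (real k) \<and> oc (p l) (ys l) k = 1" if "l \<in> {1..nouts M}" for l
    using cand[OF that] by (auto simp: io_candidate_def monic_in_def oc_def)
  then obtain n where n: "\<And>l. l \<in> {1..nouts M} \<Longrightarrow> dord (Output (ys l)) (p l) = ereal (real (n l)) \<and> oc (p l) (ys l) (n l) = 1"
    by metis
  have up: "io_upto M ys p n (nouts M)"
    using full n by (simp add: io_upto_def full_io_equations_def)
  \<comment> \<open>Indexing the equations by their leading output, not by position, removes the
    ordering \<open>ys\<close> from everything that follows.\<close>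
  define inv where "inv = inv_into {1..nouts M} ys"
  have inv: "inv j \<in> {1..nouts M}" "ys (inv j) = j" if "j \<in> outputs M" for j
  proof -
    have "j \<in> ys ` {1..nouts M}" using bij that by (simp add: bij_betw_def)
    then show "inv j \<in> {1..nouts M}" "ys (inv j) = j"
      unfolding inv_def by (rule inv_into_into, rule f_inv_into_f)
  qed
  have inv_ys: "inv (ys l) = l" if "l \<in> {1..nouts M}" for l
    using bij that by (auto simp: inv_def bij_betw_def)
  have fin: "finite (\<Union>l\<in>{1..nouts M}. snd ` mp_vars (p l))" by (simp add: finite_mp_vars)
  then obtain D where D: "\<And>k. k \<in> (\<Union>l\<in>{1..nouts M}. snd ` mp_vars (p l)) \<Longrightarrow> k < D"
    using finite_nat_set_iff_bounded by metis
  show thesis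
  proof (rule that[of "\<lambda>j. p (inv j)" "\<lambda>j. n (inv j)" D])
    have "inv ` outputs M = {1..nouts M}"
    proof
      show "inv ` outputs M \<subseteq> {1..nouts M}" using inv(1) by blast
      show "{1..nouts M} \<subseteq> inv ` outputs M"
      proof
        fix l assume l: "l \<in> {1..nouts M}"
        from imageI[OF ys_output[OF lcm bij l], of inv] show "l \<in> inv ` outputs M" unfolding inv_ys[OF l] .
      qed
    qed
    note inv_img = this
    show "(\<Union>l\<in>{1..nouts M}. Poly_Mapping.lookup (p l) ` Poly_Mapping.keys (p l)) =
      (\<Union>l\<in>outputs M. Poly_Mapping.lookup (p (inv l)) ` Poly_Mapping.keys (p (inv l)))"
      unfolding inv_img[symmetric] by (simp only: UN_simps)
    have "{(j, k). j \<in> outputs M \<and> k < n (inv j)} = io_basis ys n (nouts M)"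
    proof (intro equalityI subsetI)
      fix x assume "x \<in> {(j, k). j \<in> outputs M \<and> k < n (inv j)}"
      then obtain j k where "x = (j, k)" "j \<in> outputs M" "k < n (inv j)" by blast
      then show "x \<in> io_basis ys n (nouts M)" unfolding io_basis_def using inv[of j] by force
    next
      fix x assume "x \<in> io_basis ys n (nouts M)"
      then obtain l k where l: "x = (ys l, k)" "l \<in> {1..nouts M}" "k < n l" unfolding io_basis_def by blast
      then show "x \<in> {(j, k). j \<in> outputs M \<and> k < n (inv j)}"
        using ys_output[OF lcm bij l(2)] inv_ys[OF l(2)] by simp
    qed
    then show "indep (ratfuns (npars M)) {(j, k). j \<in> outputs M \<and> k < n (inv j)} (verts M) (obsK M)"
      using io_basis_indep[OF lcm bij up] by simp
    fix j assume j: "j \<in> outputs M"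
    let ?q = "p (inv j)" and ?l = "inv j"
    have l: "?l \<in> {1..nouts M}" "ys ?l = j" using inv[OF j] by auto
    have q: "?q \<in> I_Sigma M" "dlinear ?q"
      "?q \<in> dpolys M ((\<lambda>j. Output (ys j)) ` {1..?l} \<union> Input ` inputs M)"
      "\<And>l'. l' \<in> {1..<?l} \<Longrightarrow> dord (Output (ys l')) ?q < ereal (real (n l'))"
      using cand[OF l(1)] n l(1) by (auto simp: io_candidate_def)
    have dp: "?q \<in> dpolys M (io_indets M)"
    proof -
      have "(\<lambda>j. Output (ys j)) ` {1..?l} \<subseteq> Output ` outputs M"
        using ys_output[OF lcm bij] l(1) by auto
      then show ?thesis using q(3) unfolding dpolys_def by blast
    qed
    have bound: "k < D" if "(z, k) \<in> mp_vars ?q" for z k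
      using D l(1) that by force
    have form: "?q = io_form M D (Poly_Mapping.lookup ?q 0) (oc ?q) (ic ?q)"
      by (rule io_form_of_dlinear[OF lcm q(2) dp bound])
    have coF: "Poly_Mapping.lookup ?q m \<in> ratfuns (npars M)" for m using dp by (simp add: dpolys_def)
    \<comment> \<open>Linear means of total degree at most one, so a constant term is excluded only
      by membership in the ideal.\<close>
    have "Poly_Mapping.lookup ?q 0 = 0"
      using io_form_in_I_Sigma[OF lcm, of "Poly_Mapping.lookup ?q 0" "oc ?q" "ic ?q" D] q(1) form coF
      by (simp add: oc_def ic_def)
    moreover have "oc ?q j (n ?l) = 1" using n[OF l(1)] l(2) by simp
    moreover have var: "oc ?q j' k \<noteq> 0 \<longleftrightarrow> (Output j', k) \<in> mp_vars ?q" for j' k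
      using dlinear_mp_vars[OF q(2), of "(Output j', k)"] by (simp add: oc_def)
    moreover have "j' \<in> outputs M \<and> k < D \<and> (k < n (inv j') \<or> j' = j \<and> k = n ?l)" if nz: "oc ?q j' k \<noteq> 0" for j' k
    proof -
      have v: "(Output j', k) \<in> mp_vars ?q" using nz var by blast
      then obtain l' where l': "l' \<in> {1..?l}" "j' = ys l'" using q(3) by (auto simp: dpolys_def)
      have l'm: "l' \<in> {1..nouts M}" using l' l(1) by auto
      have "k < n l' \<or> j' = j \<and> k = n ?l"
      proof (cases "l' = ?l")
        case True
        then have "k \<le> n ?l" using n[OF l(1)] v l' by (auto simp: dord_eq)
        then show ?thesis using True l l' by auto
      next
        case False
        then show ?thesis using q(4)[of l'] l' v by (auto simp: dord_less)
      qed
      then show ?thesis using l' l'm inv_ys ys_output[OF lcm bij] bound[OF v] by auto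
    qed
    moreover have "n ?l < D"
      using bound[of "Output j" "n ?l"] var[of j "n ?l"] n[OF l(1)] l(2) by simp
    ultimately show "?q \<in> I_Sigma M \<and> ?q \<in> dpolys M (io_indets M) \<and>
      ?q = io_form M D 0 (oc ?q) (ic ?q) \<and> oc ?q j (n ?l) = 1 \<and> n ?l < D \<and>
      (\<forall>j' k. oc ?q j' k \<noteq> 0 \<longrightarrow> j' \<in> outputs M \<and> k < D \<and> (k < n (inv j') \<or> j' = j \<and> k = n ?l))"
      using q(1) dp form by auto
  qed
qed

section \<open>Relations among the jets of inputs and states\<close>

text \<open>Stated for the jets at all shifts \<open>t\<close>, which amounts to asking that no
  nontrivial homogeneous linear differential relation with constant coefficients and orders below
  \<open>D\<close> hold among the inputs as germs.\<close>

definition input_generic :: "nat set \<Rightarrow> (nat \<Rightarrow> nat \<Rightarrow> complex) \<Rightarrow> nat \<Rightarrow> bool" where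
  "input_generic I U D \<longleftrightarrow> (\<forall>\<epsilon>. (\<forall>t. (\<Sum>i\<in>I. \<Sum>k<D. \<epsilon> i k * U i (t + k)) = 0) \<longrightarrow> (\<forall>i\<in>I. \<forall>k<D. \<epsilon> i k = 0))"

fun row_iter :: "nat set \<Rightarrow> (nat \<Rightarrow> nat \<Rightarrow> complex) \<Rightarrow> (nat \<Rightarrow> complex) \<Rightarrow> nat \<Rightarrow> nat \<Rightarrow> complex" where
  "row_iter S A \<Gamma> 0 s = \<Gamma> s"
| "row_iter S A \<Gamma> (Suc m) s = (\<Sum>r\<in>S. row_iter S A \<Gamma> m r * A r s)"

lemma row_iter_mpow:
  assumes "finite S" "s \<in> S"
  shows "row_iter S A \<Gamma> m s = (\<Sum>j\<in>S. \<Gamma> j * mpow S A m j s)"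
  using assms(2)
proof (induction m arbitrary: s)
  case 0
  have "(\<Sum>j\<in>S. \<Gamma> j * (if j = s then 1 else 0)) = (\<Sum>j\<in>S. (if s = j then 1 else 0) * \<Gamma> j)"
    by (intro sum.cong) auto
  then show ?case using sum_delta_mult[OF assms(1) 0, of \<Gamma>] by simp
next
  case (Suc m)
  have "row_iter S A \<Gamma> (Suc m) s = (\<Sum>r\<in>S. (\<Sum>j\<in>S. \<Gamma> j * mpow S A m j r) * A r s)"
    using Suc.IH by simp
  also have "\<dots> = (\<Sum>j\<in>S. \<Gamma> j * (\<Sum>r\<in>S. mpow S A m j r * A r s))"
    by (simp add: sum_distrib_left sum_distrib_right mult.assoc) (rule sum.swap)
  also have "\<dots> = (\<Sum>j\<in>S. \<Gamma> j * mpow S A (Suc m) j s)"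
    by (intro sum.cong refl) (simp only: mpow_Suc_right[OF assms(1) _ Suc.prems])
  finally show ?case .
qed

locale driven_system =
  fixes S I :: "nat set" and A :: "nat \<Rightarrow> nat \<Rightarrow> complex" and b x0 :: "nat \<Rightarrow> complex"
    and U :: "nat \<Rightarrow> nat \<Rightarrow> complex"
  assumes fin: "finite S" and I: "I \<subseteq> S"
begin

abbreviation "X \<equiv> sys_jet S A x0 (\<lambda>i k. if i \<in> I then b i * U i k else 0)"

lemma row_step:
  "(\<Sum>s\<in>S. (\<Sum>r\<in>S. \<Gamma> r * A r s) * X t s) = (\<Sum>s\<in>S. \<Gamma> s * X (Suc t) s) - (\<Sum>i\<in>I. \<Gamma> i * b i * U i t)"
proof -
  have "(\<Sum>s\<in>S. (\<Sum>r\<in>S. \<Gamma> r * A r s) * X t s) = (\<Sum>r\<in>S. \<Gamma> r * (\<Sum>s\<in>S. A r s * X t s))"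
    by (simp add: sum_distrib_left sum_distrib_right mult.assoc) (rule sum.swap)
  also have "\<dots> = (\<Sum>r\<in>S. \<Gamma> r * X (Suc t) r) - (\<Sum>r\<in>S. \<Gamma> r * (if r \<in> I then b r * U r t else 0))"
    by (simp add: algebra_simps sum.distrib)
  also have "(\<Sum>r\<in>S. \<Gamma> r * (if r \<in> I then b r * U r t else 0)) = (\<Sum>i\<in>I. \<Gamma> i * b i * U i t)"
    using fin I by (intro sum.mono_neutral_cong_right) auto
  finally show ?thesis .
qed

text \<open>Multiplying by \<open>A\<close> shifts the input coefficients; a linear dependence among the iterates of the
  row then shows that the leading input coefficient vanishes.\<close>

lemma input_coefficients_vanish:
  assumes rel: "\<And>t. (\<Sum>s\<in>S. \<Gamma> s * X t s) = (\<Sum>i\<in>I. \<Sum>k<D. \<delta> i k * U i (t + k))"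
    and gen: "input_generic I U D'" and D': "D + card S < D'"
    and ik: "i \<in> I" "k < D"
  shows "\<delta> i k = 0"
proof -
  define d where "d i k = (if k < D then \<delta> i k else 0)" for i k
  \<comment> \<open>Coefficients of the relation for the row multiplied \<open>m\<close> times by
    \<open>A\<close>: each multiplication raises all orders by one and puts a new coefficient at
    order 0, coming from the input term of the system.\<close>
  define e where "e = rec_nat d (\<lambda>m em i k. case k of 0 \<Rightarrow> - (row_iter S A \<Gamma> m i * b i) | Suc k' \<Rightarrow> em i k')"
  have e0: "e 0 = d" and eS: "e (Suc m) i 0 = - (row_iter S A \<Gamma> m i * b i)" "e (Suc m) i (Suc k) = e m i k" for m i k
    by (simp_all add: e_def)
  have e_shift: "e m i (k + m) = d i k" for m i k
    by (induction m) (simp_all add: e0 eS)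
  have e_large: "e m i k = 0" if "k \<ge> D + m" for m i k
    using e_shift[of m i "k - m"] that by (simp add: d_def)
  have iter: "(\<Sum>s\<in>S. row_iter S A \<Gamma> m s * X t s) = (\<Sum>i\<in>I. \<Sum>k<D + m. e m i k * U i (t + k))" for m t
  proof (induction m arbitrary: t)
    case 0
    show ?case using rel[of t] by (simp add: e0 d_def)
  next
    case (Suc m)
    have "(\<Sum>s\<in>S. row_iter S A \<Gamma> (Suc m) s * X t s) =
        (\<Sum>i\<in>I. \<Sum>k<D + m. e m i k * U i (Suc t + k)) - (\<Sum>i\<in>I. row_iter S A \<Gamma> m i * b i * U i t)"
      using row_step[of "row_iter S A \<Gamma> m" t] Suc.IH[of "Suc t"] by simp
    also have "\<dots> = (\<Sum>i\<in>I. (\<Sum>k<D + m. e (Suc m) i (Suc k) * U i (t + Suc k)) + e (Suc m) i 0 * U i (t + 0))"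
      by (simp add: eS sum_subtractf sum.distrib algebra_simps sum_negf)
    also have "\<dots> = (\<Sum>i\<in>I. \<Sum>k<D + Suc m. e (Suc m) i k * U i (t + k))"
      by (simp add: sum.lessThan_Suc_shift add.commute del: sum.lessThan_Suc)
    finally show ?case .
  qed
  have iter': "(\<Sum>s\<in>S. row_iter S A \<Gamma> m s * X t s) = (\<Sum>i\<in>I. \<Sum>k<D'. e m i k * U i (t + k))" if "m \<le> card S" for m t
  proof -
    have "(\<Sum>k<D + m. e m i k * U i (t + k)) = (\<Sum>k<D'. e m i k * U i (t + k))" for i
      using that D' e_large[of m] by (intro sum.mono_neutral_left) auto
    then show ?thesis unfolding iter by simp
  qed
  \<comment> \<open>There are \<open>card S + 1\<close> iterates of a row with \<open>card S\<close>
    entries. Their dependence eliminates the state and leaves a relation among the inputs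
    alone.\<close>
  have "\<not> indep UNIV {..card S} S (row_iter S A \<Gamma>)"
    by (rule dependent_if_card_less) (auto simp: fin is_subfield_def)
  then obtain x where x: "\<And>s. s \<in> S \<Longrightarrow> (\<Sum>m\<le>card S. x m * row_iter S A \<Gamma> m s) = 0" "\<exists>m\<le>card S. x m \<noteq> 0"
    unfolding indep_def by auto
  have "(\<Sum>i\<in>I. \<Sum>k<D'. (\<Sum>m\<le>card S. x m * e m i k) * U i (t + k)) = 0" for t
  proof -
    have "(\<Sum>i\<in>I. \<Sum>k<D'. (\<Sum>m\<le>card S. x m * e m i k) * U i (t + k)) =
        (\<Sum>i\<in>I. \<Sum>m\<le>card S. x m * (\<Sum>k<D'. e m i k * U i (t + k)))"
      by (rule sum.cong[OF refl], simp add: sum_distrib_left sum_distrib_right mult.assoc) (rule sum.swap)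
    also have "\<dots> = (\<Sum>m\<le>card S. x m * (\<Sum>i\<in>I. \<Sum>k<D'. e m i k * U i (t + k)))"
      by (subst sum.swap) (simp add: sum_distrib_left)
    also have "\<dots> = (\<Sum>m\<le>card S. x m * (\<Sum>s\<in>S. row_iter S A \<Gamma> m s * X t s))"
      using iter' by (intro sum.cong) auto
    also have "\<dots> = (\<Sum>s\<in>S. (\<Sum>m\<le>card S. x m * row_iter S A \<Gamma> m s) * X t s)"
      by (simp add: sum_distrib_left sum_distrib_right mult.assoc) (rule sum.swap)
    also have "\<dots> = 0" using x(1) by simp
    finally show ?thesis .
  qed
  then have coef: "(\<Sum>m\<le>card S. x m * e m i k) = 0" if "k < D'" for k
    using gen[unfolded input_generic_def, rule_format, of "\<lambda>i k. \<Sum>m\<le>card S. x m * e m i k" i k] ik(1) that by blast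
  define m0 where "m0 = Max {m. m \<le> card S \<and> x m \<noteq> 0}"
  have fm: "finite {m. m \<le> card S \<and> x m \<noteq> 0}" "{m. m \<le> card S \<and> x m \<noteq> 0} \<noteq> {}" using x(2) by auto
  have m0: "m0 \<le> card S" "x m0 \<noteq> 0" using Max_in[OF fm] by (auto simp: m0_def)
  have m0_max: "x m = 0" if "m \<le> card S" "m > m0" for m
  proof (rule ccontr)
    assume "x m \<noteq> 0"
    then have "m \<le> m0" unfolding m0_def using fm(1) that by (intro Max_ge) auto
    then show False using that by simp
  qed
  show ?thesis
  proof (rule ccontr)
    assume nz: "\<delta> i k \<noteq> 0"
    let ?K = "{k. k < D \<and> \<delta> i k \<noteq> 0}"
    have fk: "finite ?K" "?K \<noteq> {}" using nz ik by auto
    define k0 where "k0 = Max ?K"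
    have k0: "k0 < D" "\<delta> i k0 \<noteq> 0" using Max_in[OF fk] by (auto simp: k0_def)
    have k0_max: "d i k = 0" if "k > k0" for k
    proof (rule ccontr)
      assume "d i k \<noteq> 0"
      then have "k \<le> k0" unfolding k0_def using fk(1) by (intro Max_ge) (auto simp: d_def split: if_splits)
      then show False using that by simp
    qed
    \<comment> \<open>With \<open>m0\<close> the last iterate used and \<open>k0\<close> the highest
      order present for input \<open>i\<close>, order \<open>k0 + m0\<close> receives a single
      product. It lies below \<open>D'\<close>, so that product is zero.\<close>
    have "(\<Sum>m\<le>card S. x m * e m i (k0 + m0)) = (\<Sum>m\<le>card S. if m = m0 then x m0 * d i k0 else 0)"
    proof (rule sum.cong[OF refl])
      fix m assume m: "m \<in> {..card S}"
      show "x m * e m i (k0 + m0) = (if m = m0 then x m0 * d i k0 else 0)"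
      proof (cases "m < m0")
        case True
        then have "e m i (k0 + m0) = 0"
          using e_shift[of m i "k0 + m0 - m"] k0_max[of "k0 + m0 - m"] by simp
        then show ?thesis using True by simp
      next
        case False
        then show ?thesis using m m0_max[of m] e_shift[of m0 i k0] by (cases "m = m0") auto
      qed
    qed
    also have "\<dots> = x m0 * d i k0" using m0(1) by simp
    finally have "x m0 * d i k0 = 0" using coef[of "k0 + m0"] k0(1) m0(1) D' by simp
    then show False using m0(2) k0 by (simp add: d_def)
  qed
qed

text \<open>Once the input coefficients are gone, the row annihilates the trajectory.
  Differentiating once gives a relation for the row times \<open>A\<close> with inputs of order 0
  only; its input coefficients vanish again, so the property passes to all iterates.\<close>

lemma row_is_uncontrollable:
  assumes rel: "\<And>t. (\<Sum>s\<in>S. \<Gamma> s * X t s) = (\<Sum>i\<in>I. \<Sum>k<D. \<delta> i k * U i (t + k))"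
    and gen: "input_generic I U D'" and D': "D + card S < D'" "D > 0"
  shows "(\<Sum>s\<in>S. row_iter S A \<Gamma> m s * X t s) = 0"
    and "i \<in> I \<Longrightarrow> row_iter S A \<Gamma> m i * b i = 0"
proof -
  have inp: "row_iter S A \<Gamma> m i * b i = 0" if zero: "\<And>t. (\<Sum>s\<in>S. row_iter S A \<Gamma> m s * X t s) = 0" and i: "i \<in> I" for m i
  proof -
    have "(\<Sum>s\<in>S. row_iter S A \<Gamma> (Suc m) s * X t s) =
      (\<Sum>i\<in>I. \<Sum>k<1. - (row_iter S A \<Gamma> m i * b i) * U i (t + k))" for t
      using row_step[of "row_iter S A \<Gamma> m" t] zero by (simp add: sum_negf del: sys_jet.simps)
    \<comment> \<open>The cutoff of this relation is 1, and \<open>1 + card S < D'\<close> follows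
      from \<open>D > 0\<close>.\<close>
    from input_coefficients_vanish[OF this gen _ i, of 0] D' show ?thesis by simp
  qed
  have zero: "(\<Sum>s\<in>S. row_iter S A \<Gamma> m s * X t s) = 0" for m t
  proof (induction m arbitrary: t)
    case 0
    have "\<delta> i k = 0" if "i \<in> I" "k < D" for i k
      by (rule input_coefficients_vanish[OF rel gen D'(1) that])
    then show ?case using rel[of t] by simp
  next
    case (Suc m)
    have "(\<Sum>s\<in>S. row_iter S A \<Gamma> (Suc m) s * X t s) = - (\<Sum>i\<in>I. row_iter S A \<Gamma> m i * b i * U i t)"
      using row_step[of "row_iter S A \<Gamma> m" t] Suc.IH by (simp del: sys_jet.simps)
    also have "(\<Sum>i\<in>I. row_iter S A \<Gamma> m i * b i * U i t) = 0"
      by (rule sum.neutral) (use inp[OF Suc.IH] in auto)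
    finally show ?case by simp
  qed
  show "(\<Sum>s\<in>S. row_iter S A \<Gamma> m s * X t s) = 0" by (rule zero)
  show "i \<in> I \<Longrightarrow> row_iter S A \<Gamma> m i * b i = 0" by (rule inp[OF zero])
qed

text \<open>Reducing the relation to the state gives a row that, with all its iterates, kills
  \<open>x0\<close> and the input directions. Controllability makes the row zero, independence of
  the observability rows makes \<open>\<gamma>\<close> zero, and what remains is a relation among
  inputs, excluded by genericity.\<close>

lemma output_input_relation_trivial:
  assumes Y: "Y \<subseteq> S" and J: "J \<subseteq> Y \<times> {..<D}"
    and ctrl: "indep UNIV S (UNIV \<times> insert None (Some ` I)) (ctrl S A x0)"
    and b: "\<And>i. i \<in> I \<Longrightarrow> b i \<noteq> 0"
    and obs: "indep UNIV J S (obs S A c)"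
    and gen: "input_generic I U D'" and D': "D + card S < D'" "D > 0"
    and supp: "\<And>j k. (j, k) \<notin> J \<Longrightarrow> \<gamma> j k = 0"
    and rel: "\<And>t. (\<Sum>j\<in>Y. \<Sum>k<D. \<gamma> j k * (c j * X (t + k) j)) + (\<Sum>i\<in>I. \<Sum>r<D. \<delta> i r * U i (t + r)) = 0"
  shows "\<gamma> j k = 0" and "i \<in> I \<Longrightarrow> r < D \<Longrightarrow> \<delta> i r = 0"
proof -
  let ?a = "\<lambda>j k. \<gamma> j k * c j"
  let ?G = "row_of S A Y D ?a" and ?N = "inp_of S A Y D ?a"
  have r: "(\<Sum>s\<in>S. ?G s * X t s) = (\<Sum>i\<in>I. \<Sum>k<D. - (\<delta> i k + ?N i k * b i) * U i (t + k))" for t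
  proof -
    have "(\<Sum>r<D. \<Sum>s\<in>S. ?N s r * (if s \<in> I then b s * U s (t + r) else 0)) = (\<Sum>r<D. \<Sum>i\<in>I. ?N i r * b i * U i (t + r))"
      using fin I by (intro sum.cong refl sum.mono_neutral_cong_right) auto
    also have "\<dots> = (\<Sum>i\<in>I. \<Sum>r<D. ?N i r * b i * U i (t + r))" by (rule sum.swap)
    finally have "(\<Sum>j\<in>Y. \<Sum>k<D. ?a j k * X (t + k) j) = (\<Sum>s\<in>S. ?G s * X t s) + (\<Sum>i\<in>I. \<Sum>r<D. ?N i r * b i * U i (t + r))"
      using sys_jet_combination[OF fin Y, where D = D and a = ?a and w = "\<lambda>i k. if i \<in> I then b i * U i k else 0" and t = t] by simp
    then show ?thesis using rel[of t]
      by (simp add: algebra_simps sum_subtractf sum.distrib sum_negf eq_neg_iff_add_eq_0)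
  qed
  have G0: "?G s = 0" if s: "s \<in> S" for s
  proof (rule indepD[OF ctrl, of ?G, OF _ _ s])
    fix x :: "nat \<times> nat option" assume "x \<in> UNIV \<times> insert None (Some ` I)"
    then consider m where "x = (m, None)" | m i where "x = (m, Some i)" "i \<in> I" by auto
    then show "(\<Sum>j\<in>S. ?G j * ctrl S A x0 j x) = 0"
    proof cases
      case 1
      have "(\<Sum>j\<in>S. ?G j * ctrl S A x0 j x) = (\<Sum>s\<in>S. (\<Sum>j\<in>S. ?G j * mpow S A m j s) * x0 s)"
        unfolding 1 ctrl_def by (simp add: sum_distrib_left sum_distrib_right mult.assoc) (rule sum.swap)
      also have "\<dots> = (\<Sum>s\<in>S. row_iter S A ?G m s * X 0 s)"
        using row_iter_mpow[OF fin] by (intro sum.cong) auto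
      also have "\<dots> = 0" by (rule row_is_uncontrollable(1)[OF r gen D'])
      finally show ?thesis .
    next
      case 2
      then have "i \<in> S" using I by auto
      then have "(\<Sum>j\<in>S. ?G j * ctrl S A x0 j x) = row_iter S A ?G m i"
        unfolding 2 ctrl_def by (simp add: row_iter_mpow[OF fin])
      also have "\<dots> = 0" using row_is_uncontrollable(2)[OF r gen D' 2(2), of m] b[OF 2(2)] by simp
      finally show ?thesis .
    qed
  qed simp
  have Yfin: "finite Y" using fin Y finite_subset by blast
  have "(case x of (j, k) \<Rightarrow> \<gamma> j k) = 0" if "x \<in> J" for x
  proof (rule indepD[OF obs, of "\<lambda>(j, k). \<gamma> j k", OF _ _ that])
    fix s assume "s \<in> S"
    from G0[OF this] show "(\<Sum>x\<in>J. (case x of (j, k) \<Rightarrow> \<gamma> j k) * obs S A c x s) = 0"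
      by (simp add: row_of_obs[OF Yfin J supp] split_def)
  qed simp
  then have g0: "\<gamma> j k = 0" for j k using supp[of j k] by fastforce
  then show "\<gamma> j k = 0" .
  have "?N i r = 0" for i r by (simp add: inp_of_def g0)
  then have "(\<Sum>i\<in>I. \<Sum>k<D. \<delta> i k * U i (t + k)) = 0" for t
    using rel[of t] g0 by simp
  moreover have "(\<Sum>s\<in>S. 0 * X t s) = 0" for t by simp
  ultimately show "i \<in> I \<Longrightarrow> r < D \<Longrightarrow> \<delta> i r = 0"
    using input_coefficients_vanish[where \<Gamma> = "\<lambda>_. 0" and D = D and \<delta> = \<delta> and D' = D' and i = i and k = r] gen D' by simp
qed

end

lemma input_generic_iff_indep:
  assumes "finite I"
  shows "input_generic I U D \<longleftrightarrow> indep UNIV (I \<times> {..<D}) UNIV (\<lambda>(i, k) t. U i (t + k))"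
proof -
  have eq: "(\<Sum>x\<in>I \<times> {..<D}. \<gamma> x * (case x of (i, k) \<Rightarrow> \<lambda>t. U i (t + k)) t) = (\<Sum>i\<in>I. \<Sum>k<D. \<gamma> (i, k) * U i (t + k))" for \<gamma> t
    unfolding sum.cartesian_product by (intro sum.cong) auto
  show ?thesis
  proof
    assume L: "input_generic I U D"
    show "indep UNIV (I \<times> {..<D}) UNIV (\<lambda>(i, k) t. U i (t + k))"
      unfolding indep_def eq
    proof (intro allI impI, elim conjE)
      fix \<gamma> :: "nat \<times> nat \<Rightarrow> complex" assume "\<forall>s\<in>UNIV. (\<Sum>i\<in>I. \<Sum>k<D. \<gamma> (i, k) * U i (s + k)) = 0"
      then have "\<forall>i\<in>I. \<forall>k<D. \<gamma> (i, k) = 0"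
        using L[unfolded input_generic_def, rule_format, of "\<lambda>i k. \<gamma> (i, k)"] by blast
      then show "\<forall>j\<in>I \<times> {..<D}. \<gamma> j = 0" by auto
    qed
  next
    assume R: "indep UNIV (I \<times> {..<D}) UNIV (\<lambda>(i, k) t. U i (t + k))"
    show "input_generic I U D"
      unfolding input_generic_def
    proof (intro allI impI ballI)
      fix \<epsilon> i k assume "\<forall>t. (\<Sum>i\<in>I. \<Sum>k<D. \<epsilon> i k * U i (t + k)) = 0" "i \<in> I" "k < D"
      then show "\<epsilon> i k = 0"
        using R[unfolded indep_def eq, rule_format, of "\<lambda>(i, k). \<epsilon> i k" "(i, k)"] by simp
    qed
  qed
qed

text \<open>Genericity is an independence statement about jets, so one explicit input with
  independent shifted jets yields a certificate polynomial that defines the open set. Monomials with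
  the chosen jets show that the set is nonempty.\<close>

lemma generic_inputs_exist:
  assumes "finite I"
  shows "\<exists>V\<in>zariski_analytic I. \<forall>u\<in>V. u \<in> analytic_tuples I \<and> input_generic I (\<lambda>i. jet (u i)) D"
proof -
  let ?V = "\<lambda>(i, k) t. mp_var (i, t + k) :: (nat \<times> nat, complex) mpoly"
  \<comment> \<open>Each input has a single nonzero derivative at 0. The marked orders of different
    inputs are at least \<open>D\<close> apart, so a window of length \<open>D\<close> cannot meet
    two of them.\<close>
  define z :: "nat \<times> nat \<Rightarrow> complex" where "z = (\<lambda>(i, m). if m = Suc i * D then 1 else 0)"
  have ind: "indep UNIV (I \<times> {..<D}) UNIV (\<lambda>x t. mp_eval z (?V x t))"
    unfolding indep_def
  proof (intro allI impI ballI, elim conjE)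
    fix \<gamma> :: "nat \<times> nat \<Rightarrow> complex" and x
    assume rel: "\<forall>s\<in>UNIV. (\<Sum>x\<in>I \<times> {..<D}. \<gamma> x * mp_eval z (?V x s)) = 0" and x: "x \<in> I \<times> {..<D}"
    obtain i k where ik: "x = (i, k)" "i \<in> I" "k < D" using x by auto
    \<comment> \<open>The shift for which the window meets the marked order of input
      \<open>i\<close> exactly at offset \<open>k\<close>.\<close>
    let ?t = "Suc i * D - k"
    have "(\<Sum>x\<in>I \<times> {..<D}. \<gamma> x * mp_eval z (?V x ?t)) = (\<Sum>y\<in>I \<times> {..<D}. if y = x then \<gamma> x else 0)"
    proof (rule sum.cong[OF refl])
      fix y assume "y \<in> I \<times> {..<D}"
      then obtain i' k' where y: "y = (i', k')" "i' \<in> I" "k' < D" by auto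
      have "?t + k' = Suc i' * D \<longleftrightarrow> i' = i \<and> k' = k"
      proof
        assume e: "?t + k' = Suc i' * D"
        have "\<not> i' < i"
        proof
          assume "i' < i"
          then have "Suc i' * D \<le> i * D" by (intro mult_right_mono) auto
          then show False using e ik(3) by simp
        qed
        moreover have "\<not> i < i'"
        proof
          assume "i < i'"
          then have "Suc (Suc i) * D \<le> Suc i' * D" by (intro mult_right_mono) auto
          then show False using e y(3) by simp
        qed
        ultimately show "i' = i \<and> k' = k" using e ik(3) by simp
      qed (use ik(3) in simp)
      then show "\<gamma> y * mp_eval z (?V y ?t) = (if y = x then \<gamma> x else 0)"
        using y ik by (auto simp: z_def)
    qed
    also have "\<dots> = \<gamma> x" using x assms by (simp add: sum.delta)
    finally show "\<gamma> x = 0" using rel by simp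
  qed
  have "\<exists>P\<in>polys_over UNIV (I \<times> UNIV). mp_eval z P \<noteq> 0 \<and>
    (\<forall>\<psi>::_ \<Rightarrow> complex. is_hom \<psi> \<and> \<psi> P \<noteq> 0 \<longrightarrow> indep UNIV (I \<times> {..<D}) UNIV (\<lambda>x t. \<psi> (?V x t)))"
    by (rule indep_certificate[OF _ subring_polys_over[OF subring_UNIV] is_hom_mp_eval _ _ _ ind])
      (auto simp: assms is_subfield_def intro: polys_over_var[OF subring_UNIV])
  then obtain P where P: "mp_vars P \<subseteq> I \<times> UNIV" "mp_eval z P \<noteq> 0"
    "\<And>\<psi>::_ \<Rightarrow> complex. is_hom \<psi> \<Longrightarrow> \<psi> P \<noteq> 0 \<Longrightarrow> indep UNIV (I \<times> {..<D}) UNIV (\<lambda>x t. \<psi> (?V x t))"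
    by (auto simp: polys_over_UNIV)
  let ?j = "\<lambda>u (i, k). (deriv ^^ k) (u i) (0::complex)"
  let ?U = "{u \<in> analytic_tuples I. mp_eval (?j u) P \<noteq> 0}"
  define u0 :: "nat \<Rightarrow> complex \<Rightarrow> complex" where "u0 = (\<lambda>i t. (1 / fact (Suc i * D)) * t ^ (Suc i * D))"
  have u0: "u0 i has_fps_expansion fps_const (1 / fact (Suc i * D)) * fps_X ^ (Suc i * D)" for i
    unfolding u0_def by (intro has_fps_expansion_cmult_left has_fps_expansion_fps_X_power)
  have "?j u0 = z"
    using jet_fps[OF u0] by (auto simp: fun_eq_iff jet_def z_def)
  moreover have "u0 \<in> analytic_tuples I"
    using has_fps_expansion_imp_analytic_0[OF u0] by (simp add: analytic_tuples_def)
  ultimately have "u0 \<in> ?U" using P(2) by simp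
  then have "?U \<in> zariski_analytic I" using P(1) unfolding zariski_analytic_def by blast
  moreover have "u \<in> analytic_tuples I \<and> input_generic I (\<lambda>i. jet (u i)) D" if "u \<in> ?U" for u
  proof -
    have "indep UNIV (I \<times> {..<D}) UNIV (\<lambda>x t. mp_eval (?j u) (?V x t))"
      using that by (intro P(3) is_hom_mp_eval) auto
    moreover have "(\<lambda>x t. mp_eval (?j u) (?V x t)) = (\<lambda>(i, k) t. jet (u i) (t + k))"
      by (auto simp: fun_eq_iff jet_def)
    ultimately show ?thesis using that by (simp add: input_generic_iff_indep[OF assms])
  qed
  ultimately show ?thesis by blast
qed

section \<open>Evaluating the input-output equations\<close>

lemma indep_scale:
  assumes "indep F J S (\<lambda>j s. d j * V j s)" "is_subfield F" "\<And>j. j \<in> J \<Longrightarrow> d j \<in> F" "\<And>j. j \<in> J \<Longrightarrow> d j \<noteq> 0"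
  shows "indep F J S V"
  unfolding indep_def
proof (intro allI impI ballI, elim conjE)
  fix \<gamma> j assume g: "\<forall>j\<in>J. \<gamma> j \<in> F" "\<forall>s\<in>S. (\<Sum>j\<in>J. \<gamma> j * V j s) = 0" and j: "j \<in> J"
  have "\<gamma> j / d j = 0"
  proof (rule indepD[OF assms(1), of "\<lambda>j. \<gamma> j / d j", OF _ _ j])
    show "\<gamma> j / d j \<in> F" if "j \<in> J" for j using g(1) that assms(2,3) by (intro subfield_divide) auto
    show "(\<Sum>j\<in>J. \<gamma> j / d j * (d j * V j s)) = 0" if "s \<in> S" for s
    proof -
      have "(\<Sum>j\<in>J. \<gamma> j / d j * (d j * V j s)) = (\<Sum>j\<in>J. \<gamma> j * V j s)"
        using assms(4) by (intro sum.cong) auto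
      then show ?thesis using g(2) that by simp
    qed
  qed
  then show "\<gamma> j = 0" using assms(4)[OF j] by simp
qed

lemma indep_scaled:
  assumes "indep UNIV J S V" "\<And>j. j \<in> J \<Longrightarrow> d j \<noteq> (0::'a::field)"
  shows "indep UNIV J S (\<lambda>j s. d j * V j s)"
proof (rule indep_scale[where d = "\<lambda>j. inverse (d j)"])
  show "indep UNIV J S (\<lambda>j s. inverse (d j) * (d j * V j s))"
    unfolding indep_def
  proof (intro allI impI, elim conjE)
    fix \<gamma> assume g: "\<forall>s\<in>S. (\<Sum>j\<in>J. \<gamma> j * (inverse (d j) * (d j * V j s))) = 0"
    have "(\<Sum>j\<in>J. \<gamma> j * (inverse (d j) * (d j * V j s))) = (\<Sum>j\<in>J. \<gamma> j * V j s)" for s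
      using assms(2) by (intro sum.cong) auto
    then show "\<forall>j\<in>J. \<gamma> j = 0" using assms(1) g by (auto simp: indep_def)
  qed
qed (use assms(2) in \<open>auto simp: is_subfield_def\<close>)

text \<open>Membership in \<open>Omega\<close> reduced to its real content: the entries of the
  matrix are polynomials and so regular at every point.\<close>

definition good_point :: "compartment_model \<Rightarrow> (nat \<Rightarrow> complex) \<Rightarrow> bool" where
  "good_point M \<mu> \<longleftrightarrow> (\<forall>i\<in>inputs M. rf_regular_at (npars M) (bcoef M i) \<mu>) \<and>
     (\<forall>i\<in>outputs M. rf_regular_at (npars M) (ccoef M i) \<mu>)"

definition cpoly :: "compartment_model \<Rightarrow> nat \<Rightarrow> nat \<Rightarrow> (nat, complex) mpoly" where
  "cpoly M i j = (SOME P. cmat M i j = Fract P 1 \<and> mp_vars P \<subseteq> {1..npars M})"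

text \<open>The assumptions on \<open>P\<close>, \<open>n\<close> and \<open>D\<close> are what
  \<open>full_io_equations_structure\<close> supplies, free of any ordering of the outputs.\<close>

locale io_system =
  fixes M :: compartment_model and n :: "nat \<Rightarrow> nat" and P :: "nat \<Rightarrow> dpoly" and D :: nat
  assumes lcm: "linear_compartment_model M"
    and basis: "indep (ratfuns (npars M)) {(j, k). j \<in> outputs M \<and> k < n j} (verts M) (obsK M)"
    and eqs: "\<And>l. l \<in> outputs M \<Longrightarrow> P l \<in> I_Sigma M \<and> P l \<in> dpolys M (io_indets M) \<and>
      P l = io_form M D 0 (oc (P l)) (ic (P l)) \<and> oc (P l) l (n l) = 1 \<and> n l < D \<and>
      (\<forall>j k. oc (P l) j k \<noteq> 0 \<longrightarrow> j \<in> outputs M \<and> k < D \<and> (k < n j \<or> j = l \<and> k = n l))"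
begin

abbreviation "N \<equiv> npars M"
abbreviation "V \<equiv> verts M"
abbreviation "J \<equiv> {(j, k). j \<in> outputs M \<and> k < n j}"
abbreviation "reg h \<mu> \<equiv> rf_regular_at N h \<mu>"
abbreviation "obsC \<mu> \<equiv> obs V (A_at M \<mu>) (\<lambda>j. rf_eval \<mu> (ccoef M j))"
abbreviation "obsP \<equiv> (\<lambda>(j, k) s. mpow V (cpoly M) k j s)"

definition coeffs_set :: "ratfun set" where
  "coeffs_set = (\<Union>l\<in>outputs M. Poly_Mapping.lookup (P l) ` Poly_Mapping.keys (P l))"

lemma out_V: "j \<in> outputs M \<Longrightarrow> j \<in> V"
  using outputs_subset[OF lcm] by auto

lemma eq_I: "l \<in> outputs M \<Longrightarrow> P l \<in> I_Sigma M"
  by (rule conjunct1[OF eqs])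

lemma eq_dpoly: "l \<in> outputs M \<Longrightarrow> P l \<in> dpolys M (io_indets M)"
  by (rule conjunct1[OF conjunct2[OF eqs]])

lemma eq_form: "l \<in> outputs M \<Longrightarrow> P l = io_form M D 0 (oc (P l)) (ic (P l))"
  by (rule conjunct1[OF conjunct2[OF conjunct2[OF eqs]]])

lemma eq_lead: "l \<in> outputs M \<Longrightarrow> oc (P l) l (n l) = 1"
  by (rule conjunct1[OF conjunct2[OF conjunct2[OF conjunct2[OF eqs]]]])

lemma eq_bound: "l \<in> outputs M \<Longrightarrow> n l < D"
  by (rule conjunct1[OF conjunct2[OF conjunct2[OF conjunct2[OF conjunct2[OF eqs]]]]])

lemma eq_supp:
  "l \<in> outputs M \<Longrightarrow> oc (P l) j k \<noteq> 0 \<Longrightarrow> j \<in> outputs M \<and> k < D \<and> (k < n j \<or> j = l \<and> k = n l)"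
  by (rule conjunct2[OF conjunct2[OF conjunct2[OF conjunct2[OF conjunct2[OF eqs]]]], rule_format])

lemma J_sub: "J \<subseteq> outputs M \<times> {..<D}"
  using eq_bound by (auto intro: less_trans)

lemma finite_J: "finite J"
  using J_sub finite_subset by fastforce

lemma D_pos: "D > 0"
  using eq_bound[of 1] lcm by (auto simp: linear_compartment_model_def outputs_def)

lemma coeff_ratfun: "l \<in> outputs M \<Longrightarrow> oc (P l) j k \<in> ratfuns N" "l \<in> outputs M \<Longrightarrow> ic (P l) i r \<in> ratfuns N"
  using eq_dpoly by (auto simp: dpolys_def oc_def ic_def)

lemma coeffs_ratfun: "coeffs_set \<subseteq> ratfuns N"
  using eq_dpoly by (auto simp: dpolys_def coeffs_set_def)

lemma coeffs_set_cases:
  assumes "g \<in> coeffs_set"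
  obtains l j k where "l \<in> outputs M" "g = oc (P l) j k" | l i r where "l \<in> outputs M" "i \<in> inputs M" "r < D" "g = ic (P l) i r"
proof -
  obtain l m where l: "l \<in> outputs M" "m \<in> Poly_Mapping.keys (P l)" "g = Poly_Mapping.lookup (P l) m"
    using assms by (auto simp: coeffs_set_def)
  have form: "P l = io_form M D 0 (oc (P l)) (ic (P l))" by (rule eq_form[OF l(1)])
  have m0: "m \<noteq> 0"
  proof
    assume "m = 0"
    have "Poly_Mapping.lookup (P l) 0 = 0" by (subst form) (rule lookup_io_form(1)[OF lcm])
    then show False using l(2) \<open>m = 0\<close> by (simp add: in_keys_iff)
  qed
  have mk: "m \<in> Poly_Mapping.keys (io_form M D 0 (oc (P l)) (ic (P l)))" using l(2) by (simp only: form[symmetric])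
  from keys_io_form[OF lcm mk] m0 have "\<exists>v\<in>io_indets M \<times> UNIV. m = Poly_Mapping.single v 1" by (simp only: simp_thms)
  then obtain v where v: "v \<in> io_indets M \<times> UNIV" "m = Poly_Mapping.single v 1" by (rule bexE)
  then consider j k where "v = (Output j, k)" | i r where "v = (Input i, r)" "i \<in> inputs M" by (cases v) auto
  then show thesis
  proof cases
    case 1
    then show thesis using that(1) l v by (simp add: oc_def)
  next
    case 2
    have g: "g = ic (P l) i r" using 2 l v by (simp add: ic_def)
    have "ic (P l) i r = (if i \<in> inputs M \<and> r < D then ic (P l) i r else 0)"
      by (subst form) (rule lookup_io_form(3)[OF lcm])
    moreover have "g \<noteq> 0" using l by (simp add: in_keys_iff)
    ultimately have "r < D" using g by metis
    then show thesis using that(2) l(1) 2 g by blast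
  qed
qed

lemma coeff_in_coeffs_set:
  assumes "l \<in> outputs M"
  shows "oc (P l) j k \<noteq> 0 \<Longrightarrow> oc (P l) j k \<in> coeffs_set" "ic (P l) i r \<noteq> 0 \<Longrightarrow> ic (P l) i r \<in> coeffs_set"
  unfolding coeffs_set_def oc_def ic_def
  by (rule UN_I[OF assms], rule imageI, simp add: in_keys_iff)+

lemma cpoly: "i \<in> V \<Longrightarrow> j \<in> V \<Longrightarrow> cmat M i j = Fract (cpoly M i j) 1"
  and cpoly_vars: "i \<in> V \<Longrightarrow> j \<in> V \<Longrightarrow> mp_vars (cpoly M i j) \<subseteq> {1..N}"
proof -
  assume ij: "i \<in> V" "j \<in> V"
  have "\<exists>P. cmat M i j = Fract P 1 \<and> mp_vars P \<subseteq> {1..N}"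
    using cmat_in_ratfuns[OF lcm ij] by metis
  from someI_ex[OF this] show "cmat M i j = Fract (cpoly M i j) 1" "mp_vars (cpoly M i j) \<subseteq> {1..N}"
    unfolding cpoly_def by blast+
qed

lemma A_at_cpoly: "i \<in> V \<Longrightarrow> j \<in> V \<Longrightarrow> A_at M \<mu> i j = mp_eval \<mu> (cpoly M i j)"
  unfolding A_at_def by (simp only: cpoly regular_polynomial(2)[OF cpoly_vars])

lemma mpow_cpoly_vars: "i \<in> V \<Longrightarrow> j \<in> V \<Longrightarrow> mp_vars (mpow V (cpoly M) k i j) \<subseteq> {1..N}"
proof (induction k arbitrary: i)
  case 0
  have "mp_vars (1 :: (nat, complex) mpoly) \<subseteq> {1..N}" by (rule mp_vars_closed)
  moreover have "mp_vars (0 :: (nat, complex) mpoly) \<subseteq> {1..N}" by (rule mp_vars_closed)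
  ultimately show ?case by simp
next
  case (Suc k)
  then show ?case unfolding mpow.simps by (intro mp_vars_closed cpoly_vars) auto
qed

lemma mpow_K: "i \<in> V \<Longrightarrow> mpow V (cmat M) k i j = Fract (mpow V (cpoly M) k i j) 1"
  unfolding hom_mpow[OF is_hom_Fract] by (rule mpow_cong) (rule cpoly)

lemma mpow_C: "i \<in> V \<Longrightarrow> mpow V (A_at M \<mu>) k i j = mp_eval \<mu> (mpow V (cpoly M) k i j)"
  unfolding hom_mpow[OF is_hom_mp_eval] by (rule mpow_cong) (rule A_at_cpoly)

lemma mpow_regular:
  assumes "i \<in> V" "j \<in> V"
  shows "reg (mpow V (cmat M) k i j) \<mu>" "rf_eval \<mu> (mpow V (cmat M) k i j) = mpow V (A_at M \<mu>) k i j"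
  unfolding mpow_K[OF assms(1)] mpow_C[OF assms(1)]
  by (rule regular_polynomial[OF mpow_cpoly_vars[OF assms]])+

lemma obs_regular:
  assumes "good_point M \<mu>" "j \<in> outputs M" "s \<in> V"
  shows "reg (obsK M (j, k) s) \<mu>" "rf_eval \<mu> (obsK M (j, k) s) = obsC \<mu> (j, k) s"
  using assms mpow_regular[OF out_V[OF assms(2)] assms(3)]
  by (auto simp: obs_def good_point_def regular_diff_mult)

lemma io_relations:
  assumes l: "l \<in> outputs M"
  shows "s \<in> V \<Longrightarrow> row_of V (cmat M) (outputs M) D (\<lambda>j k. oc (P l) j k * ccoef M j) s = 0"
    and "i \<in> inputs M \<Longrightarrow> r < D \<Longrightarrow>
      ic (P l) i r = - (inp_of V (cmat M) (outputs M) D (\<lambda>j k. oc (P l) j k * ccoef M j) i r * bcoef M i)"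
proof -
  have I: "io_form M D 0 (oc (P l)) (ic (P l)) \<in> I_Sigma M" by (simp only: eq_form[OF l, symmetric] eq_I[OF l])
  have "(\<forall>s\<in>V. row_of V (cmat M) (outputs M) D (\<lambda>j k. oc (P l) j k * ccoef M j) s = 0) \<and>
    (\<forall>i\<in>inputs M. \<forall>r<D. ic (P l) i r + inp_of V (cmat M) (outputs M) D (\<lambda>j k. oc (P l) j k * ccoef M j) i r * bcoef M i = 0)"
    using io_form_in_I_Sigma[OF lcm, of 0 "oc (P l)" "ic (P l)" D] I coeff_ratfun[OF l]
      subfield_closed(1)[OF subfield_ratfuns] by blast
  then show "s \<in> V \<Longrightarrow> row_of V (cmat M) (outputs M) D (\<lambda>j k. oc (P l) j k * ccoef M j) s = 0"
    "i \<in> inputs M \<Longrightarrow> r < D \<Longrightarrow>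
      ic (P l) i r = - (inp_of V (cmat M) (outputs M) D (\<lambda>j k. oc (P l) j k * ccoef M j) i r * bcoef M i)"
    by (simp_all add: eq_neg_iff_add_eq_0)
qed

definition coeffs_regular :: "(nat \<Rightarrow> complex) \<Rightarrow> bool" where
  "coeffs_regular \<mu> \<longleftrightarrow> (\<forall>g\<in>coeffs_set. reg g \<mu>)"

lemma oc_support:
  assumes "l \<in> outputs M" "(j, k) \<notin> insert (l, n l) J"
  shows "oc (P l) j k = 0"
  using eq_supp[OF assms(1), of j k] assms(2) by blast

text \<open>Equation \<open>l\<close> expresses the row \<open>(l, n l)\<close> in the basis rows.
  All these rows have entries in the local ring at \<open>\<mu>\<close> and the basis stays
  independent in the residue field, so the output coefficients lie in that ring; the input
  coefficients are polynomial expressions in them and in regular functions.\<close>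

lemma coeffs_regular_if_indep:
  assumes good: "good_point M \<mu>" and ind: "indep UNIV J V (obsC \<mu>)"
  shows "coeffs_regular \<mu>"
proof -
  have oc_reg: "reg (oc (P l) j k) \<mu>" if l: "l \<in> outputs M" for l j k
  proof -
    have e: "(\<Sum>x\<in>J. (case x of (j, k) \<Rightarrow> - oc (P l) j k) * obsK M x s) = obsK M (l, n l) s" if s: "s \<in> V" for s
    proof -
      have "0 = (\<Sum>(j, k)\<in>insert (l, n l) J. oc (P l) j k * obsK M (j, k) s)"
        using io_relations(1)[OF l s] row_of_obs[of "outputs M" "insert (l, n l) J" D "oc (P l)" V "cmat M" "ccoef M" s]
          J_sub l eq_bound[OF l] oc_support[OF l] by auto
      also have "\<dots> = oc (P l) l (n l) * obsK M (l, n l) s + (\<Sum>(j, k)\<in>J. oc (P l) j k * obsK M (j, k) s)"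
        by (subst sum.insert[OF finite_J]) auto
      finally show ?thesis
        using eq_lead[OF l] by (simp add: split_def sum_negf eq_neg_iff_add_eq_0 neg_eq_iff_add_eq_0 add.commute)
    qed
    have "\<forall>x\<in>J. (case x of (j, k) \<Rightarrow> - oc (P l) j k) \<in> regular_ring N \<mu>"
    proof (rule local_ring_coefficients[where \<epsilon> = "rf_eval \<mu>" and w = "obsK M (l, n l)", OF subring_regular_ring _ _ _ finite_J _ _ _ e])
      show "obsK M x t \<in> regular_ring N \<mu>" if "x \<in> J" "t \<in> V" for x t
        using obs_regular(1)[OF good] that by (auto simp: regular_ring_def)
      show "obsK M (l, n l) t \<in> regular_ring N \<mu>" if "t \<in> V" for t
        using obs_regular(1)[OF good l that] by (auto simp: regular_ring_def)
      have "(\<Sum>x\<in>J. \<gamma> x * rf_eval \<mu> (obsK M x t)) = (\<Sum>x\<in>J. \<gamma> x * obsC \<mu> x t)" if "t \<in> V" for \<gamma> t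
        using obs_regular(2)[OF good _ that] by (intro sum.cong) auto
      then show "indep UNIV J V (\<lambda>j t. rf_eval \<mu> (obsK M j t))"
        using ind unfolding indep_def by simp
    qed (auto simp: regular_ring_def regular_diff_mult regular_inverse)
    then have J_reg: "reg (oc (P l) j k) \<mu>" if "(j, k) \<in> J" for j k
      using that regular_closed(5)[of N "- oc (P l) j k" \<mu>] by (auto simp: regular_ring_def)
    show ?thesis
    proof (cases "(j, k) \<in> J")
      case True
      then show ?thesis by (rule J_reg)
    next
      case False
      then show ?thesis
        using oc_support[OF l, of j k] eq_lead[OF l] by (cases "(j, k) = (l, n l)") (auto simp: regular_closed)
    qed
  qed
  have ic_reg: "reg (ic (P l) i r) \<mu>" if l: "l \<in> outputs M" "i \<in> inputs M" "r < D" for l i r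
    unfolding io_relations(2)[OF l] inp_of_def
    using good inputs_subset[OF lcm] l(2)
    by (intro regular_closed oc_reg l mpow_regular) (auto simp: good_point_def out_V)
  show ?thesis
    unfolding coeffs_regular_def
  proof
    fix g assume "g \<in> coeffs_set"
    then show "reg g \<mu>" by (cases rule: coeffs_set_cases) (auto intro: oc_reg ic_reg)
  qed
qed

lemma coeff_reg:
  assumes "coeffs_regular \<mu>" "l \<in> outputs M"
  shows "reg (oc (P l) j k) \<mu>" "reg (ic (P l) i r) \<mu>"
  using assms coeff_in_coeffs_set[OF assms(2)] regular_closed(1)[of N \<mu>] unfolding coeffs_regular_def by metis+

section \<open>Output jets at a parameter point and the evaluated equations\<close>

definition out_jet :: "(nat \<Rightarrow> complex) \<Rightarrow> (nat \<Rightarrow> complex) \<Rightarrow> (nat \<Rightarrow> nat \<Rightarrow> complex) \<Rightarrow> nat \<Rightarrow> nat \<Rightarrow> complex" where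
  "out_jet x0 \<mu> U k j = rf_eval \<mu> (ccoef M j) * sys_jet V (A_at M \<mu>) x0 (w_at M \<mu> U) k j"

lemma jet_combination:
  "(\<Sum>j\<in>outputs M. \<Sum>k<D. a j k * out_jet x0 \<mu> U (t + k) j) =
    (\<Sum>s\<in>V. row_of V (A_at M \<mu>) (outputs M) D (\<lambda>j k. a j k * rf_eval \<mu> (ccoef M j)) s * sys_jet V (A_at M \<mu>) x0 (w_at M \<mu> U) t s) +
    (\<Sum>i\<in>inputs M. \<Sum>r<D. inp_of V (A_at M \<mu>) (outputs M) D (\<lambda>j k. a j k * rf_eval \<mu> (ccoef M j)) i r * rf_eval \<mu> (bcoef M i) * U i (t + r))"
proof -
  let ?N = "inp_of V (A_at M \<mu>) (outputs M) D (\<lambda>j k. a j k * rf_eval \<mu> (ccoef M j))"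
  have "(\<Sum>r<D. \<Sum>s\<in>V. ?N s r * w_at M \<mu> U s (t + r)) = (\<Sum>r<D. \<Sum>i\<in>inputs M. ?N i r * rf_eval \<mu> (bcoef M i) * U i (t + r))"
    using inputs_subset[OF lcm] unfolding w_at_def
    by (intro sum.cong refl sum.mono_neutral_cong_right) auto
  also have "\<dots> = (\<Sum>i\<in>inputs M. \<Sum>r<D. ?N i r * rf_eval \<mu> (bcoef M i) * U i (t + r))" by (rule sum.swap)
  finally show ?thesis
    using sys_jet_combination[OF finite_verts outputs_subset[OF lcm], where D = D and w = "w_at M \<mu> U" and t = t
      and A = "A_at M \<mu>" and ?x0.0 = x0 and a = "\<lambda>j k. a j k * rf_eval \<mu> (ccoef M j)"]
    by (simp add: out_jet_def mult.assoc)
qed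

text \<open>The row and input identities behind the equation are evaluated at \<open>\<mu>\<close>
  first and then applied to the numerical trajectory, so regularity at \<open>\<mu>\<close> carries
  the whole argument.\<close>

lemma io_jets:
  assumes good: "good_point M \<mu>" and cr: "coeffs_regular \<mu>" and l: "l \<in> outputs M"
  shows "(\<Sum>j\<in>outputs M. \<Sum>k<D. rf_eval \<mu> (oc (P l) j k) * out_jet x0 \<mu> U (t + k) j) +
    (\<Sum>i\<in>inputs M. \<Sum>r<D. rf_eval \<mu> (ic (P l) i r) * U i (t + r)) = 0"
proof -
  let ?a = "\<lambda>j k. rf_eval \<mu> (oc (P l) j k) * rf_eval \<mu> (ccoef M j)"
  have summand: "reg (oc (P l) j k * ccoef M j * mpow V (cmat M) m j s) \<mu>"
    "rf_eval \<mu> (oc (P l) j k * ccoef M j * mpow V (cmat M) m j s) = ?a j k * mpow V (A_at M \<mu>) m j s"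
    if "j \<in> outputs M" "s \<in> V" for j k m s
  proof -
    have c: "reg (ccoef M j) \<mu>" using good that(1) by (simp add: good_point_def)
    note oc = regular_diff_mult(3,4)[OF coeff_reg(1)[OF cr l, of j k] c]
    note m = mpow_regular[OF out_V[OF that(1)] that(2)]
    show "reg (oc (P l) j k * ccoef M j * mpow V (cmat M) m j s) \<mu>"
      "rf_eval \<mu> (oc (P l) j k * ccoef M j * mpow V (cmat M) m j s) = ?a j k * mpow V (A_at M \<mu>) m j s"
      using regular_diff_mult(3,4)[OF oc(1) m(1)[of m]] oc(2) m(2) by simp_all
  qed
  have row: "row_of V (A_at M \<mu>) (outputs M) D ?a s = 0" if s: "s \<in> V" for s
  proof -
    have "0 = rf_eval \<mu> (row_of V (cmat M) (outputs M) D (\<lambda>j k. oc (P l) j k * ccoef M j) s)"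
      using io_relations(1)[OF l s] by simp
    also have "\<dots> = row_of V (A_at M \<mu>) (outputs M) D ?a s"
      unfolding row_of_def using s by (simp add: rf_eval_sum[of _ N] regular_closed summand)
    finally show ?thesis by simp
  qed
  have inp: "inp_of V (A_at M \<mu>) (outputs M) D ?a i r * rf_eval \<mu> (bcoef M i) = - rf_eval \<mu> (ic (P l) i r)"
    if i: "i \<in> inputs M" "r < D" for i r
  proof -
    have iV: "i \<in> V" using i inputs_subset[OF lcm] by auto
    let ?N = "inp_of V (cmat M) (outputs M) D (\<lambda>j k. oc (P l) j k * ccoef M j) i r"
    have N: "reg ?N \<mu>" "rf_eval \<mu> ?N = inp_of V (A_at M \<mu>) (outputs M) D ?a i r"
      unfolding inp_of_def using iV by (simp_all add: rf_eval_sum[of _ N] regular_closed summand)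
    have b: "reg (bcoef M i) \<mu>" using good i by (simp add: good_point_def)
    have "- ic (P l) i r = ?N * bcoef M i" using io_relations(2)[OF l i] by simp
    then have "rf_eval \<mu> (- ic (P l) i r) = rf_eval \<mu> ?N * rf_eval \<mu> (bcoef M i)"
      using regular_diff_mult(4)[OF N(1) b] by simp
    moreover have "rf_eval \<mu> (- ic (P l) i r) = - rf_eval \<mu> (ic (P l) i r)"
      using regular_diff_mult(2)[of N 0 \<mu> "ic (P l) i r"] coeff_reg(2)[OF cr l] by (simp add: regular_closed)
    ultimately show ?thesis using N(2) by simp
  qed
  have "(\<Sum>s\<in>V. row_of V (A_at M \<mu>) (outputs M) D ?a s * sys_jet V (A_at M \<mu>) x0 (w_at M \<mu> U) t s) = 0"
    using row by simp
  moreover have "(\<Sum>i\<in>inputs M. \<Sum>r<D. inp_of V (A_at M \<mu>) (outputs M) D ?a i r * rf_eval \<mu> (bcoef M i) * U i (t + r)) =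
      - (\<Sum>i\<in>inputs M. \<Sum>r<D. rf_eval \<mu> (ic (P l) i r) * U i (t + r))"
    by (simp add: sum_negf[symmetric] inp)
  ultimately show ?thesis unfolding jet_combination by simp
qed

text \<open>The equation solved for its leading derivative: together with the inputs, the jets
  indexed by \<open>J\<close> determine all output jets.\<close>

lemma out_jet_recursion:
  assumes "good_point M \<mu>" "coeffs_regular \<mu>" and l: "l \<in> outputs M"
  shows "out_jet x0 \<mu> U (t + n l) l = - (\<Sum>(j, k)\<in>J. rf_eval \<mu> (oc (P l) j k) * out_jet x0 \<mu> U (t + k) j) -
    (\<Sum>i\<in>inputs M. \<Sum>r<D. rf_eval \<mu> (ic (P l) i r) * U i (t + r))"
proof -
  let ?f = "\<lambda>(j, k). rf_eval \<mu> (oc (P l) j k) * out_jet x0 \<mu> U (t + k) j"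
  have "(\<Sum>j\<in>outputs M. \<Sum>k<D. rf_eval \<mu> (oc (P l) j k) * out_jet x0 \<mu> U (t + k) j) = sum ?f (outputs M \<times> {..<D})"
    by (simp add: sum.cartesian_product)
  also have "\<dots> = sum ?f (insert (l, n l) J)"
  proof (rule sum.mono_neutral_right)
    show "insert (l, n l) J \<subseteq> outputs M \<times> {..<D}" using J_sub l eq_bound[OF l] by simp
    show "\<forall>x\<in>outputs M \<times> {..<D} - insert (l, n l) J. ?f x = 0"
    proof
      fix x assume x: "x \<in> outputs M \<times> {..<D} - insert (l, n l) J"
      obtain j k where jk: "x = (j, k)" by (cases x)
      have "oc (P l) j k = 0" using x unfolding jk by (intro oc_support[OF l]) blast
      then show "?f x = 0" by (simp add: jk)
    qed
  qed simp
  also have "\<dots> = out_jet x0 \<mu> U (t + n l) l + sum ?f J"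
    using eq_lead[OF l] by (subst sum.insert[OF finite_J]) (auto simp: regular_1(2))
  finally show ?thesis using io_jets[OF assms, of x0 U t] by (simp add: algebra_simps eq_neg_iff_add_eq_0)
qed

text \<open>Independent rows allow the jets indexed by \<open>J\<close> to be prescribed through the
  initial state; the higher ones then agree because both outputs obey the same recursion.\<close>

lemma matching_initial_state:
  assumes \<mu>: "good_point M \<mu>" "coeffs_regular \<mu>" and \<mu>': "good_point M \<mu>'" "coeffs_regular \<mu>'"
    and eq: "\<And>g. g \<in> coeffs_set \<Longrightarrow> rf_eval \<mu> g = rf_eval \<mu>' g"
    and ind: "indep UNIV J V (obsC \<mu>')"
  shows "\<exists>x0'. \<forall>j\<in>outputs M. \<forall>k. out_jet x0 \<mu> U k j = out_jet x0' \<mu>' U k j"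
proof -
  \<comment> \<open>The response from the zero state is subtracted, which leaves a linear system for
    the initial state.\<close>
  obtain x0' where x0': "\<And>j k. (j, k) \<in> J \<Longrightarrow> (\<Sum>s\<in>V. obsC \<mu>' (j, k) s * x0' s) = out_jet x0 \<mu> U k j - out_jet (\<lambda>_. 0) \<mu>' U k j"
    using indep_imp_solvable[OF finite_J finite_verts ind, of "\<lambda>(j, k). out_jet x0 \<mu> U k j - out_jet (\<lambda>_. 0) \<mu>' U k j"] by auto
  have lin: "out_jet x0' \<mu>' U k j = (\<Sum>s\<in>V. obsC \<mu>' (j, k) s * x0' s) + out_jet (\<lambda>_. 0) \<mu>' U k j" if "j \<in> outputs M" for j k
    using sys_jet_shift[OF finite_verts out_V[OF that], of "A_at M \<mu>'" x0' "w_at M \<mu>' U" 0 k]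
      sys_jet_shift[OF finite_verts out_V[OF that], of "A_at M \<mu>'" "\<lambda>_. 0" "w_at M \<mu>' U" 0 k]
    by (simp add: out_jet_def obs_def algebra_simps sum_distrib_left)
  have oc_eq: "rf_eval \<mu> (oc (P l) j k) = rf_eval \<mu>' (oc (P l) j k)" "rf_eval \<mu> (ic (P l) i r) = rf_eval \<mu>' (ic (P l) i r)"
    if "l \<in> outputs M" for l j k i r
    using coeff_in_coeffs_set[OF that] eq rf_eval_0 by metis+
  \<comment> \<open>The bound rises for all outputs at once, because the recursion for one output
    uses lower derivatives of the others.\<close>
  have step: "\<forall>j\<in>outputs M. \<forall>k<n j + t. out_jet x0 \<mu> U k j = out_jet x0' \<mu>' U k j" for t
  proof (induction t)
    case 0
    show ?case
    proof (intro ballI allI impI)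
      fix j k assume "j \<in> outputs M" "k < n j + 0"
      then show "out_jet x0 \<mu> U k j = out_jet x0' \<mu>' U k j" using lin[of j k] x0'[of j k] by simp
    qed
  next
    case (Suc t)
    show ?case
    proof (intro ballI allI impI)
      fix l k assume l: "l \<in> outputs M" and k: "k < n l + Suc t"
      show "out_jet x0 \<mu> U k l = out_jet x0' \<mu>' U k l"
      proof (cases "k < n l + t")
        case True
        then show ?thesis using Suc.IH l by blast
      next
        case False
        then have k: "k = t + n l" using k by simp
        have "(\<Sum>(j, k)\<in>J. rf_eval \<mu> (oc (P l) j k) * out_jet x0 \<mu> U (t + k) j) =
            (\<Sum>(j, k)\<in>J. rf_eval \<mu>' (oc (P l) j k) * out_jet x0' \<mu>' U (t + k) j)"
          using Suc.IH oc_eq(1)[OF l] by (intro sum.cong) auto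
        then show ?thesis
          unfolding k out_jet_recursion[OF \<mu> l] out_jet_recursion[OF \<mu>' l] oc_eq(2)[OF l] by simp
      qed
    qed
  qed
  show ?thesis
  proof (intro exI[of _ x0'] ballI allI)
    fix j k assume "j \<in> outputs M"
    then show "out_jet x0 \<mu> U k j = out_jet x0' \<mu>' U k j" using step[of "Suc k"] by simp
  qed
qed

text \<open>Nothing generic is assumed of \<open>\<mu>'\<close>: a dependence among its observability rows would be a relation
  of low order for the common output, which the genericity of the experiment at \<open>\<mu>\<close> excludes.\<close>

lemma coefficients_determined:
  assumes \<mu>: "good_point M \<mu>" and \<mu>': "good_point M \<mu>'"
    and ctrl: "indep UNIV V (ctrl_idx M) (ctrl V (A_at M \<mu>) x0)"
    and b: "\<And>i. i \<in> inputs M \<Longrightarrow> rf_eval \<mu> (bcoef M i) \<noteq> 0"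
    and obs: "indep UNIV J V (obsC \<mu>)"
    and gen: "input_generic (inputs M) U D'" and D': "D + card V < D'"
    and same: "\<And>j k. j \<in> outputs M \<Longrightarrow> out_jet x0 \<mu> U k j = out_jet x0' \<mu>' U k j"
  shows "coeffs_regular \<mu>" "coeffs_regular \<mu>'" "g \<in> coeffs_set \<Longrightarrow> rf_eval \<mu> g = rf_eval \<mu>' g"
proof -
  interpret driven_system V "inputs M" "A_at M \<mu>" "\<lambda>i. rf_eval \<mu> (bcoef M i)" x0 U
    by standard (simp_all add: inputs_subset[OF lcm])
  have w: "w_at M \<mu> U = (\<lambda>i k. if i \<in> inputs M then rf_eval \<mu> (bcoef M i) * U i k else 0)"
    by (simp add: w_at_def fun_eq_iff)
  note trivial = output_input_relation_trivial[OF outputs_subset[OF lcm] J_sub ctrl b obs gen D' D_pos,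
      folded w, folded out_jet_def]
  show 1: "coeffs_regular \<mu>" by (rule coeffs_regular_if_indep[OF \<mu> obs])
  have ind': "indep UNIV J V (obsC \<mu>')"
    unfolding indep_def
  proof (intro allI impI ballI, elim conjE)
    fix \<gamma> :: "nat \<times> nat \<Rightarrow> complex" and x
    assume \<gamma>: "\<forall>s\<in>V. (\<Sum>j\<in>J. \<gamma> j * obsC \<mu>' j s) = 0" and x: "x \<in> J"
    define a where "a j k = (if (j, k) \<in> J then \<gamma> (j, k) else 0)" for j k
    have a0: "a j k = 0" if "(j, k) \<notin> J" for j k by (simp only: a_def that if_False)
    let ?N = "inp_of V (A_at M \<mu>') (outputs M) D (\<lambda>j k. a j k * rf_eval \<mu>' (ccoef M j))"
    have row: "row_of V (A_at M \<mu>') (outputs M) D (\<lambda>j k. a j k * rf_eval \<mu>' (ccoef M j)) s = 0" if "s \<in> V" for s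
    proof -
      have "row_of V (A_at M \<mu>') (outputs M) D (\<lambda>j k. a j k * rf_eval \<mu>' (ccoef M j)) s = (\<Sum>(j, k)\<in>J. a j k * obsC \<mu>' (j, k) s)"
        by (rule row_of_obs[OF finite_outputs J_sub a0])
      also have "\<dots> = (\<Sum>x\<in>J. \<gamma> x * obsC \<mu>' x s)" by (intro sum.cong) (auto simp: a_def)
      finally show ?thesis using \<gamma> that by simp
    qed
    have rel: "(\<Sum>j\<in>outputs M. \<Sum>k<D. a j k * out_jet x0 \<mu> U (t + k) j) +
      (\<Sum>i\<in>inputs M. \<Sum>r<D. - (?N i r * rf_eval \<mu>' (bcoef M i)) * U i (t + r)) = 0" for t
    proof -
      have "(\<Sum>j\<in>outputs M. \<Sum>k<D. a j k * out_jet x0 \<mu> U (t + k) j) = (\<Sum>j\<in>outputs M. \<Sum>k<D. a j k * out_jet x0' \<mu>' U (t + k) j)"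
        using same by simp
      also have "\<dots> = (\<Sum>i\<in>inputs M. \<Sum>r<D. ?N i r * rf_eval \<mu>' (bcoef M i) * U i (t + r))"
        unfolding jet_combination using row by simp
      finally show ?thesis by (simp add: sum_negf)
    qed
    obtain j k where jk: "x = (j, k)" by (cases x)
    have "a j k = 0" by (rule trivial(1)[OF _ a0 rel])
    then show "\<gamma> x = 0" using x jk by (simp add: a_def)
  qed
  show 2: "coeffs_regular \<mu>'" by (rule coeffs_regular_if_indep[OF \<mu>' ind'])
  have co: "rf_eval \<mu> (oc (P l) j k) - rf_eval \<mu>' (oc (P l) j k) = 0"
    "i \<in> inputs M \<Longrightarrow> r < D \<Longrightarrow> rf_eval \<mu> (ic (P l) i r) - rf_eval \<mu>' (ic (P l) i r) = 0"
    if l: "l \<in> outputs M" for l j k i r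
  proof -
    let ?a = "\<lambda>j k. rf_eval \<mu> (oc (P l) j k) - rf_eval \<mu>' (oc (P l) j k)"
    let ?d = "\<lambda>i r. rf_eval \<mu> (ic (P l) i r) - rf_eval \<mu>' (ic (P l) i r)"
    \<comment> \<open>In the difference of the two evaluated equations the leading terms, both with
      coefficient 1, cancel; the rest is supported on \<open>J\<close>.\<close>
    have supp: "?a j k = 0" if "(j, k) \<notin> J" for j k
      using oc_support[OF l, of j k] that eq_lead[OF l] by (cases "(j, k) = (l, n l)") (auto simp: regular_1(2))
    have rel: "(\<Sum>j\<in>outputs M. \<Sum>k<D. ?a j k * out_jet x0 \<mu> U (t + k) j) +
      (\<Sum>i\<in>inputs M. \<Sum>r<D. ?d i r * U i (t + r)) = 0" for t
    proof -
      have "(\<Sum>j\<in>outputs M. \<Sum>k<D. rf_eval \<mu>' (oc (P l) j k) * out_jet x0 \<mu> U (t + k) j) +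
        (\<Sum>i\<in>inputs M. \<Sum>r<D. rf_eval \<mu>' (ic (P l) i r) * U i (t + r)) = 0"
        using io_jets[OF \<mu>' 2 l, of x0' U t] same by simp
      then show ?thesis using io_jets[OF \<mu> 1 l, of x0 U t]
        by (simp add: left_diff_distrib sum_subtractf add_eq_0_iff)
    qed
    show "?a j k = 0" by (rule trivial(1)[OF _ supp rel])
    show "i \<in> inputs M \<Longrightarrow> r < D \<Longrightarrow> ?d i r = 0"
      by (rule trivial(2)[OF _ supp rel])
  qed
  show "rf_eval \<mu> g = rf_eval \<mu>' g" if "g \<in> coeffs_set"
    using that by (cases rule: coeffs_set_cases) (use co in auto)
qed

end

section \<open>Countable fields of definition\<close>

lemma countable_poly_mappings:
  assumes "countable A" "countable B"
  shows "countable {p :: 'a \<Rightarrow>\<^sub>0 'b::zero. Poly_Mapping.keys p \<subseteq> A \<and> (\<forall>x. Poly_Mapping.lookup p x \<in> B)}"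
    (is "countable ?X")
proof -
  let ?g = "\<lambda>p :: 'a \<Rightarrow>\<^sub>0 'b. (\<lambda>x. (x, Poly_Mapping.lookup p x)) ` Poly_Mapping.keys p"
  have "inj_on ?g ?X"
  proof (rule inj_onI, rule poly_mapping_eqI)
    fix p q :: "'a \<Rightarrow>\<^sub>0 'b" and x assume eq: "?g p = ?g q"
    have mem: "Poly_Mapping.lookup r x = y \<and> y \<noteq> 0 \<longleftrightarrow> (x, y) \<in> ?g r \<and> y \<noteq> 0" for r :: "'a \<Rightarrow>\<^sub>0 'b" and y
      by (auto simp: in_keys_iff)
    show "Poly_Mapping.lookup p x = Poly_Mapping.lookup q x"
      using mem[of p "Poly_Mapping.lookup p x"] mem[of q "Poly_Mapping.lookup p x"]
        mem[of q "Poly_Mapping.lookup q x"] mem[of p "Poly_Mapping.lookup q x"] eq by metis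
  qed
  moreover have "?g ` ?X \<subseteq> {F. F \<subseteq> A \<times> B \<and> finite F}" by auto
  moreover have "countable {F. F \<subseteq> A \<times> B \<and> finite F}"
    using countable_Collect_finite_subset[of "A \<times> B"] assms by (simp add: conj_commute)
  ultimately have "countable (?g ` ?X)" "inj_on ?g ?X" by (blast intro: countable_subset)+
  then show ?thesis by (rule countable_image_inj_on)
qed

lemma countable_polys_over:
  assumes "countable k" "countable V"
  shows "countable (polys_over k V)"
proof (rule countable_subset)
  let ?A = "{m :: 'b \<Rightarrow>\<^sub>0 nat. Poly_Mapping.keys m \<subseteq> V \<and> (\<forall>x. Poly_Mapping.lookup m x \<in> UNIV)}"
  show "polys_over k V \<subseteq> {p. Poly_Mapping.keys p \<subseteq> ?A \<and> (\<forall>x. Poly_Mapping.lookup p x \<in> k)}"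
    by (auto simp: polys_over_def mp_vars_def)
  show "countable {p. Poly_Mapping.keys p \<subseteq> ?A \<and> (\<forall>x. Poly_Mapping.lookup p x \<in> k)}"
    by (intro countable_poly_mappings assms) simp
qed

lemma countable_ratfuns_over:
  assumes "countable k"
  shows "countable (ratfuns_over k N)"
proof (rule countable_subset)
  show "ratfuns_over k N \<subseteq> (\<lambda>(P, Q). Fract P Q) ` (polys_over k {1..N} \<times> polys_over k {1..N})"
    by (auto simp: ratfuns_over_def)
  show "countable ((\<lambda>(P, Q). Fract P Q) ` (polys_over k {1..N} \<times> polys_over k {1..N}))"
    using countable_polys_over[OF assms, of "{1..N}"] by (intro countable_image countable_SIGMA) auto
qed

lemma countable_subring_exists:
  assumes "countable (C :: 'a::comm_ring_1 set)"
  shows "\<exists>k. countable k \<and> subring_set k \<and> C \<subseteq> k"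
proof -
  define step where "step B = B \<union> (\<lambda>(x, y). x - y) ` (B \<times> B) \<union> (\<lambda>(x, y). x * y) ` (B \<times> B)" for B :: "'a set"
  define G where "G n = (step ^^ n) (insert 1 C)" for n
  have cnt: "countable (G n)" for n
    unfolding G_def using assms by (induction n) (auto simp: step_def)
  have mono: "G m \<subseteq> G n" if "m \<le> n" for m n
    using that by (rule lift_Suc_mono_le[rotated]) (auto simp: G_def step_def)
  have "subring_set (\<Union>n. G n)"
    unfolding subring_set_def
  proof (intro conjI ballI)
    show "1 \<in> (\<Union>n. G n)" by (rule UN_I[of 0]) (auto simp: G_def)
    fix x y assume "x \<in> (\<Union>n. G n)" "y \<in> (\<Union>n. G n)"
    then obtain m n where "x \<in> G m" "y \<in> G n" by auto
    then have xy: "x \<in> G (max m n)" "y \<in> G (max m n)"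
      using mono[of m "max m n"] mono[of n "max m n"] by auto
    have "step (G (max m n)) = G (Suc (max m n))" by (simp add: G_def)
    moreover have "x - y \<in> step (G (max m n))" "x * y \<in> step (G (max m n))"
      using xy unfolding step_def by force+
    ultimately show "x - y \<in> (\<Union>n. G n)" "x * y \<in> (\<Union>n. G n)" by blast+
  qed
  moreover have "C \<subseteq> G 0" by (auto simp: G_def)
  ultimately show ?thesis using cnt by (intro exI[of _ "\<Union>n. G n"]) auto
qed

text \<open>Zero is included so that coefficients off the support are covered too.\<close>

definition poly_coeffs :: "('v, 'a::zero) mpoly \<Rightarrow> 'a set" where
  "poly_coeffs p = insert 0 (Poly_Mapping.lookup p ` Poly_Mapping.keys p)"

lemma poly_coeffs_over: "poly_coeffs p \<subseteq> k \<Longrightarrow> mp_vars p \<subseteq> V \<Longrightarrow> p \<in> polys_over k V"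
  unfolding polys_over_def poly_coeffs_def
proof (intro CollectI conjI allI)
  fix m assume "insert 0 (Poly_Mapping.lookup p ` Poly_Mapping.keys p) \<subseteq> k"
  then show "Poly_Mapping.lookup p m \<in> k"
    by (cases "m \<in> Poly_Mapping.keys p") (auto simp: in_keys_iff)
qed

lemma ratfun_field_of_definition:
  assumes "f \<in> ratfuns N"
  shows "\<exists>C. finite C \<and> (\<forall>k. C \<subseteq> k \<longrightarrow> f \<in> ratfuns_over k N)"
proof -
  obtain P Q where PQ: "f = Fract P Q" "mp_vars P \<subseteq> {1..N}" "mp_vars Q \<subseteq> {1..N}" "Q \<noteq> 0"
    using assms unfolding ratfuns_def by blast
  show ?thesis
  proof (intro exI[of _ "poly_coeffs P \<union> poly_coeffs Q"] conjI allI impI)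
    fix k assume "poly_coeffs P \<union> poly_coeffs Q \<subseteq> k"
    then have "P \<in> polys_over k {1..N}" "Q \<in> polys_over k {1..N}"
      by (simp_all add: poly_coeffs_over PQ(2,3) del: One_nat_def)
    then show "f \<in> ratfuns_over k N" unfolding ratfuns_over_def using PQ(1,4) by blast
  qed (simp add: poly_coeffs_def)
qed

section \<open>Comparison of the two fields\<close>

definition lift_poly :: "(nat, complex) mpoly \<Rightarrow> (nat + nat, complex) mpoly" where
  "lift_poly P = mev mp_const (\<lambda>v. mp_var (Inr v)) P"

lemma mp_eval_lift_poly: "mp_eval z (lift_poly P) = mp_eval (\<lambda>v. z (Inr v)) P"
  unfolding lift_poly_def hom_mev[OF is_hom_mp_eval is_hom_mp_const] by (simp add: mp_eval_eq_mev[symmetric])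

lemma lift_poly_vars:
  assumes "mp_vars P \<subseteq> V"
  shows "mp_vars (lift_poly P) \<subseteq> Inr ` V"
proof -
  have "lift_poly P \<in> polys_over UNIV (Inr ` V)"
    unfolding lift_poly_def
    by (rule mev_in_subring[OF subring_polys_over[OF subring_UNIV]])
      (use assms in \<open>auto intro!: polys_over_var[OF subring_UNIV] polys_over_const\<close>)
  then show ?thesis by (simp add: polys_over_UNIV)
qed

lemma subfield_generated:
  "is_subfield (subfield_generated_over_C S)" "rf_const c \<in> subfield_generated_over_C S"
  "S \<subseteq> subfield_generated_over_C S"
  "is_subfield F \<Longrightarrow> (\<And>c. rf_const c \<in> F) \<Longrightarrow> S \<subseteq> F \<Longrightarrow> subfield_generated_over_C S \<subseteq> F"
  unfolding subfield_generated_over_C_def by (auto simp: is_subfield_def)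

lemma subfield_Int: "is_subfield A \<Longrightarrow> is_subfield B \<Longrightarrow> is_subfield (A \<inter> B)"
  by (simp add: is_subfield_def)

lemma const_ratfun: "rf_const c \<in> ratfuns N"
  unfolding rf_const_def by (rule ratfuns_polynomial) simp

context io_system
begin

abbreviation "coeff_field \<equiv> subfield_generated_over_C coeffs_set"

lemma coeff_field_ratfun: "coeff_field \<subseteq> ratfuns N"
  by (rule subfield_generated(4)[OF subfield_ratfuns const_ratfun coeffs_ratfun])

lemma Omega_of_iff:
  "(x0, \<mu>, u) \<in> Omega_of M h \<longleftrightarrow> good_point M \<mu> \<and> reg h \<mu> \<and> u \<in> analytic_tuples (inputs M)"
  using regular_polynomial(1)[OF cpoly_vars] cpoly
  by (auto simp: Omega_of_def Omega_def good_point_def)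

lemma same_output_iff:
  assumes "u \<in> analytic_tuples (inputs M)"
  shows "same_germs (outputs M) (output_fun M x0 \<mu> u) (output_fun M x0' \<mu>' u) \<longleftrightarrow>
    (\<forall>j\<in>outputs M. \<forall>k. out_jet x0 \<mu> (\<lambda>i. jet (u i)) k j = out_jet x0' \<mu>' (\<lambda>i. jet (u i)) k j)"
  unfolding same_germs_iff_jets[OF assms outputs_subset[OF lcm]] by (simp add: out_jet_def x_jet_def)

text \<open>The factors \<open>ccoef\<close> are only rational, so they are split off; the
  certificate is formed on the polynomial rows \<open>obsP\<close>, and the factors are restored by
  rescaling at the point.\<close>

lemma observability_certificate:
  obtains Q where "mp_vars Q \<subseteq> {1..N}" "Q \<noteq> 0"
    "\<And>\<mu>. mp_eval \<mu> Q \<noteq> 0 \<Longrightarrow> (\<And>j. j \<in> outputs M \<Longrightarrow> rf_eval \<mu> (ccoef M j) \<noteq> 0) \<Longrightarrow> indep UNIV J V (obsC \<mu>)"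
proof -
  let ?d = "\<lambda>(j, k). ccoef M j"
  have K: "obsK M x s = ?d x * Fract (obsP x s) 1" if "x \<in> J" for x s
    using that mpow_K[OF out_V] by (auto simp: obs_def)
  have "(\<Sum>x\<in>J. \<gamma> x * (?d x * Fract (obsP x s) 1)) = (\<Sum>x\<in>J. \<gamma> x * obsK M x s)" for \<gamma> s
    by (intro sum.cong refl) (simp only: K)
  then have "indep (ratfuns N) J V (\<lambda>x s. ?d x * Fract (obsP x s) 1)"
    using basis unfolding indep_def by simp
  then have ind: "indep (ratfuns N) J V (\<lambda>x s. Fract (obsP x s) 1)"
    by (rule indep_scale[OF _ subfield_ratfuns]) (use ccoef_ratfun[OF lcm] ccoef_nonzero[OF lcm] in auto)
  have "\<exists>Q\<in>polys_over UNIV {1..N}. Fract Q 1 \<noteq> 0 \<and>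
    (\<forall>\<psi>::_ \<Rightarrow> complex. is_hom \<psi> \<and> \<psi> Q \<noteq> 0 \<longrightarrow> indep UNIV J V (\<lambda>x s. \<psi> (obsP x s)))"
  proof (rule indep_certificate[OF finite_J subring_polys_over[OF subring_UNIV] is_hom_Fract subfield_ratfuns _ _ ind])
    show "(\<lambda>P. Fract P 1) ` polys_over UNIV {1..N} \<subseteq> ratfuns N"
      using ratfuns_polynomial by (auto simp: polys_over_UNIV simp del: One_nat_def)
    show "obsP x s \<in> polys_over UNIV {1..N}" if "x \<in> J" "s \<in> V" for x s
      using that mpow_cpoly_vars[OF out_V] by (auto simp: polys_over_UNIV simp del: One_nat_def)
  qed
  then obtain Q where QR: "Q \<in> polys_over UNIV {1..N}" and Q0: "Fract Q 1 \<noteq> 0"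
    and Qi: "\<forall>\<psi>::_ \<Rightarrow> complex. is_hom \<psi> \<and> \<psi> Q \<noteq> 0 \<longrightarrow> indep UNIV J V (\<lambda>x s. \<psi> (obsP x s))"
    by (elim bexE conjE)
  have Q: "mp_vars Q \<subseteq> {1..N}" "Fract Q 1 \<noteq> 0"
    "is_hom \<psi> \<Longrightarrow> \<psi> Q \<noteq> 0 \<Longrightarrow> indep UNIV J V (\<lambda>x s. \<psi> (obsP x s))" for \<psi> :: "_ \<Rightarrow> complex"
    using QR[unfolded polys_over_UNIV] Q0 Qi by blast+
  show thesis
  proof (rule that[OF Q(1)])
    show "Q \<noteq> 0" using Q(2) by (auto simp: fract_collapse)
    fix \<mu> assume \<mu>: "mp_eval \<mu> Q \<noteq> 0" and c: "\<And>j. j \<in> outputs M \<Longrightarrow> rf_eval \<mu> (ccoef M j) \<noteq> 0"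
    let ?e = "\<lambda>(j, k). rf_eval \<mu> (ccoef M j)"
    have C: "obsC \<mu> x s = ?e x * mp_eval \<mu> (obsP x s)" if "x \<in> J" for x s
      using that mpow_C[OF out_V] by (auto simp: obs_def)
    have "indep UNIV J V (\<lambda>x s. ?e x * mp_eval \<mu> (obsP x s))"
      using c by (intro indep_scaled Q(3) is_hom_mp_eval \<mu>) auto
    moreover have "(\<Sum>x\<in>J. \<gamma> x * obsC \<mu> x s) = (\<Sum>x\<in>J. \<gamma> x * (?e x * mp_eval \<mu> (obsP x s)))" for \<gamma> s
      by (intro sum.cong refl) (simp only: C)
    ultimately show "indep UNIV J V (obsC \<mu>)" unfolding indep_def by simp
  qed
qed

text \<open>Treating the initial values as indeterminates makes all columns polynomial, so the
  special controllable point yields a certificate. It uses one pivot per vertex even though there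
  are infinitely many columns.\<close>

lemma controllability_certificate:
  assumes "\<And>w. w \<in> V \<Longrightarrow> \<exists>v\<in>leaks M \<union> inputs M. reachable M w v"
  obtains Q where "mp_vars Q \<subseteq> Inl ` V \<union> Inr ` {1..N}" "\<exists>z. mp_eval z Q \<noteq> 0"
    "\<And>x0 \<mu>. mp_eval (case_sum x0 \<mu>) Q \<noteq> 0 \<Longrightarrow> indep UNIV V (ctrl_idx M) (ctrl V (A_at M \<mu>) x0)"
proof -
  obtain \<mu>0 y0 where pt: "indep UNIV V (ctrl_idx M) (ctrl V (A_at M \<mu>0) y0)"
    using controllable_point_exists[OF lcm assms] by blast
  define W where "W = ctrl V (\<lambda>i j. lift_poly (cpoly M i j)) (\<lambda>i. mp_var (Inl i) :: (nat + nat, complex) mpoly)"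
  have ev: "mp_eval (case_sum x0 \<mu>) (W i c) = ctrl V (A_at M \<mu>) x0 i c" if "i \<in> V" for x0 \<mu> i c
  proof -
    have m: "mp_eval (case_sum x0 \<mu>) (mpow V (\<lambda>i j. lift_poly (cpoly M i j)) k i j) = mpow V (A_at M \<mu>) k i j" for k j
      unfolding hom_mpow[OF is_hom_mp_eval] mp_eval_lift_poly
      by (rule mpow_cong[OF _ that]) (simp add: A_at_cpoly)
    show ?thesis
      unfolding W_def ctrl_def by (auto simp: is_hom_simps[OF is_hom_mp_eval] m split: prod.split option.split)
  qed
  have ctrl_eq: "indep UNIV V (ctrl_idx M) (\<lambda>i c. mp_eval (case_sum x0 \<mu>) (W i c)) \<longleftrightarrow>
      indep UNIV V (ctrl_idx M) (ctrl V (A_at M \<mu>) x0)" for x0 \<mu>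
  proof -
    have "(\<Sum>i\<in>V. \<gamma> i * mp_eval (case_sum x0 \<mu>) (W i c)) = (\<Sum>i\<in>V. \<gamma> i * ctrl V (A_at M \<mu>) x0 i c)" for \<gamma> c
      by (intro sum.cong refl) (simp only: ev)
    then show ?thesis unfolding indep_def by simp
  qed
  let ?X = "Inl ` V \<union> Inr ` {1..N} :: (nat + nat) set"
  note cl = subring_set_closed[OF subring_polys_over[OF subring_UNIV, of ?X]]
  have mp: "mpow V (\<lambda>i j. lift_poly (cpoly M i j)) k i j \<in> polys_over UNIV ?X" if "i \<in> V" "j \<in> V" for k i j
    using that(1)
  proof (induction k arbitrary: i)
    case 0
    show ?case by (auto intro: cl simp del: One_nat_def)
  next
    case (Suc k)
    have "lift_poly (cpoly M i s) \<in> polys_over UNIV ?X" if "s \<in> V" for s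
      using lift_poly_vars[OF cpoly_vars[OF Suc.prems that]] unfolding polys_over_UNIV by blast
    then show ?case using Suc.IH unfolding mpow.simps by (intro cl) auto
  qed
  have inR: "W i c \<in> polys_over UNIV ?X" if i: "i \<in> V" and c: "c \<in> ctrl_idx M" for i c
  proof -
    consider m where "c = (m, None)" | m j where "c = (m, Some j)" "j \<in> inputs M" using c by auto
    then show ?thesis
    proof cases
      case 1
      then show ?thesis unfolding W_def ctrl_def
        using mp[OF i] by (auto intro!: cl polys_over_var[OF subring_UNIV] simp del: One_nat_def)
    next
      case 2
      then show ?thesis unfolding W_def ctrl_def using mp[OF i, of j] inputs_subset[OF lcm] by auto
    qed
  qed
  have "\<exists>Q\<in>polys_over UNIV ?X. mp_eval (case_sum y0 \<mu>0) Q \<noteq> 0 \<and>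
    (\<forall>\<psi>::_ \<Rightarrow> complex. is_hom \<psi> \<and> \<psi> Q \<noteq> 0 \<longrightarrow> indep UNIV V (ctrl_idx M) (\<lambda>i c. \<psi> (W i c)))"
  proof (rule indep_certificate[OF finite_verts subring_polys_over[OF subring_UNIV] is_hom_mp_eval _ _ inR])
    show "is_subfield (UNIV :: complex set)" by (simp add: is_subfield_def)
    show "indep UNIV V (ctrl_idx M) (\<lambda>i c. mp_eval (case_sum y0 \<mu>0) (W i c))" unfolding ctrl_eq by (rule pt)
  qed simp_all
  then obtain Q where QR: "Q \<in> polys_over UNIV ?X" and Q0: "mp_eval (case_sum y0 \<mu>0) Q \<noteq> 0"
    and Qi: "\<forall>\<psi>::_ \<Rightarrow> complex. is_hom \<psi> \<and> \<psi> Q \<noteq> 0 \<longrightarrow> indep UNIV V (ctrl_idx M) (\<lambda>i c. \<psi> (W i c))"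
    by (elim bexE conjE)
  have Q: "mp_vars Q \<subseteq> ?X" "mp_eval (case_sum y0 \<mu>0) Q \<noteq> 0"
    "is_hom \<psi> \<Longrightarrow> \<psi> Q \<noteq> 0 \<Longrightarrow> indep UNIV V (ctrl_idx M) (\<lambda>i c. \<psi> (W i c))" for \<psi> :: "_ \<Rightarrow> complex"
    using QR[unfolded polys_over_UNIV] Q0 Qi by blast+
  show thesis
    by (rule that[OF Q(1)]) (use Q(2,3) ctrl_eq is_hom_mp_eval in blast)+
qed

text \<open>Only \<open>\<mu>\<close> is generic here, since \<open>S_set\<close> ranges over arbitrary competing parameter values.\<close>

definition determined :: "ratfun \<Rightarrow> bool" where
  "determined h \<longleftrightarrow> (\<exists>Q. mp_vars Q \<subseteq> {1..N} \<and> Q \<noteq> 0 \<and> (\<forall>\<mu> \<mu>'. mp_eval \<mu> Q \<noteq> 0 \<longrightarrow>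
     coeffs_regular \<mu> \<longrightarrow> coeffs_regular \<mu>' \<longrightarrow> (\<forall>g\<in>coeffs_set. rf_eval \<mu> g = rf_eval \<mu>' g) \<longrightarrow>
     reg h \<mu> \<and> reg h \<mu>' \<and> rf_eval \<mu> h = rf_eval \<mu>' h))"

lemma determinedI:
  assumes "mp_vars Q \<subseteq> {1..N}" "Q \<noteq> 0"
    "\<And>\<mu> \<mu>'. mp_eval \<mu> Q \<noteq> 0 \<Longrightarrow> coeffs_regular \<mu> \<Longrightarrow> coeffs_regular \<mu>' \<Longrightarrow>
      (\<And>g. g \<in> coeffs_set \<Longrightarrow> rf_eval \<mu> g = rf_eval \<mu>' g) \<Longrightarrow> reg h \<mu> \<and> reg h \<mu>' \<and> rf_eval \<mu> h = rf_eval \<mu>' h"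
  shows "determined h"
  unfolding determined_def using assms by (intro exI[of _ Q]) blast

lemma determinedE:
  assumes "determined h"
  obtains Q where "mp_vars Q \<subseteq> {1..N}" "Q \<noteq> 0"
    "\<And>\<mu> \<mu>'. mp_eval \<mu> Q \<noteq> 0 \<Longrightarrow> coeffs_regular \<mu> \<Longrightarrow> coeffs_regular \<mu>' \<Longrightarrow>
      (\<And>g. g \<in> coeffs_set \<Longrightarrow> rf_eval \<mu> g = rf_eval \<mu>' g) \<Longrightarrow> reg h \<mu> \<and> reg h \<mu>' \<and> rf_eval \<mu> h = rf_eval \<mu>' h"
  using assms unfolding determined_def by blast

lemma vars_mult: "mp_vars P1 \<subseteq> {1..N} \<Longrightarrow> mp_vars P2 \<subseteq> {1..N} \<Longrightarrow> mp_vars (P1 * P2 :: (nat, complex) mpoly) \<subseteq> {1..N}"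
  by (rule mp_vars_closed)

text \<open>The determined functions form a subfield that contains the constants and the
  coefficients, so they exhaust the generated field.\<close>

lemma coeff_field_determined: "h \<in> coeff_field \<Longrightarrow> determined h"
proof -
  let ?F = "{h \<in> ratfuns N. determined h}"
  have one: "mp_vars (1 :: (nat, complex) mpoly) \<subseteq> {1..N}" by simp
  have "is_subfield ?F"
    unfolding is_subfield_def
  proof (intro conjI ballI impI)
    show "1 \<in> ?F"
      using determinedI[OF one] regular_1 subfield_closed(2)[OF subfield_ratfuns] by auto
    fix x assume x: "x \<in> ?F"
    then obtain Q where Q: "mp_vars Q \<subseteq> {1..N}" "Q \<noteq> 0"
      "\<And>\<mu> \<mu>'. mp_eval \<mu> Q \<noteq> 0 \<Longrightarrow> coeffs_regular \<mu> \<Longrightarrow> coeffs_regular \<mu>' \<Longrightarrow>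
        (\<And>g. g \<in> coeffs_set \<Longrightarrow> rf_eval \<mu> g = rf_eval \<mu>' g) \<Longrightarrow> reg x \<mu> \<and> reg x \<mu>' \<and> rf_eval \<mu> x = rf_eval \<mu>' x"
      using determinedE[of x] by auto
    {
      fix y assume y: "y \<in> ?F"
      then obtain R where R: "mp_vars R \<subseteq> {1..N}" "R \<noteq> 0"
        "\<And>\<mu> \<mu>'. mp_eval \<mu> R \<noteq> 0 \<Longrightarrow> coeffs_regular \<mu> \<Longrightarrow> coeffs_regular \<mu>' \<Longrightarrow>
          (\<And>g. g \<in> coeffs_set \<Longrightarrow> rf_eval \<mu> g = rf_eval \<mu>' g) \<Longrightarrow> reg y \<mu> \<and> reg y \<mu>' \<and> rf_eval \<mu> y = rf_eval \<mu>' y"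
        using determinedE[of y] by auto
      have QR: "mp_vars (Q * R) \<subseteq> {1..N}" "Q * R \<noteq> 0" using vars_mult Q(1,2) R(1,2) by auto
      have both: "(reg x \<mu> \<and> reg x \<mu>' \<and> rf_eval \<mu> x = rf_eval \<mu>' x) \<and> (reg y \<mu> \<and> reg y \<mu>' \<and> rf_eval \<mu> y = rf_eval \<mu>' y)"
        if "mp_eval \<mu> (Q * R) \<noteq> 0" "coeffs_regular \<mu>" "coeffs_regular \<mu>'" "\<And>g. g \<in> coeffs_set \<Longrightarrow> rf_eval \<mu> g = rf_eval \<mu>' g" for \<mu> \<mu>'
      proof -
        have "mp_eval \<mu> Q \<noteq> 0" "mp_eval \<mu> R \<noteq> 0" using that(1) by (auto simp: is_hom_simps[OF is_hom_mp_eval])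
        then show ?thesis using Q(3)[of \<mu> \<mu>'] R(3)[of \<mu> \<mu>'] that(2-4) by blast
      qed
      have "determined (x - y)"
      proof (rule determinedI[OF QR], goal_cases)
        case (1 \<mu> \<mu>')
        from both[OF 1] show ?case by (simp add: regular_diff_mult[of N])
      qed
      moreover have "determined (x * y)"
      proof (rule determinedI[OF QR], goal_cases)
        case (1 \<mu> \<mu>')
        from both[OF 1] show ?case by (simp add: regular_diff_mult[of N])
      qed
      ultimately show "x - y \<in> ?F" "x * y \<in> ?F"
        using x y by (auto intro: subfield_closed[OF subfield_ratfuns])
    }
    assume x0: "x \<noteq> 0"
    have xr: "x \<in> ratfuns N" using x by simp
    \<comment> \<open>\<open>R\<close> controls the value of \<open>x\<close> at
      \<open>\<mu>\<close> only; at \<open>\<mu>'\<close> the value is nonzero because the two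
      values agree.\<close>
    obtain R where R: "mp_vars R \<subseteq> {1..N}" "R \<noteq> 0"
      "\<And>\<mu>. mp_eval \<mu> R \<noteq> 0 \<Longrightarrow> rf_regular_at N x \<mu> \<and> (x \<noteq> 0 \<longrightarrow> rf_eval \<mu> x \<noteq> 0)"
      using ratfun_generic[OF xr] by blast
    have QR: "mp_vars (Q * R) \<subseteq> {1..N}" "Q * R \<noteq> 0" using vars_mult Q(1,2) R(1,2) by auto
    have "determined (inverse x)"
    proof (rule determinedI[OF QR])
      fix \<mu> \<mu>' assume \<mu>: "mp_eval \<mu> (Q * R) \<noteq> 0" "coeffs_regular \<mu>" "coeffs_regular \<mu>'" "\<And>g. g \<in> coeffs_set \<Longrightarrow> rf_eval \<mu> g = rf_eval \<mu>' g"
      have "mp_eval \<mu> Q \<noteq> 0" "mp_eval \<mu> R \<noteq> 0" using \<mu>(1) by (auto simp: is_hom_simps[OF is_hom_mp_eval])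
      then have "reg x \<mu> \<and> reg x \<mu>' \<and> rf_eval \<mu> x = rf_eval \<mu>' x" "rf_eval \<mu> x \<noteq> 0"
        using Q(3)[of \<mu> \<mu>'] R(3)[of \<mu>] \<mu>(2-4) x0 by blast+
      then show "reg (inverse x) \<mu> \<and> reg (inverse x) \<mu>' \<and> rf_eval \<mu> (inverse x) = rf_eval \<mu>' (inverse x)"
        using regular_inverse[of N x \<mu>] regular_inverse[of N x \<mu>'] by metis
    qed
    then show "inverse x \<in> ?F" using xr by (auto intro: subfield_closed[OF subfield_ratfuns])
  qed
  moreover have "rf_const c \<in> ?F" for c
    using determinedI[OF one] const_ratfun regular_const rf_eval_const by auto
  moreover have "coeffs_set \<subseteq> ?F"
    using determinedI[OF one] coeffs_ratfun by (auto simp: coeffs_regular_def)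
  ultimately have "coeff_field \<subseteq> ?F" by (intro subfield_generated(4))
  then show "h \<in> coeff_field \<Longrightarrow> determined h" by blast
qed

text \<open>The open sets collect the conditions at the true experiment: controllability,
  independent rows, nonzero \<open>bcoef\<close> and \<open>ccoef\<close>, and the denominator
  condition of \<open>h\<close>. Any competitor then has the same coefficients, hence the same value
  of \<open>h\<close>.\<close>

lemma coeff_field_identifiable:
  assumes reach: "\<And>w. w \<in> V \<Longrightarrow> \<exists>v\<in>leaks M \<union> inputs M. reachable M w v"
    and h: "h \<in> coeff_field"
  shows "identifiable M h"
proof -
  obtain Qh where Qh: "mp_vars Qh \<subseteq> {1..N}" "Qh \<noteq> 0"
    "\<And>\<mu> \<mu>'. mp_eval \<mu> Qh \<noteq> 0 \<Longrightarrow> coeffs_regular \<mu> \<Longrightarrow> coeffs_regular \<mu>' \<Longrightarrow>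
      (\<And>g. g \<in> coeffs_set \<Longrightarrow> rf_eval \<mu> g = rf_eval \<mu>' g) \<Longrightarrow> reg h \<mu> \<and> reg h \<mu>' \<and> rf_eval \<mu> h = rf_eval \<mu>' h"
    using determinedE[OF coeff_field_determined[OF h]] by blast
  obtain Qo where Qo: "mp_vars Qo \<subseteq> {1..N}" "Qo \<noteq> 0"
    "\<And>\<mu>. mp_eval \<mu> Qo \<noteq> 0 \<Longrightarrow> (\<And>j. j \<in> outputs M \<Longrightarrow> rf_eval \<mu> (ccoef M j) \<noteq> 0) \<Longrightarrow> indep UNIV J V (obsC \<mu>)"
    using observability_certificate by blast
  obtain Qc where Qc: "mp_vars Qc \<subseteq> Inl ` V \<union> Inr ` {1..N}" "\<exists>z. mp_eval z Qc \<noteq> 0"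
    "\<And>x0 \<mu>. mp_eval (case_sum x0 \<mu>) Qc \<noteq> 0 \<Longrightarrow> indep UNIV V (ctrl_idx M) (ctrl V (A_at M \<mu>) x0)"
    using controllability_certificate[OF reach] by blast
  have "\<exists>Q. mp_vars Q \<subseteq> {1..N} \<and> Q \<noteq> 0 \<and> (\<forall>\<mu>. mp_eval \<mu> Q \<noteq> 0 \<longrightarrow> rf_eval \<mu> f \<noteq> 0)"
    if f: "f \<in> ratfuns N - {0}" for f
  proof -
    have "f \<in> ratfuns N" "f \<noteq> 0" using f by auto
    then show ?thesis using ratfun_generic[of f N] by metis
  qed
  then have "\<forall>f\<in>ratfuns N - {0}. \<exists>Q. mp_vars Q \<subseteq> {1..N} \<and> Q \<noteq> 0 \<and> (\<forall>\<mu>. mp_eval \<mu> Q \<noteq> 0 \<longrightarrow> rf_eval \<mu> f \<noteq> 0)"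
    by (intro ballI)
  from bchoice[OF this] obtain Qf where Qf0: "\<forall>f\<in>ratfuns N - {0}. mp_vars (Qf f) \<subseteq> {1..N} \<and> Qf f \<noteq> 0 \<and>
      (\<forall>\<mu>. mp_eval \<mu> (Qf f) \<noteq> 0 \<longrightarrow> rf_eval \<mu> f \<noteq> 0)" ..
  have Qf: "mp_vars (Qf f) \<subseteq> {1..N}" "Qf f \<noteq> 0" "mp_eval \<mu> (Qf f) \<noteq> 0 \<Longrightarrow> rf_eval \<mu> f \<noteq> 0"
    if "f \<in> ratfuns N" "f \<noteq> 0" for f \<mu>
    using Qf0 that by blast+
  note bF = bcoef_ratfun[OF lcm] bcoef_nonzero[OF lcm] and cF = ccoef_ratfun[OF lcm] ccoef_nonzero[OF lcm]
  define Q where "Q = Qh * Qo * (\<Prod>i\<in>inputs M. Qf (bcoef M i)) * (\<Prod>j\<in>outputs M. Qf (ccoef M j))"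
  have Q: "mp_vars Q \<subseteq> {1..N}"
    unfolding Q_def by (intro mp_vars_closed Qh(1) Qo(1) Qf(1) bF cF)
  have Q0: "Q \<noteq> 0"
    unfolding Q_def using Qh(2) Qo(2) Qf(2)[OF bF] Qf(2)[OF cF] finite_inputs[OF lcm] by simp
  have Q_ev: "mp_eval \<mu> Qh \<noteq> 0" "mp_eval \<mu> Qo \<noteq> 0" "\<And>i. i \<in> inputs M \<Longrightarrow> rf_eval \<mu> (bcoef M i) \<noteq> 0"
    "\<And>j. j \<in> outputs M \<Longrightarrow> rf_eval \<mu> (ccoef M j) \<noteq> 0" if "mp_eval \<mu> Q \<noteq> 0" for \<mu>
    using that Qf(3)[OF bF] Qf(3)[OF cF] finite_inputs[OF lcm]
    unfolding Q_def by (auto simp: is_hom_simps[OF is_hom_mp_eval])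
  let ?X = "Inl ` V \<union> Inr ` {1..N} :: (nat + nat) set"
  let ?L = "lift_poly Q"
  define T where "T = Qc * ?L"
  have L: "mp_vars ?L \<subseteq> ?X" using lift_poly_vars[OF Q] by blast
  have "\<exists>z. mp_eval z ?L \<noteq> 0"
  proof -
    obtain \<mu> where "mp_eval \<mu> Q \<noteq> 0" using mpoly_nonzero_imp_nonvanishing[OF Q0] by blast
    then have "mp_eval (case_sum \<mu> \<mu>) ?L \<noteq> 0" by (simp add: mp_eval_lift_poly)
    then show ?thesis by blast
  qed
  \<comment> \<open>Two polynomials that are not identically zero have a common nonzero, so the open
    set defined by their product is nonempty.\<close>
  then have "\<exists>z. \<forall>R\<in>{Qc, ?L}. mp_eval z R \<noteq> 0"
    using Qc(1,2) L by (intro generic_point_exists[where V = ?X]) auto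
  then have nonempty: "\<exists>z. mp_eval z T \<noteq> 0" by (auto simp: T_def is_hom_simps[OF is_hom_mp_eval])
  have T_vars: "mp_vars T \<subseteq> ?X" unfolding T_def using Qc(1) L by (intro mp_vars_closed)
  define \<Theta> where "\<Theta> = {z. mp_eval z T \<noteq> 0}"
  have \<Theta>: "\<Theta> \<in> zariski_affine ?X"
    unfolding zariski_affine_def \<Theta>_def using nonempty T_vars by blast
  obtain W where W: "W \<in> zariski_analytic (inputs M)"
    "\<And>u. u \<in> W \<Longrightarrow> input_generic (inputs M) (\<lambda>i. jet (u i)) (Suc (D + card V))"
    using generic_inputs_exist[OF finite_inputs[OF lcm]] by blast
  have "card (S_set M h x0 \<mu> u) = 1" if z: "case_sum x0 \<mu> \<in> \<Theta>" and u: "u \<in> W" and om: "(x0, \<mu>, u) \<in> Omega_of M h" for x0 \<mu> u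
  proof -
    have om': "good_point M \<mu>" "reg h \<mu>" "u \<in> analytic_tuples (inputs M)" using om by (auto simp: Omega_of_iff)
    have ev: "mp_eval (case_sum x0 \<mu>) Qc \<noteq> 0" "mp_eval \<mu> Q \<noteq> 0"
      using z by (auto simp: \<Theta>_def T_def is_hom_simps[OF is_hom_mp_eval] mp_eval_lift_poly)
    have ctrl: "indep UNIV V (ctrl_idx M) (ctrl V (A_at M \<mu>) x0)" by (rule Qc(3)[OF ev(1)])
    have obs: "indep UNIV J V (obsC \<mu>)" by (rule Qo(3)[OF Q_ev(2)[OF ev(2)] Q_ev(4)[OF ev(2)]])
    have "S_set M h x0 \<mu> u = {rf_eval \<mu> h}"
    proof
      have "rf_eval \<mu> h \<in> S_set M h x0 \<mu> u"
        unfolding S_set_def same_germs_def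
        by (rule CollectI, rule exI[of _ x0], rule exI[of _ \<mu>]) (use om in auto)
      then show "{rf_eval \<mu> h} \<subseteq> S_set M h x0 \<mu> u" by simp
      show "S_set M h x0 \<mu> u \<subseteq> {rf_eval \<mu> h}"
      proof
        fix y assume "y \<in> S_set M h x0 \<mu> u"
        then obtain x0' \<mu>' where y: "y = rf_eval \<mu>' h" "(x0', \<mu>', u) \<in> Omega_of M h"
          "same_germs (outputs M) (output_fun M x0 \<mu> u) (output_fun M x0' \<mu>' u)"
          by (auto simp: S_set_def)
        have good': "good_point M \<mu>'" using y(2) by (simp add: Omega_of_iff)
        have same: "out_jet x0 \<mu> (\<lambda>i. jet (u i)) k j = out_jet x0' \<mu>' (\<lambda>i. jet (u i)) k j" if "j \<in> outputs M" for j k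
          using y(3) that unfolding same_output_iff[OF om'(3)] by blast
        note det = coefficients_determined[OF om'(1) good' ctrl Q_ev(3)[OF ev(2)] obs W(2)[OF u] lessI same]
        have "rf_eval \<mu> h = rf_eval \<mu>' h"
          using Qh(3)[OF Q_ev(1)[OF ev(2)] det(1) det(2) det(3)] by blast
        then show "y \<in> {rf_eval \<mu> h}" using y(1) by simp
      qed
    qed
    then show ?thesis by simp
  qed
  then show ?thesis unfolding identifiable_def using \<Theta> W(1) by blast
qed

text \<open>An embedding that moves the value of \<open>h\<close> while fixing all coefficient
  values produces a second parameter with the same outputs, so \<open>S_set\<close> contains two
  values.\<close>

lemma identifiable_in_coeff_field:
  assumes ident: "identifiable M h" and h: "h \<in> ratfuns N"
  shows "h \<in> coeff_field"
proof (rule ccontr)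
  assume notin: "h \<notin> coeff_field"
  obtain \<Theta> W where \<Theta>: "\<Theta> \<in> zariski_affine (Inl ` V \<union> Inr ` {1..N})" and W: "W \<in> zariski_analytic (inputs M)"
    and id: "\<And>x0 \<mu> u. case_sum x0 \<mu> \<in> \<Theta> \<Longrightarrow> u \<in> W \<Longrightarrow> (x0, \<mu>, u) \<in> Omega_of M h \<Longrightarrow> card (S_set M h x0 \<mu> u) = 1"
    using ident unfolding identifiable_def by blast
  obtain T where T: "mp_vars T \<subseteq> Inl ` V \<union> Inr ` {1..N}" "\<Theta> = {z. mp_eval z T \<noteq> 0}" "\<exists>z. mp_eval z T \<noteq> 0"
    using \<Theta> unfolding zariski_affine_def by blast
  obtain u where u: "u \<in> W" "u \<in> analytic_tuples (inputs M)" using W unfolding zariski_analytic_def by blast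
  obtain Qo where Qo: "mp_vars Qo \<subseteq> {1..N}" "Qo \<noteq> 0"
    "\<And>\<mu>. mp_eval \<mu> Qo \<noteq> 0 \<Longrightarrow> (\<And>j. j \<in> outputs M \<Longrightarrow> rf_eval \<mu> (ccoef M j) \<noteq> 0) \<Longrightarrow> indep UNIV J V (obsC \<mu>)"
    using observability_certificate by blast
  \<comment> \<open>Everything that must keep its meaning under the embedding: the function, the
    coefficients, and the scalings of inputs and outputs. The coefficients of the observability
    certificate \<open>Qo\<close> are added when \<open>k\<close> is chosen.\<close>
  define B where "B = insert h (coeffs_set \<union> bcoef M ` inputs M \<union> ccoef M ` outputs M)"
  have B_fin: "finite B" unfolding B_def coeffs_set_def using finite_inputs[OF lcm] by simp
  have B_rat: "B \<subseteq> ratfuns N"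
    unfolding B_def using h coeffs_ratfun bcoef_ratfun[OF lcm] ccoef_ratfun[OF lcm] by auto
  have "\<forall>f\<in>ratfuns N. \<exists>C. finite C \<and> (\<forall>k. C \<subseteq> k \<longrightarrow> f \<in> ratfuns_over k N)"
    using ratfun_field_of_definition by (intro ballI)
  from bchoice[OF this] obtain C where C0: "\<forall>f\<in>ratfuns N. finite (C f) \<and> (\<forall>k. C f \<subseteq> k \<longrightarrow> f \<in> ratfuns_over k N)" ..
  have C: "finite (C f) \<and> (\<forall>k. C f \<subseteq> k \<longrightarrow> f \<in> ratfuns_over k N)" if "f \<in> ratfuns N" for f
    using C0 that by blast
  have "finite (C f)" if "f \<in> B" for f using C[of f] B_rat that by blast
  then have "finite (poly_coeffs Qo \<union> (\<Union>f\<in>B. C f))"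
    using B_fin by (simp add: poly_coeffs_def)
  from countable_subring_exists[OF countable_finite[OF this]]
  obtain k where k0: "countable k \<and> subring_set k \<and> poly_coeffs Qo \<union> (\<Union>f\<in>B. C f) \<subseteq> k" ..
  have k: "countable k" "subring_set k" "poly_coeffs Qo \<subseteq> k" "f \<in> B \<Longrightarrow> C f \<subseteq> k" for f
    using k0 by auto
  let ?K = "ratfuns_over k N"
  have BK: "f \<in> ?K" if "f \<in> B" for f using C[of f] k(4)[OF that] B_rat that by blast
  have QoK: "Qo \<in> polys_over k {1..N}" by (rule poly_coeffs_over[OF k(3) Qo(1)])
  \<comment> \<open>Avoiding the zeros of all nonzero polynomials over \<open>k\<close> makes
    evaluation at \<open>\<mu>\<close> injective on \<open>?K\<close>.\<close>
  let ?pk = "polys_over k {1..N} - {0}"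
  have "\<exists>z. \<forall>R\<in>insert T (lift_poly ` ?pk). mp_eval z R \<noteq> 0"
  proof (rule generic_point_exists[where V = "Inl ` V \<union> Inr ` {1..N}"])
    show "countable (insert T (lift_poly ` ?pk))"
      using countable_polys_over[OF k(1), of "{1..N}"] by simp
    fix R assume "R \<in> insert T (lift_poly ` ?pk)"
    then consider "R = T" | Q where "R = lift_poly Q" "Q \<in> polys_over k {1..N}" "Q \<noteq> 0" by blast
    then have "mp_vars R \<subseteq> Inl ` V \<union> Inr ` {1..N} \<and> (\<exists>z. mp_eval z R \<noteq> 0)"
    proof cases
      case 1
      then show ?thesis using T by blast
    next
      case 2
      obtain \<mu> where "mp_eval \<mu> Q \<noteq> 0" using mpoly_nonzero_imp_nonvanishing[OF 2(3)] by blast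
      then have "mp_eval (case_sum \<mu> \<mu>) R \<noteq> 0" by (simp add: 2(1) mp_eval_lift_poly)
      moreover have "mp_vars R \<subseteq> Inr ` {1..N}" unfolding 2(1) using 2(2) by (intro lift_poly_vars) (simp add: polys_over_def)
      ultimately show ?thesis by blast
    qed
    then show "mp_vars R \<subseteq> Inl ` V \<union> Inr ` {1..N}" "\<exists>z. mp_eval z R \<noteq> 0" by blast+
  qed simp
  then obtain z where z: "mp_eval z T \<noteq> 0" "\<And>Q. Q \<in> ?pk \<Longrightarrow> mp_eval z (lift_poly Q) \<noteq> 0" by blast
  define x0 \<mu> where "x0 = (\<lambda>i. z (Inl i))" and "\<mu> = (\<lambda>i. z (Inr i))"
  have z_eq: "case_sum x0 \<mu> = z" by (auto simp: x0_def \<mu>_def fun_eq_iff split: sum.split)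
  have gen: "mp_eval \<mu> Q \<noteq> 0" if "Q \<in> polys_over k {1..N}" "Q \<noteq> 0" for Q
    using z(2)[of Q] that by (simp add: mp_eval_lift_poly \<mu>_def)
  have K_sub: "is_subfield ?K" by (rule subfield_ratfuns_over[OF k(2)])
  note K_cl = subfield_closed[OF K_sub]
  have K_rep: "\<exists>P Q. f = Fract P Q \<and> P \<in> polys_over k {1..N} \<and> Q \<in> polys_over k {1..N} \<and> mp_eval \<mu> Q \<noteq> 0" if "f \<in> ?K" for f
    using that gen unfolding ratfuns_over_def by blast
  have K_reg: "reg f \<mu>" if "f \<in> ?K" for f
    using K_rep[OF that] unfolding rf_regular_at_def polys_over_def by blast
  have K_nz: "rf_eval \<mu> f \<noteq> 0" if f: "f \<in> ?K" "f \<noteq> 0" for f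
  proof -
    obtain P Q where PQ: "f = Fract P Q" "P \<in> polys_over k {1..N}" "Q \<in> polys_over k {1..N}" "mp_eval \<mu> Q \<noteq> 0"
      using K_rep[OF f(1)] by blast
    then have "P \<noteq> 0" using f(2) by (auto simp: fract_collapse)
    then show ?thesis using gen[OF PQ(2)] PQ(4) by (simp add: PQ(1) rf_eval_Fract)
  qed
  have K_inj: "f = g" if "f \<in> ?K" "g \<in> ?K" "rf_eval \<mu> f = rf_eval \<mu> g" for f g
  proof (rule ccontr)
    assume "f \<noteq> g"
    moreover have "rf_eval \<mu> (f - g) = 0"
      using regular_diff_mult(2)[OF K_reg[OF that(1)] K_reg[OF that(2)]] that(3) by simp
    ultimately show False using K_nz[OF K_cl(3)[OF that(1,2)]] by simp
  qed
  \<comment> \<open>The coefficient field contains all of \<complex>; intersecting with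
    \<open>?K\<close> makes it countable and lets every element be evaluated at
    \<open>\<mu>\<close>.\<close>
  define L where "L = rf_eval \<mu> ` (coeff_field \<inter> ?K)"
  have FK_sub: "is_subfield (coeff_field \<inter> ?K)"
    by (rule subfield_Int[OF subfield_generated(1) K_sub])
  note FK_cl = subfield_closed[OF FK_sub]
  have L_sub: "is_subfield L"
    unfolding is_subfield_def
  proof (intro conjI ballI impI)
    show "1 \<in> L" unfolding L_def using imageI[OF FK_cl(2), of "rf_eval \<mu>"] by (simp add: regular_1(2))
    fix a assume "a \<in> L"
    then obtain f where f: "f \<in> coeff_field \<inter> ?K" "a = rf_eval \<mu> f" by (auto simp: L_def)
    {
      fix b assume "b \<in> L"
      then obtain g where g: "g \<in> coeff_field \<inter> ?K" "b = rf_eval \<mu> g" by (auto simp: L_def)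
      have r: "reg f \<mu>" "reg g \<mu>" using f g K_reg by auto
      show "a - b \<in> L"
        unfolding L_def f(2) g(2) regular_diff_mult(2)[OF r, symmetric] by (rule imageI[OF FK_cl(3)[OF f(1) g(1)]])
      show "a * b \<in> L"
        unfolding L_def f(2) g(2) regular_diff_mult(4)[OF r, symmetric] by (rule imageI[OF FK_cl(4)[OF f(1) g(1)]])
    }
    assume "a \<noteq> 0"
    then have "rf_eval \<mu> (inverse f) = inverse a"
      using regular_inverse(2)[of N f \<mu>] K_reg[of f] f by simp
    then show "inverse a \<in> L"
      unfolding L_def using imageI[OF FK_cl(10)[OF f(1)], of "rf_eval \<mu>"] by simp
  qed
  have "countable ?K" by (rule countable_ratfuns_over[OF k(1)])
  then have L_count: "countable L" unfolding L_def by (intro countable_image) (rule countable_subset[OF inf_le2])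
  have hK: "h \<in> ?K" by (rule BK) (simp add: B_def)
  let ?a = "rf_eval \<mu> h"
  have aL: "?a \<notin> L"
  proof
    assume "?a \<in> L"
    then obtain f where "f \<in> coeff_field" "f \<in> ?K" "rf_eval \<mu> f = ?a" by (auto simp: L_def)
    then show False using K_inj[OF _ hK] notin by auto
  qed
  \<comment> \<open>The constants in \<open>k\<close> belong to the fixed field, so the embedding
    leaves the coefficients of polynomials over \<open>k\<close> unchanged.\<close>
  have kL: "c \<in> L" if "c \<in> k" for c
  proof -
    have "mp_const c \<in> polys_over k {1..N}" "1 \<in> polys_over k {1..N}"
      using that subring_set_0[OF k(2)] subring_set_1[OF subring_polys_over[OF k(2)]] by (auto intro: polys_over_const)
    then have "rf_const c \<in> ?K" unfolding rf_const_def ratfuns_over_def by force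
    then have "rf_const c \<in> coeff_field \<inter> ?K" using subfield_generated(2) by blast
    from imageI[OF this, of "rf_eval \<mu>"] show ?thesis unfolding L_def by (simp add: rf_eval_const)
  qed
  \<comment> \<open>Only the value of \<open>h\<close> has to move; the coordinates of
    \<open>\<mu>\<close> are included so that their images form the competing parameter.\<close>
  obtain L' \<sigma> where \<sigma>: "embedding L' \<sigma>" "L \<subseteq> L'" "?a \<in> L'" "\<mu> ` {1..N} \<subseteq> L'" "\<And>x. x \<in> L \<Longrightarrow> \<sigma> x = x" "\<sigma> ?a \<noteq> ?a"
    using moving_embedding[OF L_sub L_count aL, of "\<mu> ` {1..N}"] by blast
  interpret E: embedded_field L' \<sigma> by standard (rule \<sigma>(1))
  define \<mu>' where "\<mu>' i = \<sigma> (\<mu> i)" for i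
  have P_ev: "mp_eval \<mu> P \<in> L' \<and> mp_eval \<mu>' P = \<sigma> (mp_eval \<mu> P)" if P: "P \<in> polys_over k {1..N}" for P
  proof -
    have v: "\<mu> v \<in> L'" if "m \<in> Poly_Mapping.keys P" "v \<in> Poly_Mapping.keys m" for m v
    proof -
      have "v \<in> {1..N}" using that P unfolding polys_over_def mp_vars_def by blast
      then show ?thesis using \<sigma>(4) by blast
    qed
    have c: "Poly_Mapping.lookup P m \<in> L'" "\<sigma> (Poly_Mapping.lookup P m) = Poly_Mapping.lookup P m" for m
    proof -
      have "Poly_Mapping.lookup P m \<in> L" using P kL by (simp add: polys_over_def)
      then show "Poly_Mapping.lookup P m \<in> L'" "\<sigma> (Poly_Mapping.lookup P m) = Poly_Mapping.lookup P m"
        using \<sigma>(2,5) by auto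
    qed
    have pw: "\<mu> v ^ Poly_Mapping.lookup m v \<in> L'" if "m \<in> Poly_Mapping.keys P" "v \<in> Poly_Mapping.keys m" for m v
      using v[OF that] by (rule E.closed)
    have pr: "(\<Prod>v\<in>Poly_Mapping.keys m. \<mu> v ^ Poly_Mapping.lookup m v) \<in> L'" if "m \<in> Poly_Mapping.keys P" for m
      using pw[OF that] by (rule E.closed)
    have tm: "Poly_Mapping.lookup P m * (\<Prod>v\<in>Poly_Mapping.keys m. \<mu> v ^ Poly_Mapping.lookup m v) \<in> L'" if "m \<in> Poly_Mapping.keys P" for m
      by (intro E.closed c pr that)
    have "\<sigma> (mp_eval \<mu> P) = (\<Sum>m\<in>Poly_Mapping.keys P. \<sigma> (Poly_Mapping.lookup P m *
        (\<Prod>v\<in>Poly_Mapping.keys m. \<mu> v ^ Poly_Mapping.lookup m v)))"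
      unfolding mp_eval_def by (rule E.\<sigma>_sum[OF tm])
    also have "\<dots> = mp_eval \<mu>' P"
      unfolding mp_eval_def
    proof (rule sum.cong[OF refl])
      fix m assume m: "m \<in> Poly_Mapping.keys P"
      have "\<sigma> (\<Prod>v\<in>Poly_Mapping.keys m. \<mu> v ^ Poly_Mapping.lookup m v) = (\<Prod>v\<in>Poly_Mapping.keys m. \<mu>' v ^ Poly_Mapping.lookup m v)"
      proof -
        have "\<sigma> (\<Prod>v\<in>Poly_Mapping.keys m. \<mu> v ^ Poly_Mapping.lookup m v) =
            (\<Prod>v\<in>Poly_Mapping.keys m. \<sigma> (\<mu> v ^ Poly_Mapping.lookup m v))"
          by (rule E.\<sigma>_prod) (rule pw[OF m])
        also have "\<dots> = (\<Prod>v\<in>Poly_Mapping.keys m. \<mu>' v ^ Poly_Mapping.lookup m v)"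
          unfolding \<mu>'_def by (intro prod.cong refl E.\<sigma>_power v[OF m])
        finally show ?thesis .
      qed
      then show "\<sigma> (Poly_Mapping.lookup P m * (\<Prod>v\<in>Poly_Mapping.keys m. \<mu> v ^ Poly_Mapping.lookup m v)) =
          Poly_Mapping.lookup P m * (\<Prod>v\<in>Poly_Mapping.keys m. \<mu>' v ^ Poly_Mapping.lookup m v)"
        by (simp add: E.\<sigma>_mult[OF c(1) pr[OF m]] c(2))
    qed
    finally have "\<sigma> (mp_eval \<mu> P) = mp_eval \<mu>' P" .
    moreover have "mp_eval \<mu> P \<in> L'" unfolding mp_eval_def using tm by (rule E.closed)
    ultimately show ?thesis by simp
  qed
  have K': "reg f \<mu>' \<and> rf_eval \<mu> f \<in> L' \<and> rf_eval \<mu>' f = \<sigma> (rf_eval \<mu> f)" if fK: "f \<in> ?K" for f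
  proof -
    obtain P Q where PQ: "f = Fract P Q" "P \<in> polys_over k {1..N}" "Q \<in> polys_over k {1..N}" "mp_eval \<mu> Q \<noteq> 0"
      using K_rep[OF fK] by blast
    note p = P_ev[OF PQ(2)] and q = P_ev[OF PQ(3)]
    have q': "mp_eval \<mu>' Q \<noteq> 0" using q PQ(4) E.\<sigma>_eq_0 by metis
    have fL: "rf_eval \<mu> f \<in> L'" unfolding PQ(1) rf_eval_Fract[OF PQ(4)] using p q by (intro E.closed) auto
    have "rf_eval \<mu> f * mp_eval \<mu> Q = mp_eval \<mu> P" unfolding PQ(1) rf_eval_Fract[OF PQ(4)] using PQ(4) by simp
    then have "\<sigma> (rf_eval \<mu> f) * mp_eval \<mu>' Q = mp_eval \<mu>' P"
      using E.\<sigma>_mult[OF fL, of "mp_eval \<mu> Q"] p q by simp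
    then have "rf_eval \<mu>' f = \<sigma> (rf_eval \<mu> f)"
      unfolding PQ(1) rf_eval_Fract[OF q'] using q' by (simp add: field_simps)
    moreover have "reg f \<mu>'" unfolding rf_regular_at_def using PQ q' unfolding polys_over_def by blast
    ultimately show ?thesis using fL by blast
  qed
  have G_in: "g \<in> ?K" if "g \<in> coeffs_set" for g using BK that by (simp add: B_def)
  have good: "good_point M \<mu>" "good_point M \<mu>'"
    unfolding good_point_def using BK K_reg K' by (auto simp: B_def)
  have cr: "coeffs_regular \<mu>" "coeffs_regular \<mu>'"
    unfolding coeffs_regular_def using G_in K_reg K' by blast+
  have eqG: "rf_eval \<mu> g = rf_eval \<mu>' g" if "g \<in> coeffs_set" for g
  proof -
    have "g \<in> coeff_field" using that subfield_generated(3) by blast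
    then have "rf_eval \<mu> g \<in> L" using G_in[OF that] by (simp add: L_def)
    then show ?thesis using K'[OF G_in[OF that]] \<sigma>(5) by simp
  qed
  \<comment> \<open>Embeddings preserve nonvanishing, so the certificate and the output scalings
    remain nonzero at \<open>\<mu>'\<close>.\<close>
  have ind: "indep UNIV J V (obsC \<mu>')"
  proof (rule Qo(3))
    show "mp_eval \<mu>' Qo \<noteq> 0" using P_ev[OF QoK] gen[OF QoK Qo(2)] E.\<sigma>_eq_0 by metis
    fix j assume j: "j \<in> outputs M"
    then have cK: "ccoef M j \<in> ?K" using BK by (simp add: B_def)
    show "rf_eval \<mu>' (ccoef M j) \<noteq> 0"
      using K'[OF cK] K_nz[OF cK ccoef_nonzero[OF lcm j]] E.\<sigma>_eq_0 by metis
  qed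
  obtain x0' where x0': "\<forall>j\<in>outputs M. \<forall>k. out_jet x0 \<mu> (\<lambda>i. jet (u i)) k j = out_jet x0' \<mu>' (\<lambda>i. jet (u i)) k j"
    using matching_initial_state[OF good(1) cr(1) good(2) cr(2) eqG ind] by blast
  have om: "(x0, \<mu>, u) \<in> Omega_of M h" "(x0', \<mu>', u) \<in> Omega_of M h"
    using good u(2) K_reg[OF hK] K'[OF hK] by (auto simp: Omega_of_iff)
  have "same_germs (outputs M) (output_fun M x0 \<mu> u) (output_fun M x0' \<mu>' u)"
    using x0' unfolding same_output_iff[OF u(2)] .
  \<comment> \<open>The primed point enters only as a competitor in \<open>S_set\<close>; membership
    in \<open>\<Theta>\<close> is asked of the unprimed point.\<close>
  then have "rf_eval \<mu>' h \<in> S_set M h x0 \<mu> u" using om(2) unfolding S_set_def by blast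
  moreover have "?a \<in> S_set M h x0 \<mu> u"
    unfolding S_set_def same_germs_def
    by (rule CollectI, rule exI[of _ x0], rule exI[of _ \<mu>]) (use om(1) in auto)
  moreover have "card (S_set M h x0 \<mu> u) = 1"
    using id[OF _ u(1) om(1)] z(1) by (simp add: T(2) z_eq)
  ultimately have "rf_eval \<mu>' h = ?a" by (metis card_1_singletonE singletonD)
  then show False using \<sigma>(6) K'[OF hK] by simp
qed

end

text \<open>Existence of a full set is asserted as well, so that the equality for all full sets is
  not vacuous. Since one side does not mention \<open>p\<close>, the equality also shows that under
  these hypotheses the field of IO-identifiable functions does not depend on the choice of the full
  set.\<close>

theorem mainTheorem2:
  fixes M :: compartment_model
  assumes "linear_compartment_model M"
    and "\<And>w. w \<in> verts M \<Longrightarrow> \<exists>v\<in>leaks M \<union> inputs M. reachable M w v"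
  shows "(\<exists>ys p. full_io_equations M ys p) \<and>
    (\<forall>ys p. full_io_equations M ys p \<longrightarrow> identifiable_field M = io_field M p)"
proof (intro conjI allI impI)
  show "\<exists>ys p. full_io_equations M ys p" by (rule full_io_equations_exist[OF assms(1)])
  fix ys p assume full: "full_io_equations M ys p"
  show "identifiable_field M = io_field M p"
  proof (rule full_io_equations_structure[OF assms(1) full])
    fix n P D
    assume gens: "(\<Union>l\<in>{1..nouts M}. Poly_Mapping.lookup (p l) ` Poly_Mapping.keys (p l)) =
        (\<Union>l\<in>outputs M. Poly_Mapping.lookup (P l) ` Poly_Mapping.keys (P l))"
      and basis: "indep (ratfuns (npars M)) {(j, k). j \<in> outputs M \<and> k < n j} (verts M) (obsK M)"
      and eqs: "\<And>l. l \<in> outputs M \<Longrightarrow> P l \<in> I_Sigma M \<and> P l \<in> dpolys M (io_indets M) \<and>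
        P l = io_form M D 0 (oc (P l)) (ic (P l)) \<and> oc (P l) l (n l) = 1 \<and> n l < D \<and>
        (\<forall>j k. oc (P l) j k \<noteq> 0 \<longrightarrow> j \<in> outputs M \<and> k < D \<and> (k < n j \<or> j = l \<and> k = n l))"
    interpret io_system M n P D by (rule io_system.intro[OF assms(1) basis eqs])
    have "io_field M p = coeff_field"
      unfolding io_field_def gens coeffs_set_def ..
    moreover have "identifiable_field M = coeff_field"
      using identifiable_in_coeff_field coeff_field_identifiable[OF assms(2)] coeff_field_ratfun
      unfolding identifiable_field_def by blast
    ultimately show ?thesis by simp
  qed
qed

end
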